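(* Consider a sequence of $M/GI/\infty$ queues indexed by $n\in\mathbb{N}^*$, where the $n$-th system has initial profile $\mu_0^n$ (a random element of $\mathcal{M}_f^+$), Poisson arrivals of intensity $\lambda^n$, and i.i.d. service times with nonatomic distribution $\alpha^n$ satisfying $\langle\alpha^n,I\rangle<\infty$. Let $(\mu^n_t)_{t\ge0}$ be its profile process and $\bar\mu^n$ the normalized profile process. Assume: (i) $\lambda^n\to\lambda$ for some $\lambda>0$; (ii) for every $\varepsilon>0$ there is $M_\varepsilon>0$ with $\mathbf{P}[\langle\mu_0^n,\mathbf{1}\rangle>nM_\varepsilon]\le\varepsilon$ for all $n$; (iii) there is $\bar\mu_0^*\in\mathcal{M}_f^+$ with $\langle\bar\mu_0^*,I\rangle<\infty$ such that $\langle\bar\mu_0^n,f\rangle\to\langle\bar\mu_0^*,f\rangle$ in probability for every $f\in\mathcal{D}_b$; (iv) there is a nonatomic probability distribution $\bar\alpha^*$ such that $\bar\alpha^n\to\bar\alpha^*$ weakly and $\langle\bar\alpha^n,I\rangle\to\langle\bar\alpha^*,I\rangle<\infty$. Then $\bar\mu^n\Rightarrow\bar\mu^*$ in $\mathcal{D}([0,\infty),\mathcal{M}_f^+)$, where $\bar\mu^*$ is the deterministic element of $\mathcal{C}([0,\infty),\mathcal{M}_f^+)$ defined for all $t\ge0$ and all $\phi\in\mathcal{D}_b$ by $$\langle\bar\mu_t^*,\phi\rangle=\langle\bar\mu_0^*,\tau_t\phi\rangle+\lambda\int_0^t\langle\bar\alpha^*,\tau_s\phi\rangle\,ds.$$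
   Context: $\mathcal{M}_f^+$ is the set of finite nonnegative measures on $\mathbb{R}$ with the weak topology $\sigma(\mathcal{M}_f^+,\mathcal{C}_b)$; $\langle\mu,f\rangle=\int f\,d\mu$. $\mathcal{D}_b$ is the set of bounded right-continuous real functions on $\mathbb{R}$ with left limits; $\mathbf{1}$ is the constant function $1$, $I(x)=x$. For a function $f$, $\tau_xf(\cdot)=f(\cdot-x)$; for a measure, $\tau_x\nu(B)=\nu(B-x)$. $\mathcal{D}([0,\infty),\mathcal{M}_f^+)$ carries the Skorokhod topology, $\Rightarrow$ denotes convergence in distribution. The $n$-th $M/GI/\infty$ queue: customers arrive at the points $T_i^n$ of a Poisson process $(N^n_t)$ of intensity $\lambda^n$, the $i$-th customer requests service time $\sigma_i^n$ (i.i.d. with law $\alpha^n$, independent of arrivals) and is served immediately. Its profile process is $\mu_t^n=\tau_t\mu_0^n+\sum_{i=1}^{N_t^n}\delta_{T_i^n+\sigma_i^n-t}$ (atoms at remaining processing times). The normalized process is defined by $\bar\mu_t^n(B)=\mu^n_{nt}(nB)/n$ for Borel $B$, where $nB=\{nx:x\in B\}$; in particular $\bar\mu^n_0(B)=\mu^n_0(nB)/n$. $\bar\alpha^n$ is the law of $\sigma^n/n$, i.e. $\bar\alpha^n(B)=\alpha^n(nB)$.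
   Formalization: The initial profile is shifted so that mass at y moves to y−t (remaining times decrease), i.e. τ_tμ_0(B)=μ_0(B+t); with the stated τ_tν(B)=ν(B−t) the claim fails, e.g. for μ_0^n=nδ_{5n}, where the profile contributes δ_{5+t} but the limit formula gives δ_{5−t}. *)

theory Defs
  imports "HOL-Probability.Probability"
begin

definition fmeas :: "real measure set" where
  "fmeas = {\<mu>. sets \<mu> = sets borel \<and> emeasure \<mu> UNIV < \<infinity>}"

definition pair :: "real measure \<Rightarrow> (real \<Rightarrow> real) \<Rightarrow> real" where
  "pair \<mu> f = (\<integral>x. f x \<partial>\<mu>)"

text \<open>The pairing with the identity I(x) = x (read as the integral of the positive part,
  which is the integral of x when the measure lives on the nonnegative half line).\<close>
definition pairI :: "real measure \<Rightarrow> ennreal" where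
  "pairI \<mu> = (\<integral>\<^sup>+x. ennreal x \<partial>\<mu>)"

definition nonatomic :: "real measure \<Rightarrow> bool" where
  "nonatomic \<mu> \<longleftrightarrow> (\<forall>x. emeasure \<mu> {x} = 0)"

definition Cb :: "(real \<Rightarrow> real) set" where
  "Cb = {f. continuous_on UNIV f \<and> bounded (range f)}"

definition Db :: "(real \<Rightarrow> real) set" where
  "Db = {f. bounded (range f) \<and> (\<forall>x. continuous (at_right x) f)
             \<and> (\<forall>x. \<exists>l. (f \<longlongrightarrow> l) (at_left x))}"

text \<open>Convergence in the weak topology sigma(M_f^+, C_b) (metrizable, so sequential).\<close>
definition wconv :: "(nat \<Rightarrow> real measure) \<Rightarrow> real measure \<Rightarrow> bool" where
  "wconv \<nu>s \<nu> \<longleftrightarrow> (\<forall>f\<in>Cb. (\<lambda>k. pair (\<nu>s k) f) \<longlonglongrightarrow> pair \<nu> f)"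

text \<open>Bounded-Lipschitz metric; it metrizes the weak topology on finite measures on the line.\<close>
definition dBL :: "real measure \<Rightarrow> real measure \<Rightarrow> real" where
  "dBL \<mu> \<nu> = Sup {\<bar>pair \<mu> f - pair \<nu> f\<bar> | f.
                 (\<forall>x. \<bar>f x\<bar> \<le> 1) \<and> (\<forall>x y. \<bar>f x - f y\<bar> \<le> \<bar>x - y\<bar>)}"

text \<open>Paths are functions real => real measure; only their values at t >= 0 matter.\<close>
definition Dspace :: "(real \<Rightarrow> real measure) set" where
  "Dspace = {x. (\<forall>t\<ge>0. x t \<in> fmeas)
     \<and> (\<forall>t\<ge>0. ((\<lambda>s. dBL (x s) (x t)) \<longlongrightarrow> 0) (at_right t))
     \<and> (\<forall>t>0. \<exists>\<nu>\<in>fmeas. ((\<lambda>s. dBL (x s) \<nu>) \<longlongrightarrow> 0) (at_left t))}"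

definition skor_conv :: "(nat \<Rightarrow> real \<Rightarrow> real measure) \<Rightarrow> (real \<Rightarrow> real measure) \<Rightarrow> bool" where
  "skor_conv xs x \<longleftrightarrow> (\<exists>lam :: nat \<Rightarrow> real \<Rightarrow> real.
      (\<forall>k. strict_mono_on {0..} (lam k) \<and> continuous_on {0..} (lam k) \<and> lam k ` {0..} = {0..})
    \<and> (\<forall>T>0. \<forall>\<epsilon>>0. eventually (\<lambda>k. \<forall>t\<in>{0..T}. \<bar>lam k t - t\<bar> \<le> \<epsilon>) sequentially)
    \<and> (\<forall>T>0. \<forall>\<epsilon>>0. eventually (\<lambda>k. \<forall>t\<in>{0..T}. dBL (xs k (lam k t)) (x t) \<le> \<epsilon>) sequentially))"

definition conv_dist_D :: "(nat \<Rightarrow> 'a measure) \<Rightarrow> (nat \<Rightarrow> 'a \<Rightarrow> real \<Rightarrow> real measure)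
    \<Rightarrow> (real \<Rightarrow> real measure) \<Rightarrow> bool" where
  "conv_dist_D M X x \<longleftrightarrow> (\<forall>F :: (real \<Rightarrow> real measure) \<Rightarrow> real.
      (\<exists>B. \<forall>y\<in>Dspace. \<bar>F y\<bar> \<le> B)
      \<and> (\<forall>ys y. (\<forall>k. ys k \<in> Dspace) \<and> y \<in> Dspace \<and> skor_conv ys y \<longrightarrow> (\<lambda>k. F (ys k)) \<longlonglongrightarrow> F y)
      \<longrightarrow> (\<lambda>n. \<integral>\<omega>. indicator {\<omega>. X n \<omega> \<in> Dspace} \<omega> * F (X n \<omega>) \<partial>M n) \<longlonglongrightarrow> F x)"

definition arr :: "(nat \<Rightarrow> real) \<Rightarrow> nat \<Rightarrow> real" where
  "arr E k = (\<Sum>j\<le>k. E j)"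

text \<open>Profile at time t: the initial profile shifted by t to the left (remaining times
  decrease) plus atoms at T_k + sigma_k - t for the customers arrived by time t.\<close>
definition prof :: "real measure \<Rightarrow> (nat \<Rightarrow> real) \<Rightarrow> (nat \<Rightarrow> real) \<Rightarrow> real \<Rightarrow> real measure" where
  "prof \<mu>0 T \<sigma> t = measure_of UNIV (sets borel)
     (\<lambda>B. emeasure \<mu>0 {y. y - t \<in> B} + (\<Sum>k\<in>{k. T k \<le> t}. indicator B (T k + \<sigma> k - t)))"

definition nrm :: "nat \<Rightarrow> real measure \<Rightarrow> real measure" where
  "nrm n \<nu> = scale_measure (ennreal (1 / real n)) (distr \<nu> borel (\<lambda>x. x / real n))"

definition nprof :: "nat \<Rightarrow> real measure \<Rightarrow> (nat \<Rightarrow> real) \<Rightarrow> (nat \<Rightarrow> real) \<Rightarrow> real \<Rightarrow> real measure" where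
  "nprof n \<mu>0 T \<sigma> t = nrm n (prof \<mu>0 T \<sigma> (real n * t))"

end

theory Submission imports Defs begin

text \<open>
  After a shift by the current time, which is an isometry for the bounded-Lipschitz distance, the
  normalized profile is the sum of the normalized initial profile and of the empirical measure
  (1/n) sum delta((T_k + sigma_k)/n) over the customers with T_k/n <= t. The latter
  is increasing in t, so local uniformity in t follows from convergence at fixed times together with
  convergence of the masses on a time grid. At a fixed time and for a Lipschitz test function f, the
  arrival time T_k may be replaced by its mean k/lambda (the error is controlled in L1 by
  the variance of the Erlang law), after which the sum has independent bounded terms, and its mean is
  a Riemann sum for the integral of f against the inflow measure. Finitely many Lipschitz test functions
  suffice to control the bounded-Lipschitz distance. Since the limit path is continuous, locally
  uniform convergence in probability yields convergence of every bounded Skorokhod-continuous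
  functional F.

  The Bochner integral of a non-measurable function is 0 and the probability spaces need not be
  complete, so measurability of F(X) on the event that X is cadlag has to hold on the whole
  space, including exceptional sets where the arrival times accumulate. It is obtained by
  discretizing time and quantizing the measures: a random path with countably many possible values
  poses no measurability problem, whatever F is, and F(X) is a limit of such compositions.
\<close>

section \<open>Finite measures and the bounded-Lipschitz distance\<close>

text \<open>The condition T_k/n <= t jumps as a function of T_k, so moving T_k to its mean k/lambda
  is harmless only for customers whose mean arrival time is away from t. Those within eta of t are
  merely counted: they contribute about 2*eta*lambda, which does not vanish in n and is removed at
  the very end by letting eta tend to 0. For the others a changed indicator costs at most 1/eta
  times the deviation of T_k/n, so an averaged L1 bound on the deviations is enough. The second
  obstacle is that nothing is known about F beyond boundedness and sequential continuity on
  \<open>Dspace\<close>, while membership in \<open>Dspace\<close> has to be decided for every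
  outcome. It turns out to depend on the arrival times alone: the mass of the profile is a constant
  plus 1/n times the number of arrivals, and between arrivals the profile is only
  translated.\<close>

definition bdd_borel :: "(real \<Rightarrow> real) set" where
  "bdd_borel = {f. f \<in> borel_measurable borel \<and> (\<exists>B. \<forall>x. \<bar>f x\<bar> \<le> B)}"

definition unit_lip :: "(real \<Rightarrow> real) set" where
  "unit_lip = {f. (\<forall>x. \<bar>f x\<bar> \<le> 1) \<and> (\<forall>x y. \<bar>f x - f y\<bar> \<le> \<bar>x - y\<bar>)}"

text \<open>The Lipschitz constant is left free because hat functions on a fine grid are steep; the
  bound 1 keeps a factor sup|f| out of the termwise estimates.\<close>

definition bdd_lip :: "(real \<Rightarrow> real) set" where
  "bdd_lip = {f. (\<forall>x. \<bar>f x\<bar> \<le> 1) \<and> (\<exists>L\<ge>0. \<forall>x y. \<bar>f x - f y\<bar> \<le> L * \<bar>x - y\<bar>)}"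

lemma fmeas_sets: "\<mu> \<in> fmeas \<Longrightarrow> sets \<mu> = sets borel"
  by (simp add: fmeas_def)

lemma fmeas_space: "\<mu> \<in> fmeas \<Longrightarrow> space \<mu> = UNIV"
  using sets_eq_imp_space_eq[of \<mu> borel] by (simp add: fmeas_def)

lemma fmeas_finite: "\<mu> \<in> fmeas \<Longrightarrow> finite_measure \<mu>"
  by (rule finite_measureI) (simp add: fmeas_space, simp add: fmeas_def less_top)

lemma fmeasI: "sets \<mu> = sets borel \<Longrightarrow> finite_measure \<mu> \<Longrightarrow> \<mu> \<in> fmeas"
  using sets_eq_imp_space_eq[of \<mu> borel] finite_measure.emeasure_finite[of \<mu> UNIV]
  by (simp add: fmeas_def less_top)

lemma fmeas_measurable: "\<mu> \<in> fmeas \<Longrightarrow> f \<in> borel_measurable borel \<Longrightarrow> f \<in> borel_measurable \<mu>"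
  by (subst measurable_cong_sets[OF fmeas_sets refl])

lemma bdd_borel_const [simp]: "(\<lambda>_. c) \<in> bdd_borel"
  by (auto simp: bdd_borel_def)

lemma bdd_borel_bound: assumes "f \<in> bdd_borel" obtains B where "B \<ge> 0" "\<And>x. \<bar>f x\<bar> \<le> B"
proof -
  from assms obtain B where B: "\<And>x. \<bar>f x\<bar> \<le> B" by (auto simp: bdd_borel_def)
  have "0 \<le> B" using B[of 0] by linarith
  with B that show ?thesis by blast
qed

lemma bdd_borel_measurable: "f \<in> bdd_borel \<Longrightarrow> f \<in> borel_measurable borel"
  by (simp add: bdd_borel_def)

lemma bdd_borel_add: assumes "f \<in> bdd_borel" "g \<in> bdd_borel" shows "(\<lambda>x. f x + g x) \<in> bdd_borel"
proof -
  obtain B C where "\<And>x. \<bar>f x\<bar> \<le> B" "\<And>x. \<bar>g x\<bar> \<le> C" using bdd_borel_bound assms by metis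
  then have "\<bar>f x + g x\<bar> \<le> B + C" for x using abs_triangle_ineq[of "f x" "g x"] add_mono order_trans by blast
  moreover have "(\<lambda>x. f x + g x) \<in> borel_measurable borel"
    using assms by (auto simp: bdd_borel_def)
  ultimately show ?thesis by (auto simp: bdd_borel_def)
qed

lemma bdd_borel_mult: assumes "f \<in> bdd_borel" shows "(\<lambda>x. c * f x) \<in> bdd_borel"
proof -
  obtain B where B: "\<And>x. \<bar>f x\<bar> \<le> B" using bdd_borel_bound assms by metis
  have "\<bar>c * f x\<bar> \<le> \<bar>c\<bar> * B" for x using B by (simp add: abs_mult mult_left_mono)
  moreover have "(\<lambda>x. c * f x) \<in> borel_measurable borel"
    using assms by (auto simp: bdd_borel_def)
  ultimately show ?thesis by (auto simp: bdd_borel_def)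
qed

lemma bdd_borel_diff: "f \<in> bdd_borel \<Longrightarrow> g \<in> bdd_borel \<Longrightarrow> (\<lambda>x. f x - g x) \<in> bdd_borel"
  using bdd_borel_add[of f "\<lambda>x. (-1) * g x"] bdd_borel_mult[of g "-1"] by simp

lemma bdd_borel_abs: "f \<in> bdd_borel \<Longrightarrow> (\<lambda>x. \<bar>f x\<bar>) \<in> bdd_borel"
  by (auto simp: bdd_borel_def)

lemma bdd_borel_sum: "(\<And>i. i \<in> I \<Longrightarrow> f i \<in> bdd_borel) \<Longrightarrow> (\<lambda>x. \<Sum>i\<in>I. f i x) \<in> bdd_borel"
  by (induction I rule: infinite_finite_induct) (auto intro!: bdd_borel_add)

lemma bdd_borel_comp: "f \<in> bdd_borel \<Longrightarrow> g \<in> borel_measurable borel \<Longrightarrow> (\<lambda>x. f (g x)) \<in> bdd_borel"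
  by (auto simp: bdd_borel_def)

lemma bdd_borel_shift: "f \<in> bdd_borel \<Longrightarrow> (\<lambda>x. f (x - t)) \<in> bdd_borel"
  by (rule bdd_borel_comp) auto

lemma fmeas_integrable: assumes "\<mu> \<in> fmeas" "f \<in> bdd_borel" shows "integrable \<mu> f"
proof -
  interpret finite_measure \<mu> by (rule fmeas_finite[OF assms(1)])
  obtain B where "\<And>x. \<bar>f x\<bar> \<le> B" using bdd_borel_bound[OF assms(2)] by metis
  then show ?thesis
    using fmeas_measurable[OF assms(1) bdd_borel_measurable[OF assms(2)]]
    by (intro integrable_const_bound[where B=B]) auto
qed

lemma pair_const: "\<mu> \<in> fmeas \<Longrightarrow> pair \<mu> (\<lambda>_. c) = c * measure \<mu> UNIV"
  by (simp add: pair_def fmeas_space)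

lemma pair_add: "\<mu> \<in> fmeas \<Longrightarrow> f \<in> bdd_borel \<Longrightarrow> g \<in> bdd_borel \<Longrightarrow>
    pair \<mu> (\<lambda>x. f x + g x) = pair \<mu> f + pair \<mu> g"
  unfolding pair_def by (intro Bochner_Integration.integral_add fmeas_integrable)

lemma pair_diff: "\<mu> \<in> fmeas \<Longrightarrow> f \<in> bdd_borel \<Longrightarrow> g \<in> bdd_borel \<Longrightarrow>
    pair \<mu> (\<lambda>x. f x - g x) = pair \<mu> f - pair \<mu> g"
  unfolding pair_def by (intro Bochner_Integration.integral_diff fmeas_integrable)

lemma pair_mult: "pair \<mu> (\<lambda>x. c * f x) = c * pair \<mu> f"
  unfolding pair_def by simp

lemma pair_sum: "\<mu> \<in> fmeas \<Longrightarrow> (\<And>i. i \<in> I \<Longrightarrow> f i \<in> bdd_borel) \<Longrightarrow>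
    pair \<mu> (\<lambda>x. \<Sum>i\<in>I. f i x) = (\<Sum>i\<in>I. pair \<mu> (f i))"
  unfolding pair_def by (intro Bochner_Integration.integral_sum fmeas_integrable) auto

lemma pair_mono: "\<mu> \<in> fmeas \<Longrightarrow> f \<in> bdd_borel \<Longrightarrow> g \<in> bdd_borel \<Longrightarrow> (\<And>x. f x \<le> g x) \<Longrightarrow> pair \<mu> f \<le> pair \<mu> g"
  unfolding pair_def by (intro integral_mono fmeas_integrable) auto

lemma pair_abs_le: assumes "\<mu> \<in> fmeas" "f \<in> bdd_borel" "g \<in> bdd_borel" "\<And>x. \<bar>f x\<bar> \<le> g x"
  shows "\<bar>pair \<mu> f\<bar> \<le> pair \<mu> g"
proof -
  have "\<bar>pair \<mu> f\<bar> \<le> pair \<mu> (\<lambda>x. \<bar>f x\<bar>)" unfolding pair_def by (rule integral_abs_bound)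
  also have "\<dots> \<le> pair \<mu> g" by (intro pair_mono assms bdd_borel_abs)
  finally show ?thesis .
qed

lemma pair_bound: "\<mu> \<in> fmeas \<Longrightarrow> f \<in> bdd_borel \<Longrightarrow> (\<And>x. \<bar>f x\<bar> \<le> B) \<Longrightarrow> \<bar>pair \<mu> f\<bar> \<le> B * measure \<mu> UNIV"
  using pair_abs_le[of \<mu> f "\<lambda>_. B"] by (simp add: pair_const)

lemma bdd_lip_measurable: assumes "f \<in> bdd_lip" shows "f \<in> borel_measurable borel" "continuous_on UNIV f"
proof -
  from assms obtain L where L: "L \<ge> 0" "\<And>x y. \<bar>f x - f y\<bar> \<le> L * \<bar>x - y\<bar>" by (auto simp: bdd_lip_def)
  have "L-lipschitz_on UNIV f"
    by (rule lipschitz_onI) (use L in \<open>auto simp: dist_real_def\<close>)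
  then show "continuous_on UNIV f" by (rule lipschitz_on_continuous_on)
  then show "f \<in> borel_measurable borel" by (rule borel_measurable_continuous_onI)
qed

lemma bdd_lip_bdd_borel: "f \<in> bdd_lip \<Longrightarrow> f \<in> bdd_borel"
  using bdd_lip_measurable(1)[of f] by (auto simp: bdd_borel_def bdd_lip_def)

lemma bdd_lip_Cb: "f \<in> bdd_lip \<Longrightarrow> f \<in> Cb"
  using bdd_lip_measurable(2)[of f] by (auto simp: Cb_def bdd_lip_def bounded_iff)

lemma Cb_Db: assumes "f \<in> Cb" shows "f \<in> Db"
proof -
  have c: "isCont f x" for x using assms by (simp add: Cb_def continuous_on_eq_continuous_at)
  have "continuous (at_right x) f" for x by (rule continuous_at_imp_continuous_within[OF c])
  moreover have "(f \<longlongrightarrow> f x) (at_left x)" for x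
    using continuous_at_imp_continuous_within[OF c, of x "{..<x}"] by (simp add: continuous_within)
  ultimately show ?thesis using assms by (auto simp: Db_def Cb_def)
qed

lemma unit_lip_bdd_lip: "f \<in> unit_lip \<Longrightarrow> f \<in> bdd_lip"
  by (auto simp: unit_lip_def bdd_lip_def intro!: exI[of _ 1])

lemma unit_lip_bdd_borel: "f \<in> unit_lip \<Longrightarrow> f \<in> bdd_borel"
  by (intro bdd_lip_bdd_borel unit_lip_bdd_lip)

lemma bdd_lip_Db: "f \<in> bdd_lip \<Longrightarrow> f \<in> Db"
  by (intro Cb_Db bdd_lip_Cb)

lemma bdd_lip_const: "\<bar>c\<bar> \<le> 1 \<Longrightarrow> (\<lambda>_. c) \<in> bdd_lip"
  by (auto simp: bdd_lip_def)

lemma unit_lip_shift: assumes "f \<in> unit_lip" shows "(\<lambda>x. f (x - t)) \<in> unit_lip"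
proof -
  have "\<bar>f (x - t) - f (y - t)\<bar> \<le> \<bar>x - y\<bar>" for x y
  proof -
    have "\<bar>f (x - t) - f (y - t)\<bar> \<le> \<bar>(x - t) - (y - t)\<bar>" using assms unfolding unit_lip_def by blast
    then show ?thesis by simp
  qed
  then show ?thesis using assms by (auto simp: unit_lip_def)
qed

lemma unit_lip_const: "\<bar>c\<bar> \<le> 1 \<Longrightarrow> (\<lambda>_. c) \<in> unit_lip"
  by (auto simp: unit_lip_def)

text \<open>Right-continuity makes f the pointwise limit of its values at the next point of a grid.\<close>
lemma Db_bdd_borel: assumes "f \<in> Db" shows "f \<in> bdd_borel"
proof -
  let ?r = "\<lambda>k x. (of_int \<lfloor>real (Suc k) * x\<rfloor> + 1) / real (Suc k)"
  have r: "x < ?r k x" "?r k x \<le> x + 1 / real (Suc k)" for k x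
  proof -
    define n where "n = real (Suc k)"
    have n: "n > 0" by (simp add: n_def)
    have "n * x < of_int \<lfloor>n * x\<rfloor> + 1" "of_int \<lfloor>n * x\<rfloor> \<le> n * x" by linarith+
    then have "x < (of_int \<lfloor>n * x\<rfloor> + 1) / n" "(of_int \<lfloor>n * x\<rfloor> + 1) / n \<le> x + 1 / n"
      using n by (auto simp: field_simps)
    then show "x < ?r k x" "?r k x \<le> x + 1 / real (Suc k)" by (auto simp: n_def)
  qed
  have lim: "(\<lambda>k. f (?r k x)) \<longlonglongrightarrow> f x" for x
  proof -
    have "(f \<longlongrightarrow> f x) (at_right x)" using assms by (auto simp: Db_def continuous_within)
    moreover have "filterlim (\<lambda>k. ?r k x) (at_right x) sequentially"
    proof (rule filterlim_at_withinI)
      show "(\<lambda>k. ?r k x) \<longlonglongrightarrow> x"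
      proof (rule real_tendsto_sandwich[where f="\<lambda>_. x" and h="\<lambda>k. x + 1 / real (Suc k)"])
        have "(\<lambda>k. x + 1 / real (Suc k)) \<longlonglongrightarrow> x + 0"
          by (intro tendsto_add tendsto_const LIMSEQ_Suc lim_1_over_n)
        then show "(\<lambda>k. x + 1 / real (Suc k)) \<longlonglongrightarrow> x" by simp
        show "\<forall>\<^sub>F k in sequentially. x \<le> ?r k x"
          by (intro always_eventually allI less_imp_le r(1))
        show "\<forall>\<^sub>F k in sequentially. ?r k x \<le> x + 1 / real (Suc k)"
          by (intro always_eventually allI r(2))
      qed auto
      show "\<forall>\<^sub>F k in sequentially. ?r k x \<in> {x<..} - {x}"
        using r(1)[of x] by (intro always_eventually allI) (auto simp: less_le)
    qed
    ultimately show ?thesis by (rule filterlim_compose)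
  qed
  have "(\<lambda>x. f (?r k x)) \<in> borel_measurable borel" for k
  proof -
    have "(\<lambda>z::int. f ((of_int z + 1) / real (Suc k))) \<in> measurable (count_space UNIV) borel" by simp
    moreover have "(\<lambda>x::real. \<lfloor>real (Suc k) * x\<rfloor>) \<in> measurable borel (count_space UNIV)" by measurable
    ultimately show ?thesis by (rule measurable_compose_rev)
  qed
  then have "f \<in> borel_measurable borel"
    by (rule borel_measurable_LIMSEQ_real[OF lim])
  moreover have "\<exists>B. \<forall>x. \<bar>f x\<bar> \<le> B" using assms by (auto simp: Db_def bounded_iff)
  ultimately show ?thesis by (simp add: bdd_borel_def)
qed

section \<open>The bounded-Lipschitz distance and its reduction to finitely many test
  functions\<close>

lemma dBL_unit_lip: "dBL \<mu> \<nu> = (SUP f\<in>unit_lip. \<bar>pair \<mu> f - pair \<nu> f\<bar>)"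
  unfolding dBL_def unit_lip_def by (rule arg_cong[where f=Sup]) auto

lemma dBL_le: "(\<And>f. f \<in> unit_lip \<Longrightarrow> \<bar>pair \<mu> f - pair \<nu> f\<bar> \<le> c) \<Longrightarrow> dBL \<mu> \<nu> \<le> c"
  unfolding dBL_unit_lip using unit_lip_const[of 0] by (intro cSUP_least) auto

text \<open>A real supremum is an upper bound only for a set that is bounded above; the finite
  masses supply this bound.\<close>

lemma dBL_ge: assumes "\<mu> \<in> fmeas" "\<nu> \<in> fmeas" "f \<in> unit_lip"
  shows "\<bar>pair \<mu> f - pair \<nu> f\<bar> \<le> dBL \<mu> \<nu>"
  unfolding dBL_unit_lip
proof (rule cSUP_upper[OF assms(3)])
  have "\<bar>pair \<mu> g - pair \<nu> g\<bar> \<le> measure \<mu> UNIV + measure \<nu> UNIV" if "g \<in> unit_lip" for g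
    using pair_bound[OF assms(1), of g 1] pair_bound[OF assms(2), of g 1] that unit_lip_bdd_borel[OF that]
    by (auto simp: unit_lip_def)
  then show "bdd_above ((\<lambda>f. \<bar>pair \<mu> f - pair \<nu> f\<bar>) ` unit_lip)" by (auto intro!: bdd_aboveI2)
qed

lemma dBL_nonneg: "\<mu> \<in> fmeas \<Longrightarrow> \<nu> \<in> fmeas \<Longrightarrow> 0 \<le> dBL \<mu> \<nu>"
  using dBL_ge[of \<mu> \<nu> "\<lambda>_. 0"] unit_lip_const[of 0] by simp

lemma dBL_refl: "dBL \<mu> \<mu> = 0"
proof -
  have "unit_lip \<noteq> {}" using unit_lip_const[of 0] by auto
  then show ?thesis by (simp add: dBL_unit_lip)
qed

lemma dBL_commute: "dBL \<mu> \<nu> = dBL \<nu> \<mu>"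
  by (simp add: dBL_unit_lip abs_minus_commute)

lemma dBL_triangle: assumes "\<mu> \<in> fmeas" "\<nu> \<in> fmeas" "\<rho> \<in> fmeas"
  shows "dBL \<mu> \<rho> \<le> dBL \<mu> \<nu> + dBL \<nu> \<rho>"
proof (rule dBL_le)
  fix f assume "f \<in> unit_lip"
  then show "\<bar>pair \<mu> f - pair \<rho> f\<bar> \<le> dBL \<mu> \<nu> + dBL \<nu> \<rho>"
    using dBL_ge[OF assms(1,2), of f] dBL_ge[OF assms(2,3), of f] by linarith
qed

lemma dBL_mass: "\<mu> \<in> fmeas \<Longrightarrow> \<nu> \<in> fmeas \<Longrightarrow> \<bar>measure \<mu> UNIV - measure \<nu> UNIV\<bar> \<le> dBL \<mu> \<nu>"
  using dBL_ge[of \<mu> \<nu> "\<lambda>_. 1"] by (simp add: unit_lip_const pair_const)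

text \<open>Hat function centred at i*e, falling linearly to 0 at the neighbouring grid points. The
  hats form a partition of unity, and the sum of the hats weighted by the values of f at the grid
  points is the piecewise linear interpolant of f.\<close>

definition tent :: "real \<Rightarrow> int \<Rightarrow> real \<Rightarrow> real" where
  "tent e i x = max 0 (1 - \<bar>x / e - of_int i\<bar>)"

lemma tent_bdd_lip: assumes "e > 0" shows "tent e i \<in> bdd_lip"
proof -
  have "\<bar>tent e i x - tent e i y\<bar> \<le> (1/e) * \<bar>x - y\<bar>" for x y
  proof -
    have "\<bar>tent e i x - tent e i y\<bar> \<le> \<bar>x / e - y / e\<bar>" by (auto simp: tent_def)
    also have "\<dots> = (1/e) * \<bar>x - y\<bar>" using assms by (simp add: diff_divide_distrib[symmetric])
    finally show ?thesis .
  qed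
  moreover have "0 \<le> 1/e" using assms by simp
  ultimately show ?thesis unfolding bdd_lip_def by (auto simp: tent_def intro!: exI[of _ "1/e"])
qed

text \<open>Only the hats at \<open>\<lfloor>x / e\<rfloor>\<close> and at the next grid point can
  be nonzero at x, with values 1 - theta and theta. The extra 1 in the second hypothesis keeps both
  indices inside the window.\<close>

lemma tent_sum:
  fixes m :: nat
  assumes "e > 0"
  shows "(\<Sum>i\<in>{-int m..int m}. tent e i x) \<le> 1"
    and "\<bar>x\<bar> / e + 1 \<le> real m \<Longrightarrow> (\<Sum>i\<in>{-int m..int m}. tent e i x) = 1"
proof -
  define j where "j = \<lfloor>x / e\<rfloor>"
  have j: "of_int j \<le> x / e" "x / e < of_int j + 1" by (auto simp: j_def)
  have z: "tent e i x = 0" if "i \<notin> {j, j+1}" for i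
  proof -
    have "i \<le> j - 1 \<or> i \<ge> j + 2" using that by auto
    then have "real_of_int i \<le> of_int j - 1 \<or> real_of_int i \<ge> of_int j + 2" by linarith
    then show ?thesis using j by (auto simp: tent_def)
  qed
  have v: "tent e j x = 1 - (x / e - of_int j)" "tent e (j+1) x = x / e - of_int j"
    using j by (auto simp: tent_def)
  let ?S = "{-int m..int m}"
  have eq: "(\<Sum>i\<in>?S. tent e i x) = (\<Sum>i\<in>?S \<inter> {j,j+1}. tent e i x)"
    by (rule sum.mono_neutral_right) (use z in auto)
  also have "\<dots> \<le> (\<Sum>i\<in>{j,j+1}. tent e i x)"
    by (rule sum_mono2) (auto simp: tent_def)
  also have "\<dots> = 1" by (simp add: v)
  finally show "(\<Sum>i\<in>?S. tent e i x) \<le> 1" .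
  assume m: "\<bar>x\<bar> / e + 1 \<le> real m"
  have "\<bar>x / e\<bar> = \<bar>x\<bar> / e" using assms by simp
  then have "-real m \<le> of_int j" "of_int j + 1 \<le> real m" using m j by linarith+
  then have "- int m \<le> j" "j + 1 \<le> int m" by linarith+
  then have "?S \<inter> {j,j+1} = {j,j+1}" by auto
  then show "(\<Sum>i\<in>?S. tent e i x) = 1" using eq by (simp add: v)
qed

text \<open>Where a hat does not vanish, its centre is within e of x, so f changes by at most e; the
  weight missing from the window is charged at sup|f|, that is 1. The bound is the same for all f,
  as a supremum over \<open>unit_lip\<close> requires.\<close>

lemma tent_approx:
  fixes m :: nat
  assumes "e > 0" "f \<in> unit_lip"
  shows "\<bar>f x - (\<Sum>i\<in>{-int m..int m}. f (of_int i * e) * tent e i x)\<bar>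
         \<le> e + (1 - (\<Sum>i\<in>{-int m..int m}. tent e i x))"
proof -
  let ?S = "{-int m..int m}"
  let ?H = "\<Sum>i\<in>?S. tent e i x"
  have f: "\<bar>f x\<bar> \<le> 1" "\<And>x y. \<bar>f x - f y\<bar> \<le> \<bar>x - y\<bar>" using assms by (auto simp: unit_lip_def)
  have "f x - (\<Sum>i\<in>?S. f (of_int i * e) * tent e i x)
     = (\<Sum>i\<in>?S. (f x - f (of_int i * e)) * tent e i x) + f x * (1 - ?H)"
    by (simp add: sum_subtractf left_diff_distrib right_diff_distrib sum_distrib_left)
  also have "\<bar>\<dots>\<bar> \<le> \<bar>\<Sum>i\<in>?S. (f x - f (of_int i * e)) * tent e i x\<bar> + \<bar>f x * (1 - ?H)\<bar>"
    by (rule abs_triangle_ineq)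
  also have "\<bar>\<Sum>i\<in>?S. (f x - f (of_int i * e)) * tent e i x\<bar> \<le> (\<Sum>i\<in>?S. e * tent e i x)"
  proof (rule order_trans[OF sum_abs sum_mono])
    fix i
    have "\<bar>f x - f (of_int i * e)\<bar> * tent e i x \<le> e * tent e i x"
    proof (cases "tent e i x = 0")
      case False
      then have "\<bar>x / e - of_int i\<bar> < 1" by (auto simp: tent_def split: if_splits)
      then have "\<bar>x - of_int i * e\<bar> \<le> e"
        using assms(1) by (simp add: abs_le_iff abs_less_iff field_simps)
      then have "\<bar>f x - f (of_int i * e)\<bar> \<le> e" using f(2)[of x "of_int i * e"] by linarith
      then show ?thesis by (intro mult_right_mono) (auto simp: tent_def)
    qed auto
    then show "\<bar>(f x - f (of_int i * e)) * tent e i x\<bar> \<le> e * tent e i x"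
      by (simp add: abs_mult tent_def)
  qed
  also have "(\<Sum>i\<in>?S. e * tent e i x) = e * ?H" by (simp add: sum_distrib_left)
  also have "e * ?H \<le> e" using tent_sum(1)[OF assms(1)] assms(1) by (simp add: mult_left_le)
  also have "\<bar>f x * (1 - ?H)\<bar> \<le> 1 * (1 - ?H)"
    using tent_sum(1)[OF assms(1), where m=m and x=x] f(1)
    by (simp add: abs_mult mult_left_le_one_le)
  finally show ?thesis by simp
qed

text \<open>The interpolants of all f in \<open>unit_lip\<close> use the same finitely many hats,
  with coefficients in [-1, 1], so the pairings with these hats control the whole supremum. The tail
  outside the window is small for \<open>\<nu>\<close>; for \<open>\<mu>\<close> this follows by
  testing also with the constant 1.\<close>

lemma dBL_finite_test:
  assumes nu: "\<nu> \<in> fmeas" and eta: "\<eta> > 0"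
  obtains H d where "finite H" "H \<subseteq> bdd_lip" "d > 0"
    "\<And>\<mu>. \<mu> \<in> fmeas \<Longrightarrow> (\<And>h. h \<in> H \<Longrightarrow> \<bar>pair \<mu> h - pair \<nu> h\<bar> \<le> d) \<Longrightarrow> dBL \<mu> \<nu> \<le> \<eta>"
proof -
  define s where "s = measure \<nu> UNIV"
  have s: "s \<ge> 0" by (simp add: s_def)
  \<comment> \<open>This mesh makes the interpolation errors of both measures add up to at most
    \<eta>/4 when the mass of \<open>\<mu>\<close> is at most s + 1.\<close>
  define e where "e = \<eta> / (4 * (2 * s + 1))"
  have e: "e > 0" using eta s by (simp add: e_def)
  define Hs where "Hs m x = (\<Sum>i\<in>{-int m..int m}. tent e i x)" for m :: nat and x
  have tBM: "tent e i \<in> bdd_borel" for i by (intro bdd_lip_bdd_borel tent_bdd_lip e)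
  have HsBM: "Hs m \<in> bdd_borel" for m unfolding Hs_def by (intro bdd_borel_sum tBM)
  have Hs01: "0 \<le> Hs m x" "Hs m x \<le> 1" for m x
    using tent_sum(1)[OF e] by (auto simp: Hs_def tent_def intro!: sum_nonneg)
  have "(\<lambda>m. pair \<nu> (Hs m)) \<longlonglongrightarrow> pair \<nu> (\<lambda>_. 1)"
    unfolding pair_def
  proof (rule integral_dominated_convergence[where w="\<lambda>_. 1"])
    show "AE x in \<nu>. (\<lambda>m. Hs m x) \<longlonglongrightarrow> 1"
    proof (rule AE_I2, rule tendsto_eventually)
      fix x
      obtain m0 :: nat where "\<bar>x\<bar> / e + 1 \<le> real m0" using real_arch_simple by blast
      then show "\<forall>\<^sub>F m in sequentially. Hs m x = 1"
        unfolding Hs_def eventually_sequentially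
        by (intro exI[of _ m0] allI impI tent_sum(2)[OF e]) linarith
    qed
    show "integrable \<nu> (\<lambda>_. 1::real)" using fmeas_integrable[OF nu bdd_borel_const] .
    show "AE x in \<nu>. norm (Hs m x) \<le> 1" for m using Hs01 by (intro AE_I2) simp
    show "Hs m \<in> borel_measurable \<nu>" for m
      by (rule fmeas_measurable[OF nu bdd_borel_measurable[OF HsBM]])
  qed simp
  then have "\<forall>\<^sub>F m in sequentially. dist (pair \<nu> (Hs m)) (pair \<nu> (\<lambda>_. 1)) < \<eta> / 8"
    using eta by (intro tendstoD) auto
  then obtain m where "dist (pair \<nu> (Hs m)) (pair \<nu> (\<lambda>_. 1)) < \<eta> / 8"
    by (auto simp: eventually_sequentially)
  then have m: "s - pair \<nu> (Hs m) < \<eta> / 8" using nu unfolding dist_real_def pair_const[OF nu] s_def by argo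
  let ?S = "{-int m..int m}"
  define c where "c = 2 * (2 * real m + 1) + 1"
  define d where "d = min 1 (\<eta> / (2 * c))"
  have c: "c > 0" by (simp add: c_def)
  have d: "d > 0" "d \<le> 1" "c * d \<le> \<eta> / 2"
    using eta c by (auto simp: d_def min_def field_simps)
  show ?thesis
  proof (rule that[of "insert (\<lambda>_. 1) (tent e ` ?S)" d])
    fix \<mu> assume mu: "\<mu> \<in> fmeas"
      and close: "\<And>h. h \<in> insert (\<lambda>_. 1) (tent e ` ?S) \<Longrightarrow> \<bar>pair \<mu> h - pair \<nu> h\<bar> \<le> d"
    have 1: "\<bar>measure \<mu> UNIV - s\<bar> \<le> d"
      using close[of "\<lambda>_. 1"] mu nu by (simp add: pair_const s_def)
    have hi: "(\<Sum>i\<in>?S. \<bar>pair \<mu> (tent e i) - pair \<nu> (tent e i)\<bar>) \<le> (2 * real m + 1) * d"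
      using sum_bounded_above[of ?S "\<lambda>i. \<bar>pair \<mu> (tent e i) - pair \<nu> (tent e i)\<bar>" d] close
      by simp
    have pH: "pair \<rho> (Hs m) = (\<Sum>i\<in>?S. pair \<rho> (tent e i))" if "\<rho> \<in> fmeas" for \<rho>
      unfolding Hs_def using that tBM by (intro pair_sum)
    have H: "\<bar>pair \<mu> (Hs m) - pair \<nu> (Hs m)\<bar> \<le> (2 * real m + 1) * d"
      unfolding pH[OF mu] pH[OF nu] sum_subtractf[symmetric]
      by (rule order_trans[OF sum_abs hi])
    show "dBL \<mu> \<nu> \<le> \<eta>"
    proof (rule dBL_le)
      fix f assume f: "f \<in> unit_lip"
      define g where "g x = (\<Sum>i\<in>?S. f (of_int i * e) * tent e i x)" for x
      have gBM: "g \<in> bdd_borel" unfolding g_def by (intro bdd_borel_sum bdd_borel_mult tBM)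
      have pg: "pair \<rho> g = (\<Sum>i\<in>?S. f (of_int i * e) * pair \<rho> (tent e i))" if "\<rho> \<in> fmeas" for \<rho>
        unfolding g_def using that tBM by (subst pair_sum) (auto intro!: bdd_borel_mult simp: pair_mult)
      have G: "\<bar>pair \<mu> g - pair \<nu> g\<bar> \<le> (2 * real m + 1) * d"
      proof -
        have "\<bar>pair \<mu> g - pair \<nu> g\<bar> =
            \<bar>\<Sum>i\<in>?S. f (of_int i * e) * (pair \<mu> (tent e i) - pair \<nu> (tent e i))\<bar>"
          by (simp add: pg mu nu sum_subtractf right_diff_distrib)
        also have "\<dots> \<le> (\<Sum>i\<in>?S. \<bar>pair \<mu> (tent e i) - pair \<nu> (tent e i)\<bar>)"
        proof (rule order_trans[OF sum_abs sum_mono])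
          fix i show "\<bar>f (of_int i * e) * (pair \<mu> (tent e i) - pair \<nu> (tent e i))\<bar>
            \<le> \<bar>pair \<mu> (tent e i) - pair \<nu> (tent e i)\<bar>"
            using f by (simp add: abs_mult mult_left_le_one_le unit_lip_def)
        qed
        finally show ?thesis using hi by linarith
      qed
      have P: "\<bar>pair \<rho> f - pair \<rho> g\<bar> \<le> e * measure \<rho> UNIV + (measure \<rho> UNIV - pair \<rho> (Hs m))"
        if r: "\<rho> \<in> fmeas" for \<rho>
      proof -
        have "\<bar>pair \<rho> (\<lambda>x. f x - g x)\<bar> \<le> pair \<rho> (\<lambda>x. e + (1 - Hs m x))"
          using tent_approx[OF e f, where m=m]
          by (intro pair_abs_le r bdd_borel_diff bdd_borel_add unit_lip_bdd_borel[OF f] gBM HsBM) (auto simp: g_def Hs_def)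
        then show ?thesis
          using r f gBM HsBM by (simp add: pair_diff pair_add unit_lip_bdd_borel bdd_borel_diff pair_const)
      qed
      have "e * measure \<mu> UNIV \<le> e * (s + 1)"
        using 1 d(2) e by (intro mult_left_mono) auto
      then have E: "e * measure \<mu> UNIV + e * s \<le> \<eta> / 4"
      proof -
        have "e * (s + 1) + e * s = e * (2 * s + 1)" by (simp add: algebra_simps)
        also have "\<dots> = \<eta> / 4"
        proof -
          have "2 * s + 1 \<noteq> 0" using s by linarith
          then show ?thesis unfolding e_def by (simp add: divide_simps)
        qed
        finally show ?thesis using \<open>e * measure \<mu> UNIV \<le> e * (s + 1)\<close> by linarith
      qed
      have "c * d = 2 * ((2 * real m + 1) * d) + d" by (simp add: c_def algebra_simps)
      then show "\<bar>pair \<mu> f - pair \<nu> f\<bar> \<le> \<eta>"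
        using P[OF mu] P[OF nu] G H 1 E m d(3) unfolding s_def by argo
    qed
  qed (use d e tent_bdd_lip bdd_lip_const[of 1] in auto)
qed

section \<open>Sums, multiples, images and atomic measures\<close>

definition measure_sum :: "real measure \<Rightarrow> real measure \<Rightarrow> real measure" where
  "measure_sum \<mu> \<nu> = measure_of UNIV (sets borel) (\<lambda>B. emeasure \<mu> B + emeasure \<nu> B)"

lemma sets_measure_sum [simp]: "sets (measure_sum \<mu> \<nu>) = sets borel"
  unfolding measure_sum_def by (metis sets.sets_measure_of_eq space_borel)

lemma emeasure_measure_sum:
  assumes "sets \<mu> = sets borel" "sets \<nu> = sets borel" "B \<in> sets borel"
  shows "emeasure (measure_sum \<mu> \<nu>) B = emeasure \<mu> B + emeasure \<nu> B"
  unfolding measure_sum_def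
proof (rule emeasure_measure_of_sigma)
  show "sigma_algebra UNIV (sets (borel::real measure))"
    using sets.sigma_algebra_axioms[of "borel::real measure"] by simp
  show "positive (sets borel) (\<lambda>B. emeasure \<mu> B + emeasure \<nu> B)" by (simp add: positive_def)
  show "countably_additive (sets borel) (\<lambda>B. emeasure \<mu> B + emeasure \<nu> B)"
  proof (rule countably_additiveI)
    fix A :: "nat \<Rightarrow> real set" assume A: "range A \<subseteq> sets borel" "disjoint_family A"
    have "(\<Sum>i. emeasure \<mu> (A i) + emeasure \<nu> (A i)) = (\<Sum>i. emeasure \<mu> (A i)) + (\<Sum>i. emeasure \<nu> (A i))"
      by (rule suminf_add[symmetric]) auto
    also have "\<dots> = emeasure \<mu> (\<Union> (range A)) + emeasure \<nu> (\<Union> (range A))"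
      using A assms by (simp add: suminf_emeasure)
    finally show "(\<Sum>i. emeasure \<mu> (A i) + emeasure \<nu> (A i)) = emeasure \<mu> (\<Union> (range A)) + emeasure \<nu> (\<Union> (range A))" .
  qed
qed (use assms in auto)

lemma nn_integral_measure_sum:
  assumes [measurable_cong]: "sets \<mu> = sets borel" "sets \<nu> = sets borel" and f: "f \<in> borel_measurable borel"
  shows "(\<integral>\<^sup>+x. f x \<partial>measure_sum \<mu> \<nu>) = (\<integral>\<^sup>+x. f x \<partial>\<mu>) + (\<integral>\<^sup>+x. f x \<partial>\<nu>)"
  using f
proof induction
  case (cong f g)
  then show ?case using sets_eq_imp_space_eq[of _ borel, OF assms(1)] sets_eq_imp_space_eq[of _ borel, OF assms(2)]
    by (simp cong: nn_integral_cong_simp)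
next
  case (set A)
  then show ?case using assms(1,2) by (simp add: emeasure_measure_sum)
next
  case (mult u c)
  then show ?case by (simp add: nn_integral_cmult measurable_cong_sets[OF sets_measure_sum refl] distrib_left)
next
  case (add u v)
  then show ?case by (simp add: nn_integral_add measurable_cong_sets[OF sets_measure_sum refl] ac_simps)
next
  case (seq U)
  have *: "(\<integral>\<^sup>+x. (SUP i. U i) x \<partial>\<rho>) = (SUP i. \<integral>\<^sup>+x. U i x \<partial>\<rho>)" if [measurable_cong]: "sets \<rho> = sets borel" for \<rho>
    unfolding SUP_apply by (rule nn_integral_monotone_convergence_SUP) (use seq that in auto)
  have "incseq (\<lambda>i. \<integral>\<^sup>+x. U i x \<partial>\<rho>)" for \<rho>
    using seq(3) by (auto simp: incseq_def le_fun_def intro!: nn_integral_mono)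
  then show ?case using seq by (simp only: * assms sets_measure_sum ennreal_SUP_add)
qed

lemma measure_sum_fmeas: assumes "\<mu> \<in> fmeas" "\<nu> \<in> fmeas" shows "measure_sum \<mu> \<nu> \<in> fmeas"
  using assms by (auto simp: fmeas_def emeasure_measure_sum)

lemma fmeas_pair_nn: assumes "\<mu> \<in> fmeas" "f \<in> bdd_borel" "\<And>x. 0 \<le> f x"
  shows "ennreal (pair \<mu> f) = (\<integral>\<^sup>+x. ennreal (f x) \<partial>\<mu>)"
  unfolding pair_def by (rule nn_integral_eq_integral[symmetric]) (use assms fmeas_integrable in auto)

lemma pair_eqI:
  assumes "\<mu> \<in> fmeas" "f \<in> bdd_borel" "\<And>x. 0 \<le> f x" "c \<ge> 0" "(\<integral>\<^sup>+x. ennreal (f x) \<partial>\<mu>) = ennreal c"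
  shows "pair \<mu> f = c"
  using fmeas_pair_nn[OF assms(1-3)] assms(4,5) assms(3) unfolding pair_def
  by (simp add: Bochner_Integration.integral_nonneg)

lemma pair_nonneg: "(\<And>x. 0 \<le> f x) \<Longrightarrow> 0 \<le> pair \<mu> f"
  unfolding pair_def by (rule Bochner_Integration.integral_nonneg) auto

text \<open>The constructed measures are known through their nonnegative integrals. Since f + B and
  the constant B are nonnegative, an identity proved for such integrands passes to every bounded f
  by taking a difference.\<close>

lemma pair_nonneg_induct:
  assumes f: "f \<in> bdd_borel" and mu: "\<mu> \<in> fmeas"
    and G: "\<And>f g. f \<in> bdd_borel \<Longrightarrow> g \<in> bdd_borel \<Longrightarrow> G (\<lambda>x. f x - g x) = G f - G g"
    and eq: "\<And>g. g \<in> bdd_borel \<Longrightarrow> (\<And>x. 0 \<le> g x) \<Longrightarrow> pair \<mu> g = G g"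
  shows "pair \<mu> f = G f"
proof -
  obtain B where B: "B \<ge> 0" "\<And>x. \<bar>f x\<bar> \<le> B" using bdd_borel_bound[OF f] by metis
  let ?g = "\<lambda>x. f x - (- B)"
  have g: "?g \<in> bdd_borel" "\<And>x. 0 \<le> ?g x"
  proof -
    show "?g \<in> bdd_borel" by (rule bdd_borel_diff[OF f bdd_borel_const])
    show "0 \<le> ?g x" for x using B(2)[of x] by linarith
  qed
  have "pair \<mu> (\<lambda>x. ?g x - B) = G (\<lambda>x. ?g x - B)"
    using g B(1) by (simp only: pair_diff[OF mu g(1) bdd_borel_const] G[OF g(1) bdd_borel_const] eq[OF g] eq[OF bdd_borel_const])
  then show ?thesis by simp
qed

lemma pair_measure_sum: assumes "\<mu> \<in> fmeas" "\<nu> \<in> fmeas" "f \<in> bdd_borel"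
  shows "pair (measure_sum \<mu> \<nu>) f = pair \<mu> f + pair \<nu> f"
proof (rule pair_nonneg_induct[OF assms(3) measure_sum_fmeas[OF assms(1,2)]])
  fix g assume g: "g \<in> bdd_borel" "\<And>x. 0 \<le> g x"
  have [measurable]: "g \<in> borel_measurable borel" using g by (simp add: bdd_borel_def)
  have "(\<integral>\<^sup>+x. ennreal (g x) \<partial>measure_sum \<mu> \<nu>) = ennreal (pair \<mu> g) + ennreal (pair \<nu> g)"
    using assms g by (subst nn_integral_measure_sum) (simp_all add: fmeas_pair_nn fmeas_sets)
  then show "pair (measure_sum \<mu> \<nu>) g = pair \<mu> g + pair \<nu> g"
    using g by (intro pair_eqI measure_sum_fmeas assms) (simp_all add: pair_nonneg)
qed (simp add: pair_diff assms)

lemma scale_fmeas: "\<mu> \<in> fmeas \<Longrightarrow> scale_measure (ennreal c) \<mu> \<in> fmeas"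
  by (auto simp: fmeas_def ennreal_mult_less_top)

lemma pair_scale: assumes "\<mu> \<in> fmeas" "f \<in> bdd_borel" "c \<ge> 0"
  shows "pair (scale_measure (ennreal c) \<mu>) f = c * pair \<mu> f"
proof (rule pair_nonneg_induct[OF assms(2) scale_fmeas[OF assms(1)]])
  fix g assume g: "g \<in> bdd_borel" "\<And>x. 0 \<le> g x"
  have "g \<in> borel_measurable \<mu>" by (rule fmeas_measurable[OF assms(1) bdd_borel_measurable[OF g(1)]])
  then have "(\<integral>\<^sup>+x. ennreal (g x) \<partial>scale_measure (ennreal c) \<mu>) = ennreal (c * pair \<mu> g)"
    using assms g by (subst nn_integral_scale_measure) (simp_all add: fmeas_pair_nn[symmetric] ennreal_mult pair_nonneg)
  then show "pair (scale_measure (ennreal c) \<mu>) g = c * pair \<mu> g"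
    using g assms by (intro pair_eqI scale_fmeas assms) (simp_all add: pair_nonneg)
qed (simp add: pair_diff assms right_diff_distrib)

lemma distr_fmeas: assumes "\<mu> \<in> fmeas" "g \<in> borel_measurable borel" shows "distr \<mu> borel g \<in> fmeas"
  using finite_measure.finite_measure_distr[OF fmeas_finite[OF assms(1)] fmeas_measurable[OF assms]]
  by (intro fmeasI) auto

lemma pair_distr: assumes "\<mu> \<in> fmeas" "g \<in> borel_measurable borel" "f \<in> bdd_borel"
  shows "pair (distr \<mu> borel g) f = pair \<mu> (\<lambda>x. f (g x))"
  unfolding pair_def
  by (rule integral_distr) (use assms fmeas_measurable bdd_borel_measurable in auto)

text \<open>As a push-forward it adds the weights of indices that share a location, so simultaneous
  departures are counted with multiplicity.\<close>

definition atomic_meas :: "'i set \<Rightarrow> ('i \<Rightarrow> real) \<Rightarrow> ('i \<Rightarrow> real) \<Rightarrow> real measure" where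
  "atomic_meas I w x = distr (point_measure I (\<lambda>i. ennreal (w i))) borel x"

lemma atomic_meas_fmeas: assumes "finite I" shows "atomic_meas I w x \<in> fmeas"
proof -
  have "finite_measure (point_measure I (\<lambda>i. ennreal (w i)))"
    using assms by (intro finite_measureI) (simp add: space_point_measure emeasure_point_measure_finite)
  then show ?thesis unfolding atomic_meas_def
    by (intro fmeasI finite_measure.finite_measure_distr) (auto simp: measurable_point_measure_eq1)
qed

lemma emeasure_atomic_meas: assumes "finite I" "B \<in> sets borel"
  shows "emeasure (atomic_meas I w x) B = (\<Sum>i\<in>I. ennreal (w i) * indicator B (x i))"
proof -
  have "emeasure (atomic_meas I w x) B = emeasure (point_measure I (\<lambda>i. ennreal (w i))) (x -` B \<inter> I)"
    unfolding atomic_meas_def using assms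
    by (subst emeasure_distr) (auto simp: space_point_measure measurable_point_measure_eq1)
  also have "\<dots> = (\<Sum>i\<in>x -` B \<inter> I. ennreal (w i))"
    using assms by (subst emeasure_point_measure_finite2) auto
  also have "\<dots> = (\<Sum>i\<in>I. ennreal (w i) * indicator B (x i))"
    using assms by (intro sum.mono_neutral_cong_left) (auto split: split_indicator)
  finally show ?thesis .
qed

lemma pair_atomic_meas: assumes "finite I" "f \<in> bdd_borel" "\<And>i. i \<in> I \<Longrightarrow> 0 \<le> w i"
  shows "pair (atomic_meas I w x) f = (\<Sum>i\<in>I. w i * f (x i))"
proof -
  have "pair (atomic_meas I w x) f = (\<integral>i. f (x i) \<partial>point_measure I (\<lambda>i. ennreal (w i)))"
    unfolding pair_def atomic_meas_def
    by (rule integral_distr) (use assms in \<open>auto simp: measurable_point_measure_eq1 bdd_borel_def\<close>)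
  also have "\<dots> = (\<Sum>i\<in>I. w i * f (x i))"
    using assms by (subst lebesgue_integral_point_measure_finite) auto
  finally show ?thesis .
qed

section \<open>Skorokhod convergence and time changes\<close>

definition time_change :: "(real \<Rightarrow> real) \<Rightarrow> bool" where
  "time_change l \<longleftrightarrow> strict_mono_on {0..} l \<and> continuous_on {0..} l \<and> l ` {0..} = {0..}"

lemma time_change_id: "time_change (\<lambda>t. t)"
  by (auto simp: time_change_def strict_mono_on_def)

lemma skor_conv_uniform:
  assumes "\<And>T e. T > 0 \<Longrightarrow> e > 0 \<Longrightarrow>
    eventually (\<lambda>k. \<forall>t\<in>{0..T}. dBL (xs k t) (x t) \<le> e) sequentially"
  shows "skor_conv xs x"
  unfolding skor_conv_def
  by (rule exI[of _ "\<lambda>k t. t"]) (use assms time_change_id in \<open>auto simp: time_change_def\<close>)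

text \<open>Diagonal argument. \<open>skor_conv\<close> wants one sequence of time changes for all
  horizons and tolerances, whereas the hypothesis supplies time changes separately for each n. At
  index k the one serving the largest feasible n <= k is taken; the cap k guarantees that a largest
  n exists.\<close>

lemma skor_convI:
  assumes ev: "\<And>n::nat. eventually (\<lambda>k. \<exists>l. time_change l \<and> (\<forall>t\<in>{0..real n}.
     \<bar>l t - t\<bar> \<le> 1 / real (Suc n) \<and> dBL (xs k (l t)) (x t) \<le> 1 / real (Suc n))) sequentially"
  shows "skor_conv xs x"
proof -
  define good where "good n k l \<longleftrightarrow> (\<forall>t\<in>{0..real n}.
     \<bar>l t - t\<bar> \<le> 1 / real (Suc n) \<and> dBL (xs k (l t)) (x t) \<le> 1 / real (Suc n))" for n k l
  define P where "P n k \<longleftrightarrow> (\<exists>l. time_change l \<and> good n k l)" for n k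
  have gmono: "good m k l" if "good n k l" "m \<le> n" for m n k l
  proof -
    have "1 / real (Suc n) \<le> 1 / real (Suc m)" using that(2) by (simp add: frac_le)
    moreover have "t \<in> {0..real n}" if "t \<in> {0..real m}" for t using that \<open>m \<le> n\<close> by auto
    ultimately show ?thesis using that(1) unfolding good_def by (meson order_trans)
  qed
  have "\<exists>l. time_change l \<and> (\<forall>n\<le>k. P n k \<longrightarrow> good n k l)" for k
  proof (cases "\<exists>n\<le>k. P n k")
    case False
    then show ?thesis using time_change_id by blast
  next
    case True
    define N where "N = Max {n. n \<le> k \<and> P n k}"
    have fin: "finite {n. n \<le> k \<and> P n k}" by simp
    have "N \<in> {n. n \<le> k \<and> P n k}" unfolding N_def by (rule Max_in[OF fin]) (use True in auto)
    then obtain l where l: "time_change l" "good N k l" by (auto simp: P_def)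
    have "n \<le> N" if "n \<le> k" "P n k" for n unfolding N_def using fin that by (intro Max_ge) auto
    with l show ?thesis using gmono by blast
  qed
  then obtain L where L: "\<And>k. time_change (L k)" "\<And>k n. n \<le> k \<Longrightarrow> P n k \<Longrightarrow> good n k (L k)" by metis
  have evg: "eventually (\<lambda>k. good n k (L k)) sequentially" for n
  proof -
    have "eventually (\<lambda>k. P n k) sequentially" using ev[of n] by (simp add: P_def good_def)
    moreover have "eventually (\<lambda>k. n \<le> k) sequentially" by (rule eventually_ge_at_top)
    ultimately show ?thesis by eventually_elim (rule L(2))
  qed
  have ex: "\<exists>n. T \<le> real n \<and> 1 / real (Suc n) \<le> e" if e0: "e > 0" for T e :: real
  proof -
    obtain n1 where n1: "T \<le> real n1" using real_arch_simple by blast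
    obtain n2 where n2: "inverse (real (Suc n2)) < e" using reals_Archimedean[OF e0] by blast
    have "1 / real (Suc (max n1 n2)) \<le> 1 / real (Suc n2)" by (intro frac_le) auto
    then have "1 / real (Suc (max n1 n2)) \<le> e" using n2 by (simp add: inverse_eq_divide)
    moreover have "T \<le> real (max n1 n2)" using n1 by simp
    ultimately show ?thesis by blast
  qed
  show ?thesis unfolding skor_conv_def
  proof (intro exI[of _ L] conjI allI impI)
    fix k show "strict_mono_on {0..} (L k)" "continuous_on {0..} (L k)" "L k ` {0..} = {0..}"
      using L(1)[of k] by (auto simp: time_change_def)
  next
    fix T e :: real assume "T > 0" "e > 0"
    obtain n where n: "T \<le> real n" "1 / real (Suc n) \<le> e" using ex[OF \<open>e > 0\<close>] by blast
    show "\<forall>\<^sub>F k in sequentially. \<forall>t\<in>{0..T}. \<bar>L k t - t\<bar> \<le> e"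
      using evg[of n] by eventually_elim (use n in \<open>force simp: good_def\<close>)
    show "\<forall>\<^sub>F k in sequentially. \<forall>t\<in>{0..T}. dBL (xs k (L k t)) (x t) \<le> e"
      using evg[of n] by eventually_elim (use n in \<open>force simp: good_def\<close>)
  qed
qed

text \<open>Near t the path oscillates little on each side separately: to the right by
  right-continuity, to the left by comparison with the left limit. At t = 0 the left window is
  vacuous.\<close>

lemma Dspace_local:
  assumes x: "x \<in> Dspace" and t: "t \<ge> 0" and e: "e > 0"
  shows "\<exists>c d. c < t \<and> t < d \<and> (\<forall>u v. 0 \<le> u \<and> 0 \<le> v \<and> c \<le> u \<and> c \<le> v \<and> u < t \<and> v < t \<longrightarrow> dBL (x u) (x v) \<le> e)
     \<and> (\<forall>u v. t \<le> u \<and> t \<le> v \<and> u < d \<and> v < d \<longrightarrow> dBL (x u) (x v) \<le> e)"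
proof -
  have xf: "x s \<in> fmeas" if "s \<ge> 0" for s using x that by (auto simp: Dspace_def)
  have close: "dBL (x u) (x v) \<le> e" if "\<nu> \<in> fmeas" "dBL (x u) \<nu> < e / 2" "dBL (x v) \<nu> < e / 2" "u \<ge> 0" "v \<ge> 0" for u v \<nu>
    using dBL_triangle[OF xf[OF that(4)] that(1) xf[OF that(5)]] that(2,3) dBL_commute[of \<nu> "x v"] by simp
  have "((\<lambda>s. dBL (x s) (x t)) \<longlongrightarrow> 0) (at_right t)" using x t by (auto simp: Dspace_def)
  then have "\<forall>\<^sub>F s in at_right t. dBL (x s) (x t) < e / 2" using e by (intro order_tendstoD(2)) auto
  then obtain d where d: "d > t" "\<And>s. t < s \<Longrightarrow> s < d \<Longrightarrow> dBL (x s) (x t) < e / 2"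
    unfolding eventually_at_right_field by blast
  have d': "dBL (x s) (x t) < e / 2" if "t \<le> s" "s < d" for s
    using d(2)[of s] that e dBL_refl[of "x t"] by (cases "s = t") auto
  have R: "dBL (x u) (x v) \<le> e" if "t \<le> u" "t \<le> v" "u < d" "v < d" for u v
    by (rule close[OF xf[OF t]]) (use that t d' in auto)
  show ?thesis
  proof (cases "t = 0")
    case True
    with R d(1) show ?thesis by (intro exI[of _ "-1"] exI[of _ d]) auto
  next
    case False
    then have "t > 0" using t by simp
    moreover have "\<forall>t>0. \<exists>\<nu>\<in>fmeas. ((\<lambda>s. dBL (x s) \<nu>) \<longlongrightarrow> 0) (at_left t)"
      using x unfolding Dspace_def by blast
    ultimately obtain \<nu> where nu: "\<nu> \<in> fmeas" "((\<lambda>s. dBL (x s) \<nu>) \<longlongrightarrow> 0) (at_left t)"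
      by blast
    then have "\<forall>\<^sub>F s in at_left t. dBL (x s) \<nu> < e / 2" using e by (intro order_tendstoD(2)) auto
    then obtain c where c: "c < t" "\<And>s. c < s \<Longrightarrow> s < t \<Longrightarrow> dBL (x s) \<nu> < e / 2"
      unfolding eventually_at_left_field by blast
    \<comment> \<open>Passing to the midpoint admits the left endpoint itself into the window; the
      partition argument provides only a weak inequality there.\<close>
    have "dBL (x u) (x v) \<le> e" if "0 \<le> u" "0 \<le> v" "(c + t) / 2 \<le> u" "(c + t) / 2 \<le> v" "u < t" "v < t" for u v
      by (rule close[OF nu(1)]) (use that c in auto)
    with R c(1) d(1) show ?thesis by (intro exI[of _ "(c + t) / 2"] exI[of _ d]) auto
  qed
qed

text \<open>Compactness of [0,T] turns the local windows into a finite set of cut points. Cells are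
  described by which cut points lie at or before a time, since such comparisons can be followed
  exactly through a time change and a floor.\<close>

lemma Dspace_partition:
  assumes x: "x \<in> Dspace" and e: "e > 0"
  shows "\<exists>S. finite S \<and> S \<subseteq> {0<..} \<and>
     (\<forall>t\<in>{0..T}. \<forall>r\<ge>0. (\<forall>s\<in>S. s \<le> t \<longleftrightarrow> s \<le> r) \<longrightarrow> dBL (x r) (x t) \<le> e)"
proof -
  define Q where "Q t p \<longleftrightarrow> fst p < t \<and> t < snd p \<and>
     (\<forall>u v. 0 \<le> u \<and> 0 \<le> v \<and> fst p \<le> u \<and> fst p \<le> v \<and> u < t \<and> v < t \<longrightarrow> dBL (x u) (x v) \<le> e)
     \<and> (\<forall>u v. t \<le> u \<and> t \<le> v \<and> u < snd p \<and> v < snd p \<longrightarrow> dBL (x u) (x v) \<le> e)" for t p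
  have "\<forall>t\<in>{0..}. \<exists>p. Q t p"
  proof
    fix t :: real assume "t \<in> {0..}"
    then obtain a b where "Q t (a, b)" using Dspace_local[OF x _ e, of t] unfolding Q_def by auto
    then show "\<exists>p. Q t p" by blast
  qed
  from bchoice[OF this] obtain p where p: "\<And>t. t \<ge> 0 \<Longrightarrow> Q t (p t)" by auto
  define c d where "c t = fst (p t)" and "d t = snd (p t)" for t
  have cd: "c t < t" "t < d t"
    "\<And>u v. 0 \<le> u \<Longrightarrow> 0 \<le> v \<Longrightarrow> c t \<le> u \<Longrightarrow> c t \<le> v \<Longrightarrow> u < t \<Longrightarrow> v < t \<Longrightarrow> dBL (x u) (x v) \<le> e"
    "\<And>u v. t \<le> u \<Longrightarrow> t \<le> v \<Longrightarrow> u < d t \<Longrightarrow> v < d t \<Longrightarrow> dBL (x u) (x v) \<le> e"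
    if "t \<ge> 0" for t
    using p[OF that] unfolding Q_def c_def d_def by blast+
  have "{0..T} \<subseteq> (\<Union>t\<in>{0..T}. {c t<..<d t})" using cd(1,2) by fastforce
  then obtain C where C: "C \<subseteq> {0..T}" "finite C" "{0..T} \<subseteq> (\<Union>t\<in>C. {c t<..<d t})"
    by (rule compactE_image[OF compact_Icc, rotated]) auto
  \<comment> \<open>The centres are cut points because the path may jump there; the window ends are
    cut points so that r cannot leave the window of t.\<close>
  let ?S = "(c ` C \<union> C \<union> d ` C) \<inter> {0<..}"
  show ?thesis
  proof (intro exI[of _ ?S] conjI ballI allI impI)
    fix t r :: real assume t: "t \<in> {0..T}" and r: "0 \<le> r" and same: "\<forall>s\<in>?S. (s \<le> t) = (s \<le> r)"
    obtain u where u: "u \<in> C" "c u < t" "t < d u" using C(3) t by auto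
    have u0: "u \<ge> 0" using u(1) C(1) by auto
    have cr: "c u \<le> r" using same u r by (cases "c u > 0") auto
    have "d u \<in> ?S" using u(1) cd(2)[OF u0] u0 by auto
    with same have dr: "r < d u" using u(3) by (meson not_le)
    have ur: "u \<le> t \<longleftrightarrow> u \<le> r" using same u u0 t r by (cases "u = 0") auto
    show "dBL (x r) (x t) \<le> e"
    proof (cases "u \<le> t")
      case True
      then show ?thesis using cd(4)[OF u0] ur dr u by auto
    next
      case False
      then show ?thesis using cd(3)[OF u0] ur cr u t r by auto
    qed
  qed (use C in auto)
qed

text \<open>A perturbation of the identity by a contraction is strictly increasing, and it reaches
  every y >= 0 by the intermediate value theorem.\<close>

lemma time_change_lipschitz:
  assumes q: "0 \<le> q" "q < 1" and g0: "g 0 = 0" and g: "\<And>u v. \<bar>g u - g v\<bar> \<le> q * \<bar>u - v\<bar>"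
  shows "time_change (\<lambda>t. t + g t)"
proof -
  have mono: "u + g u < v + g v" if "u < v" for u v
  proof -
    have "\<bar>g u - g v\<bar> \<le> q * (v - u)" using g[of u v] that by simp
    also have "\<dots> < 1 * (v - u)" using q that by (intro mult_strict_right_mono) auto
    finally have "g u - g v < v - u" by simp
    then show ?thesis by linarith
  qed
  have "q-lipschitz_on UNIV g" by (rule lipschitz_onI) (use q g in \<open>auto simp: dist_real_def\<close>)
  then have cont: "continuous_on A g" for A
    using lipschitz_on_continuous_on continuous_on_subset by blast
  have "\<exists>t\<ge>0. t + g t = y" if y: "y \<ge> 0" for y
  proof -
    \<comment> \<open>At b = y / (1 - q) the worst possible loss q b still leaves the value
      y.\<close>
    let ?b = "y / (1 - q)"
    have b: "?b \<ge> 0" using y q by simp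
    have "\<bar>g ?b\<bar> \<le> q * ?b" using g[of ?b 0] unfolding g0 diff_0_right abs_of_nonneg[OF b] .
    then have "?b - q * ?b \<le> ?b + g ?b" by linarith
    moreover have "?b - q * ?b = (1 - q) * ?b" by (simp only: left_diff_distrib mult_1)
    moreover have "(1 - q) * ?b = y" using q by simp
    ultimately have "y \<le> ?b + g ?b" by linarith
    then have "\<exists>t\<ge>0. t \<le> ?b \<and> t + g t = y"
      using y b g0 by (intro IVT'[of "\<lambda>t. t + g t"]) (auto intro!: continuous_intros cont)
    then show ?thesis by blast
  qed
  moreover have "0 \<le> t + g t" if "t \<ge> 0" for t using mono[of 0 t] g0 that by (cases "t = 0") auto
  ultimately have "(\<lambda>t. t + g t) ` {0..} = {0..}" by (auto simp: image_iff)
  then show ?thesis unfolding time_change_def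
    using mono by (auto simp: strict_mono_on_def intro!: continuous_intros cont)
qed

text \<open>Moving each jump time up to the next grid point aligns the jumps of a path with those of its
  discretization.\<close>
lemma time_change_ceiling:
  assumes S: "finite S" "S \<subseteq> {0<..}" and e: "e > 0"
  shows "\<forall>\<^sub>F k in sequentially. \<exists>l. time_change l \<and> (\<forall>t. \<bar>l t - t\<bar> \<le> e) \<and>
           (\<forall>s\<in>S. l s = of_int \<lceil>real (Suc k) * s\<rceil> / real (Suc k))"
proof -
  \<comment> \<open>\<open>\<delta>\<close> exceeds neither a point of S nor a gap between two of
    them, so a bump of this radius at one point vanishes at the other points and at 0.\<close>
  obtain \<delta> where \<delta>: "\<delta> > 0" "\<And>s. s \<in> S \<Longrightarrow> \<delta> \<le> s" "\<And>s s'. s \<in> S \<Longrightarrow> s' \<in> S \<Longrightarrow> s \<noteq> s' \<Longrightarrow> \<delta> \<le> \<bar>s - s'\<bar>"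
  proof -
    let ?E = "{p \<in> S \<times> S. fst p \<noteq> snd p}"
    let ?D = "insert 1 (S \<union> (\<lambda>p. \<bar>fst p - snd p\<bar>) ` ?E)"
    have "finite ?E" by (rule finite_subset[OF _ finite_cartesian_product[OF S(1) S(1)]]) blast
    then have fin: "finite ?D" using S(1) by (intro finite.insertI finite_UnI finite_imageI)
    have pos: "z > 0" if "z \<in> ?D" for z using that S(2) by auto
    have "Min ?D \<in> ?D" by (rule Min_in[OF fin]) simp
    then have "Min ?D > 0" by (rule pos)
    moreover have le: "Min ?D \<le> z" if "z \<in> ?D" for z using fin that by (rule Min_le)
    moreover have "Min ?D \<le> \<bar>s - s'\<bar>" if "s \<in> S" "s' \<in> S" "s \<noteq> s'" for s s'
    proof (rule le)
      have "(s, s') \<in> ?E" using that by simp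
      then show "\<bar>s - s'\<bar> \<in> ?D" by (intro insertI2 UnI2) (rule image_eqI[where x="(s, s')"], simp_all)
    qed
    ultimately show ?thesis by (intro that[of "Min ?D"]) blast+
  qed
  \<comment> \<open>The displacement will be a sum of c bumps of height at most 1/n: it is bounded
    by c/n and has Lipschitz constant c/(\<delta> n), and both are small on a fine grid.\<close>
  define c where "c = real (card S)"
  define b where "b t = max 0 (1 - \<bar>t\<bar> / \<delta>)" for t
  have b01: "0 \<le> b t" "b t \<le> 1" for t using \<delta>(1) by (auto simp: b_def)
  have bl: "\<bar>b u - b v\<bar> \<le> \<bar>u - v\<bar> / \<delta>" for u v
  proof -
    have "\<bar>b u - b v\<bar> \<le> \<bar>\<bar>u\<bar> / \<delta> - \<bar>v\<bar> / \<delta>\<bar>" 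
    proof -
      have "\<bar>max 0 (1 - p) - max 0 (1 - q)\<bar> \<le> \<bar>p - q\<bar>" for p q :: real
        by (auto simp: max_def abs_if)
      then show ?thesis unfolding b_def .
    qed
    also have "\<dots> = \<bar>\<bar>u\<bar> - \<bar>v\<bar>\<bar> / \<delta>" using \<delta>(1) by (simp add: diff_divide_distrib[symmetric])
    also have "\<dots> \<le> \<bar>u - v\<bar> / \<delta>" using \<delta>(1) by (intro divide_right_mono) auto
    finally show ?thesis .
  qed
  have bz: "b t = 0" if "\<delta> \<le> \<bar>t\<bar>" for t using that \<delta>(1) by (auto simp: b_def max_def field_simps)
  have lim: "((\<lambda>k. a / real (Suc k)) \<longlonglongrightarrow> 0)" for a :: real
    using LIMSEQ_Suc[OF lim_const_over_n] by simp
  have "\<forall>\<^sub>F k in sequentially. c / real (Suc k) < e" by (rule order_tendstoD(2)[OF lim e])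
  moreover have "\<forall>\<^sub>F k in sequentially. (c / \<delta>) / real (Suc k) < 1" by (rule order_tendstoD(2)[OF lim]) simp
  ultimately show ?thesis
  proof eventually_elim
    case (elim k)
    define n where "n = real (Suc k)"
    have n: "n > 0" by (simp add: n_def)
    define r where "r s = of_int \<lceil>n * s\<rceil> / n - s" for s
    have r: "0 \<le> r s" "r s \<le> 1 / n" for s
    proof -
      have "n * s \<le> of_int \<lceil>n * s\<rceil>" "of_int \<lceil>n * s\<rceil> \<le> n * s + 1" by linarith+
      then have "s \<le> of_int \<lceil>n * s\<rceil> / n" "of_int \<lceil>n * s\<rceil> / n \<le> s + 1 / n"
        using n by (auto simp: field_simps)
      then show "0 \<le> r s" "r s \<le> 1 / n" by (auto simp: r_def)
    qed
    define g where "g t = (\<Sum>s\<in>S. r s * b (t - s))" for t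
    have gl: "\<bar>g u - g v\<bar> \<le> (c / \<delta> / n) * \<bar>u - v\<bar>" for u v
    proof -
      have "\<bar>g u - g v\<bar> = \<bar>\<Sum>s\<in>S. r s * (b (u - s) - b (v - s))\<bar>"
        by (simp add: g_def sum_subtractf right_diff_distrib)
      also have "\<dots> \<le> (\<Sum>s\<in>S. 1 / n * (\<bar>u - v\<bar> / \<delta>))"
      proof (rule order_trans[OF sum_abs sum_mono])
        fix s show "\<bar>r s * (b (u - s) - b (v - s))\<bar> \<le> 1 / n * (\<bar>u - v\<bar> / \<delta>)"
          unfolding abs_mult using r[of s] bl[of "u - s" "v - s"] n by (intro mult_mono) auto
      qed
      also have "\<dots> = (c / \<delta> / n) * \<bar>u - v\<bar>" by (simp add: c_def)
      finally show ?thesis .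
    qed
    have gb: "\<bar>g t\<bar> \<le> c / n" for t
    proof -
      have "\<bar>g t\<bar> \<le> (\<Sum>s\<in>S. 1 / n * 1)" unfolding g_def
      proof (rule order_trans[OF sum_abs sum_mono])
        fix s show "\<bar>r s * b (t - s)\<bar> \<le> 1 / n * 1"
          unfolding abs_mult using r[of s] b01[of "t - s"] n by (intro mult_mono) auto
      qed
      then show ?thesis by (simp add: c_def)
    qed
    have "b (0 - s) = 0" if "s \<in> S" for s using \<delta>(2)[OF that] by (intro bz) linarith
    then have "g 0 = 0" unfolding g_def by (intro sum.neutral) auto
    have gs: "g s = r s" if "s \<in> S" for s
    proof -
      have "g s = (\<Sum>s'\<in>S. if s' = s then r s' else 0)" unfolding g_def
        using bz \<delta>(3)[OF that] by (intro sum.cong) (auto simp: b_def)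
      then show ?thesis using that S(1) by simp
    qed
    have "time_change (\<lambda>t. t + g t)"
      by (rule time_change_lipschitz[where q="c / \<delta> / n", OF _ _ \<open>g 0 = 0\<close> gl])
         (use elim \<delta>(1) n in \<open>auto simp: c_def n_def\<close>)
    moreover have "\<bar>t + g t - t\<bar> \<le> e" for t using gb[of t] elim unfolding n_def by auto
    moreover have "s + g s = of_int \<lceil>n * s\<rceil> / n" if "s \<in> S" for s using gs[OF that] by (simp add: r_def)
    ultimately show ?case unfolding n_def by (intro exI[of _ "\<lambda>t. t + g t"]) blast
  qed
qed

text \<open>Once the jump times sit at grid points, rounding the changed time down cannot cross any
  of them: for a cut point s, the inequality s <= t amounts to ceiling(K s) <= K l(t), hence to
  ceiling(K s) <= floor(K l(t)), hence to s <= floor(K l(t))/K. So the sampled time lies in the same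
  cell of the partition as t.\<close>

lemma skor_conv_discretize:
  assumes x: "x \<in> Dspace"
  shows "skor_conv (\<lambda>k s. x (of_int \<lfloor>real (Suc k) * s\<rfloor> / real (Suc k))) x"
proof (rule skor_convI)
  fix n :: nat
  define e where "e = 1 / real (Suc n)"
  have e: "e > 0" by (simp add: e_def)
  obtain S where S: "finite S" "S \<subseteq> {0<..}"
    "\<And>t r. t \<in> {0..real n} \<Longrightarrow> r \<ge> 0 \<Longrightarrow> (\<forall>s\<in>S. s \<le> t \<longleftrightarrow> s \<le> r) \<Longrightarrow> dBL (x r) (x t) \<le> e"
    using Dspace_partition[OF x e, of "real n"] by blast
  show "\<forall>\<^sub>F k in sequentially. \<exists>l. time_change l \<and> (\<forall>t\<in>{0..real n}. \<bar>l t - t\<bar> \<le> 1 / real (Suc n)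
      \<and> dBL (x (of_int \<lfloor>real (Suc k) * l t\<rfloor> / real (Suc k))) (x t) \<le> 1 / real (Suc n))"
    using time_change_ceiling[OF S(1,2) e]
  proof eventually_elim
    case (elim k)
    then obtain l where l: "time_change l" "\<And>t. \<bar>l t - t\<bar> \<le> e"
      "\<And>s. s \<in> S \<Longrightarrow> l s = of_int \<lceil>real (Suc k) * s\<rceil> / real (Suc k)" by blast
    define K where "K = real (Suc k)"
    have K: "K > 0" by (simp add: K_def)
    have sm: "l u < l v" if "0 \<le> u" "u < v" for u v
      using l(1) that by (auto simp: time_change_def strict_mono_on_def)
    have "dBL (x (of_int \<lfloor>K * l t\<rfloor> / K)) (x t) \<le> e" if t: "t \<in> {0..real n}" for t
    proof (rule S(3)[OF t])
      have "l t \<ge> 0" using l(1) t by (auto simp: time_change_def)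
      then show "0 \<le> of_int \<lfloor>K * l t\<rfloor> / K" using K by simp
      show "\<forall>s\<in>S. (s \<le> t) = (s \<le> of_int \<lfloor>K * l t\<rfloor> / K)"
      proof
        fix s assume s: "s \<in> S"
        then have s0: "s > 0" using S(2) by auto
        have ls: "K * l s = of_int \<lceil>K * s\<rceil>" using l(3)[OF s] K by (simp add: K_def)
        have "s \<le> t \<longleftrightarrow> l s \<le> l t"
          using sm[of s t] sm[of t s] s0 t by (cases s t rule: linorder_cases) auto
        also have "\<dots> \<longleftrightarrow> of_int \<lceil>K * s\<rceil> \<le> K * l t" using K by (simp add: ls[symmetric])
        also have "\<dots> \<longleftrightarrow> \<lceil>K * s\<rceil> \<le> \<lfloor>K * l t\<rfloor>" by (simp add: le_floor_iff)
        also have "\<dots> \<longleftrightarrow> K * s \<le> of_int \<lfloor>K * l t\<rfloor>" by (simp add: ceiling_le_iff)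
        also have "\<dots> \<longleftrightarrow> s \<le> of_int \<lfloor>K * l t\<rfloor> / K" using K by (simp add: field_simps)
        finally show "(s \<le> t) = (s \<le> of_int \<lfloor>K * l t\<rfloor> / K)" .
      qed
    qed
    then show ?case using l(1,2) unfolding K_def e_def by blast
  qed
qed

lemma step_Dspace:
  assumes y: "\<And>i. i \<ge> 0 \<Longrightarrow> y i \<in> fmeas" and K: "K > 0"
  shows "(\<lambda>s. y \<lfloor>K * s\<rfloor>) \<in> Dspace"
proof -
  have R: "\<forall>\<^sub>F s in at_right t. \<lfloor>K * s\<rfloor> = \<lfloor>K * t\<rfloor>" for t
    unfolding eventually_at_right_field
  proof (intro exI[of _ "(of_int \<lfloor>K * t\<rfloor> + 1) / K"] conjI allI impI)
    show "t < (of_int \<lfloor>K * t\<rfloor> + 1) / K" using K by (simp add: field_simps) linarith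
    fix s assume s: "t < s" "s < (of_int \<lfloor>K * t\<rfloor> + 1) / K"
    have "K * s < of_int \<lfloor>K * t\<rfloor> + 1" "K * t < K * s" using s K by (auto simp: field_simps)
    then show "\<lfloor>K * s\<rfloor> = \<lfloor>K * t\<rfloor>" by linarith
  qed
  \<comment> \<open>At a grid point this index is the cell just left behind, elsewhere it is the
    current cell.\<close>
  have L: "\<forall>\<^sub>F s in at_left t. \<lfloor>K * s\<rfloor> = \<lceil>K * t\<rceil> - 1" for t
    unfolding eventually_at_left_field
  proof (intro exI[of _ "(of_int \<lceil>K * t\<rceil> - 1) / K"] conjI allI impI)
    show "(of_int \<lceil>K * t\<rceil> - 1) / K < t" using K by (simp add: field_simps) linarith
    fix s assume s: "s < t" "(of_int \<lceil>K * t\<rceil> - 1) / K < s"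
    have "of_int \<lceil>K * t\<rceil> - 1 < K * s" "K * s < K * t" using s K by (auto simp: field_simps)
    then show "\<lfloor>K * s\<rfloor> = \<lceil>K * t\<rceil> - 1" by linarith
  qed
  show ?thesis unfolding Dspace_def
  proof (intro CollectI conjI allI impI)
    fix t :: real assume "0 \<le> t" then show "y \<lfloor>K * t\<rfloor> \<in> fmeas" using y K by simp
  next
    fix t :: real
    show "((\<lambda>s. dBL (y \<lfloor>K * s\<rfloor>) (y \<lfloor>K * t\<rfloor>)) \<longlongrightarrow> 0) (at_right t)"
      by (rule tendsto_eventually) (use R[of t] in eventually_elim, simp add: dBL_refl)
  next
    fix t :: real assume t: "0 < t"
    have "y (\<lceil>K * t\<rceil> - 1) \<in> fmeas"
    proof (rule y)
      have "0 < K * t" using t K by simp then show "0 \<le> \<lceil>K * t\<rceil> - 1" by linarith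
    qed
    moreover have "((\<lambda>s. dBL (y \<lfloor>K * s\<rfloor>) (y (\<lceil>K * t\<rceil> - 1))) \<longlongrightarrow> 0) (at_left t)"
      by (rule tendsto_eventually) (use L[of t] in eventually_elim, simp add: dBL_refl)
    ultimately show "\<exists>\<nu>\<in>fmeas. ((\<lambda>s. dBL (y \<lfloor>K * s\<rfloor>) \<nu>) \<longlongrightarrow> 0) (at_left t)" by blast
  qed
qed

section \<open>Measurability of Skorokhod-continuous functionals\<close>

text \<open>With mesh 1/n and n^2 hats on each side the window reaches out to n, so that a single
  parameter governs both the mesh and the truncation.\<close>

lemma tent_sum_mass:
  assumes mu: "\<mu> \<in> fmeas"
  shows "(\<lambda>l. pair \<mu> (\<lambda>x. \<Sum>i\<in>{-int ((Suc l)^2)..int ((Suc l)^2)}. tent (1 / real (Suc l)) i x))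
     \<longlonglongrightarrow> measure \<mu> UNIV"
proof -
  let ?h = "\<lambda>l x. \<Sum>i\<in>{-int ((Suc l)^2)..int ((Suc l)^2)}. tent (1 / real (Suc l)) i x"
  have hBM: "?h l \<in> bdd_borel" for l by (intro bdd_borel_sum bdd_lip_bdd_borel tent_bdd_lip) simp
  have "(\<lambda>l. pair \<mu> (?h l)) \<longlonglongrightarrow> pair \<mu> (\<lambda>_. 1)"
    unfolding pair_def
  proof (rule integral_dominated_convergence[where w="\<lambda>_. 1"])
    show "AE x in \<mu>. (\<lambda>l. ?h l x) \<longlonglongrightarrow> 1"
    proof (rule AE_I2, rule tendsto_eventually)
      fix x
      obtain l0 :: nat where l0: "\<bar>x\<bar> + 1 \<le> real l0" using real_arch_simple by blast
      show "\<forall>\<^sub>F l in sequentially. ?h l x = 1"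
        unfolding eventually_sequentially
      proof (intro exI[of _ l0] allI impI)
        fix l assume l: "l0 \<le> l"
        define n where "n = real (Suc l)"
        have n: "\<bar>x\<bar> + 1 \<le> n" "n \<ge> 1" using l0 l by (auto simp: n_def)
        have "\<bar>x\<bar> * n + 1 \<le> (\<bar>x\<bar> + 1) * n" using n by (simp add: algebra_simps)
        also have "\<dots> \<le> n * n" using n by (intro mult_right_mono) auto
        also have "n * n = real ((Suc l)^2)" unfolding n_def by (simp only: power2_eq_square of_nat_mult)
        finally have "\<bar>x\<bar> / (1 / n) + 1 \<le> real ((Suc l)^2)" by simp
        then show "?h l x = 1" unfolding n_def by (intro tent_sum(2)) auto
      qed
    qed
    show "integrable \<mu> (\<lambda>_. 1::real)" using fmeas_integrable[OF mu bdd_borel_const] .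
    show "AE x in \<mu>. norm (?h l x) \<le> 1" for l
    proof (rule AE_I2)
      fix x
      have "0 \<le> ?h l x" by (intro sum_nonneg) (simp add: tent_def)
      then show "norm (?h l x) \<le> 1" using tent_sum(1)[where e="1 / real (Suc l)" and m="(Suc l)^2" and x=x] by simp
    qed
    show "?h l \<in> borel_measurable \<mu>" for l
      by (rule fmeas_measurable[OF mu bdd_borel_measurable[OF hBM]])
  qed simp
  then show ?thesis using mu by (simp add: pair_const)
qed

text \<open>Rounding the weights to multiples of the cube of the mesh keeps the rounding error
  summable over the quadratically many cells.\<close>
definition quantize :: "nat \<Rightarrow> real measure \<Rightarrow> real measure" where
  "quantize l \<mu> = atomic_meas {-int ((Suc l)^2)..int ((Suc l)^2)}
     (\<lambda>i. real (nat \<lfloor>real (Suc l)^3 * pair \<mu> (tent (1 / real (Suc l)) i)\<rfloor>) / real (Suc l)^3)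
     (\<lambda>i. of_int i * (1 / real (Suc l)))"

lemma quantize_fmeas: "quantize l \<mu> \<in> fmeas"
  unfolding quantize_def by (rule atomic_meas_fmeas) simp

text \<open>With n = l + 1 three errors vanish: rounding, at most 1/n^3 in each of 2n^2 + 1 cells;
  interpolation, the mass times the mesh 1/n; and the mass missed by the window.\<close>

lemma quantize_tendsto:
  assumes mu: "\<mu> \<in> fmeas"
  shows "(\<lambda>l. dBL (quantize l \<mu>) \<mu>) \<longlonglongrightarrow> 0"
proof -
  define H where "H l x = (\<Sum>i\<in>{-int ((Suc l)^2)..int ((Suc l)^2)}. tent (1 / real (Suc l)) i x)" for l x
  define s where "s = measure \<mu> UNIV"
  have bound: "dBL (quantize l \<mu>) \<mu> \<le> (3 + s) * (1 / real (Suc l)) + (s - pair \<mu> (H l))" for l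
  proof (rule dBL_le)
    fix f assume f: "f \<in> unit_lip"
    define n where "n = real (Suc l)"
    define m where "m = (Suc l)^2"
    have n: "n \<ge> 1" "n > 0" by (auto simp: n_def)
    have nm: "real m = n^2" by (simp add: m_def n_def)
    let ?e = "1 / n" let ?S = "{-int m..int m}"
    define a where "a i = pair \<mu> (tent ?e i)" for i
    have a0: "a i \<ge> 0" for i unfolding a_def by (rule pair_nonneg) (simp add: tent_def)
    have tBM: "tent ?e i \<in> bdd_borel" for i by (intro bdd_lip_bdd_borel tent_bdd_lip) (use n in auto)
    define g where "g x = (\<Sum>i\<in>?S. f (of_int i * ?e) * tent ?e i x)" for x
    have gBM: "g \<in> bdd_borel" unfolding g_def by (intro bdd_borel_sum bdd_borel_mult tBM)
    have pg: "pair \<mu> g = (\<Sum>i\<in>?S. f (of_int i * ?e) * a i)"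
      unfolding g_def a_def using mu tBM by (subst pair_sum) (auto intro!: bdd_borel_mult simp: pair_mult)
    have pq: "pair (quantize l \<mu>) f = (\<Sum>i\<in>?S. (real (nat \<lfloor>n^3 * a i\<rfloor>) / n^3) * f (of_int i * ?e))"
      unfolding quantize_def n_def[symmetric] m_def[symmetric] a_def
      by (rule pair_atomic_meas) (use f n in \<open>auto simp: unit_lip_bdd_borel\<close>)
    have "\<bar>pair (quantize l \<mu>) f - pair \<mu> g\<bar> = \<bar>\<Sum>i\<in>?S. (real (nat \<lfloor>n^3 * a i\<rfloor>) / n^3 - a i) * f (of_int i * ?e)\<bar>"
      by (simp add: pg pq sum_subtractf algebra_simps)
    also have "\<dots> \<le> (\<Sum>i\<in>?S. (1 / n^3) * 1)"
    proof (rule order_trans[OF sum_abs sum_mono])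
      fix i
      have "0 \<le> n^3 * a i" using a0 n by simp
      then have r: "real (nat \<lfloor>n^3 * a i\<rfloor>) = of_int \<lfloor>n^3 * a i\<rfloor>" by simp
      have "\<bar>of_int \<lfloor>n^3 * a i\<rfloor> - n^3 * a i\<bar> \<le> 1" by linarith
      then have "\<bar>of_int \<lfloor>n^3 * a i\<rfloor> - n^3 * a i\<bar> / n^3 \<le> 1 / n^3"
        using n by (intro divide_right_mono) auto
      moreover have "real (nat \<lfloor>n^3 * a i\<rfloor>) / n^3 - a i = (of_int \<lfloor>n^3 * a i\<rfloor> - n^3 * a i) / n^3"
        using n unfolding r by (simp add: field_simps)
      ultimately have "\<bar>real (nat \<lfloor>n^3 * a i\<rfloor>) / n^3 - a i\<bar> \<le> 1 / n^3"
        using n by simp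
      then show "\<bar>(real (nat \<lfloor>n^3 * a i\<rfloor>) / n^3 - a i) * f (of_int i * ?e)\<bar> \<le> (1 / n^3) * 1"
        unfolding abs_mult using f n by (intro mult_mono) (auto simp: unit_lip_def)
    qed
    also have "\<dots> = (2 * n^2 + 1) / n^3" by (simp add: nm)
    also have "\<dots> \<le> 3 * (1 / n)"
    proof -
      have "1 \<le> n^2" using n by simp
      then have "(2 * n^2 + 1) / n^3 \<le> (3 * n^2) / n^3" using n by (intro divide_right_mono) auto
      also have "\<dots> = 3 * (1 / n)" using n by (simp add: power2_eq_square power3_eq_cube)
      finally show ?thesis .
    qed
    finally have Q: "\<bar>pair (quantize l \<mu>) f - pair \<mu> g\<bar> \<le> 3 * (1 / n)" .
    have HBM: "H l \<in> bdd_borel" unfolding H_def n_def[symmetric] by (intro bdd_borel_sum tBM)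
    have "\<bar>pair \<mu> (\<lambda>x. f x - g x)\<bar> \<le> pair \<mu> (\<lambda>x. ?e + (1 - H l x))"
      using tent_approx[of ?e f, where m=m] n
      by (intro pair_abs_le mu bdd_borel_diff bdd_borel_add unit_lip_bdd_borel[OF f] gBM HBM)
         (auto simp: g_def H_def m_def n_def f)
    then have "\<bar>pair \<mu> f - pair \<mu> g\<bar> \<le> s * (1 / n) + (s - pair \<mu> (H l))"
      using mu f gBM HBM by (simp add: pair_diff pair_add unit_lip_bdd_borel bdd_borel_diff pair_const s_def)
    then show "\<bar>pair (quantize l \<mu>) f - pair \<mu> f\<bar> \<le> (3 + s) * (1 / real (Suc l)) + (s - pair \<mu> (H l))"
      using Q unfolding n_def[symmetric] distrib_right by linarith
  qed
  have "(\<lambda>l. (3 + s) * (1 / real (Suc l)) + (s - pair \<mu> (H l))) \<longlonglongrightarrow> (3 + s) * 0 + (s - s)"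
  proof (intro tendsto_add tendsto_diff tendsto_mult tendsto_const)
    show "(\<lambda>l. 1 / real (Suc l)) \<longlonglongrightarrow> 0" by (rule LIMSEQ_Suc[OF lim_1_over_n])
    show "(\<lambda>l. pair \<mu> (H l)) \<longlonglongrightarrow> s" unfolding H_def s_def by (rule tent_sum_mass[OF mu])
  qed
  then have lim: "(\<lambda>l. (3 + s) * (1 / real (Suc l)) + (s - pair \<mu> (H l))) \<longlonglongrightarrow> 0" by simp
  show ?thesis
    by (rule real_tendsto_sandwich[OF _ _ tendsto_const lim])
       (intro always_eventually allI bound dBL_nonneg quantize_fmeas mu)+
qed

text \<open>Lists over a countable type are again countable, so measurability may be checked on
  singletons. Applied twice, it covers the lists of lists that encode a quantized path.\<close>

lemma measurable_map_upt:
  fixes f :: "nat \<Rightarrow> 'a \<Rightarrow> 'b::countable"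
  assumes f: "\<And>i. i < n \<Longrightarrow> f i \<in> measurable M (count_space UNIV)"
  shows "(\<lambda>\<omega>. map (\<lambda>i. f i \<omega>) [0..<n]) \<in> measurable M (count_space UNIV)"
proof (subst measurable_count_space_eq_countable, simp, intro conjI ballI)
  fix a :: "'b list"
  have "{\<omega> \<in> space M. \<forall>i\<in>{..<n}. f i \<omega> = a ! i} \<in> sets M"
  proof (rule sets.sets_Collect_finite_All)
    fix i assume "i \<in> {..<n}"
    then have "f i -` {a ! i} \<inter> space M \<in> sets M" by (intro measurable_sets[OF f]) auto
    moreover have "f i -` {a ! i} \<inter> space M = {\<omega> \<in> space M. f i \<omega> = a ! i}" by auto
    ultimately show "{\<omega> \<in> space M. f i \<omega> = a ! i} \<in> sets M" by simp
  qed simp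
  moreover have "(\<lambda>\<omega>. map (\<lambda>i. f i \<omega>) [0..<n]) -` {a} \<inter> space M =
    (if length a = n then {\<omega> \<in> space M. \<forall>i\<in>{..<n}. f i \<omega> = a ! i} else {})"
  proof -
    have "map (\<lambda>i. f i \<omega>) [0..<n] = a \<longleftrightarrow> length a = n \<and> (\<forall>i\<in>{..<n}. f i \<omega> = a ! i)" for \<omega>
      unfolding list_eq_iff_nth_eq by auto
    then show ?thesis by auto
  qed
  ultimately show "(\<lambda>\<omega>. map (\<lambda>i. f i \<omega>) [0..<n]) -` {a} \<inter> space M \<in> sets M" by simp
qed auto

definition skor_cont :: "((real \<Rightarrow> real measure) \<Rightarrow> real) \<Rightarrow> bool" where
  "skor_cont F \<longleftrightarrow> (\<forall>ys y. (\<forall>k. ys k \<in> Dspace) \<and> y \<in> Dspace \<and> skor_conv ys y \<longrightarrow> (\<lambda>k. F (ys k)) \<longlonglongrightarrow> F y)"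

text \<open>Quantized and frozen after cell l, the step path is a function of a finite table of
  natural numbers. F composed with the decoding is a map out of a discrete space and hence
  measurable, whatever F is; as l grows, these paths converge uniformly on compact time
  intervals.\<close>

lemma step_path_measurable:
  assumes F: "skor_cont F" and K: "K > 0"
    and X: "\<And>\<omega> i. \<omega> \<in> space M \<Longrightarrow> X i \<omega> \<in> fmeas"
    and Xm: "\<And>i f. f \<in> bdd_lip \<Longrightarrow> (\<lambda>\<omega>. pair (X i \<omega>) f) \<in> borel_measurable M"
  shows "(\<lambda>\<omega>. F (\<lambda>s. X (nat \<lfloor>K * s\<rfloor>) \<omega>)) \<in> borel_measurable M"
proof (rule borel_measurable_LIMSEQ_real)
  let ?Y = "\<lambda>l \<omega> s. quantize l (X (min l (nat \<lfloor>K * s\<rfloor>)) \<omega>)"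
  fix \<omega> assume w: "\<omega> \<in> space M"
  have "skor_conv (\<lambda>l. ?Y l \<omega>) (\<lambda>s. X (nat \<lfloor>K * s\<rfloor>) \<omega>)"
  proof (rule skor_conv_uniform)
    fix T e :: real assume T: "T > 0" and e: "e > 0"
    let ?N = "nat \<lfloor>K * T\<rfloor>"
    have "\<forall>\<^sub>F l in sequentially. \<forall>i\<in>{..?N}. dBL (quantize l (X i \<omega>)) (X i \<omega>) < e"
      by (rule eventually_ball_finite) (auto intro: order_tendstoD(2)[OF quantize_tendsto[OF X[OF w]] e])
    moreover have "\<forall>\<^sub>F l in sequentially. ?N \<le> l" by (rule eventually_ge_at_top)
    ultimately show "\<forall>\<^sub>F l in sequentially. \<forall>t\<in>{0..T}. dBL (?Y l \<omega> t) (X (nat \<lfloor>K * t\<rfloor>) \<omega>) \<le> e"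
    proof eventually_elim
      case (elim l)
      show ?case
      proof
        fix t assume t: "t \<in> {0..T}"
        then have "nat \<lfloor>K * t\<rfloor> \<le> ?N" using K by (intro nat_mono floor_mono) auto
        with elim show "dBL (?Y l \<omega> t) (X (nat \<lfloor>K * t\<rfloor>) \<omega>) \<le> e" by (simp add: min_absorb2 less_imp_le)
      qed
    qed
  qed
  moreover have "?Y l \<omega> \<in> Dspace" for l
    by (rule step_Dspace[where y="\<lambda>i. quantize l (X (min l (nat i)) \<omega>)", OF quantize_fmeas K])
  moreover have "(\<lambda>s. X (nat \<lfloor>K * s\<rfloor>) \<omega>) \<in> Dspace"
    by (rule step_Dspace[where y="\<lambda>i. X (nat i) \<omega>", OF X[OF w] K])
  ultimately show "(\<lambda>l. F (?Y l \<omega>)) \<longlonglongrightarrow> F (\<lambda>s. X (nat \<lfloor>K * s\<rfloor>) \<omega>)"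
    using F by (simp add: skor_cont_def)
next
  fix l
  define n where "n = real (Suc l)"
  define m where "m = (Suc l)^2"
  define I where "I = {-int m..int m}"
  \<comment> \<open>Hat i is stored at position i + m, so that the indices from -m to m occupy 0 to
    2m; the entries are the integer numerators of the rounded weights.\<close>
  define c where "c \<omega> = map (\<lambda>i. map (\<lambda>j. nat \<lfloor>n^3 * pair (X i \<omega>) (tent (1 / n) (int j - int m))\<rfloor>) [0..<Suc (2 * m)]) [0..<Suc l]" for \<omega>
  define dec where "dec a = (\<lambda>s. atomic_meas I (\<lambda>i. real (a ! (min l (nat \<lfloor>K * s\<rfloor>)) ! (nat (i + int m))) / n^3)
     (\<lambda>i. of_int i * (1 / n)))" for a :: "nat list list"
  have "c \<in> measurable M (count_space UNIV)"
    unfolding c_def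
  proof (intro measurable_map_upt)
    fix i j
    have "tent (1 / n) (int j - int m) \<in> bdd_lip" by (rule tent_bdd_lip) (simp add: n_def)
    from Xm[OF this] have [measurable]: "(\<lambda>\<omega>. pair (X i \<omega>) (tent (1 / n) (int j - int m))) \<in> borel_measurable M" .
    show "(\<lambda>\<omega>. nat \<lfloor>n^3 * pair (X i \<omega>) (tent (1 / n) (int j - int m))\<rfloor>) \<in> measurable M (count_space UNIV)"
      by measurable
  qed
  then have "(\<lambda>\<omega>. F (dec (c \<omega>))) \<in> borel_measurable M"
    by (rule measurable_compose) simp
  moreover have "dec (c \<omega>) = (\<lambda>s. quantize l (X (min l (nat \<lfloor>K * s\<rfloor>)) \<omega>))" for \<omega>
  proof -
    have c: "c \<omega> ! (min l k) ! (nat (i + int m)) =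
       nat \<lfloor>n^3 * pair (X (min l k) \<omega>) (tent (1 / n) i)\<rfloor>" if "i \<in> I" for i k
    proof -
      have "nat (i + int m) < Suc (2 * m)" "min l k < Suc l" "int (nat (i + int m)) = i + int m"
        using that by (auto simp: I_def)
      then show ?thesis unfolding c_def by (simp del: upt_Suc)
    qed
    show ?thesis unfolding dec_def quantize_def n_def[symmetric] m_def[symmetric] I_def[symmetric] atomic_meas_def
    proof
      fix s
      let ?k = "min l (nat \<lfloor>K * s\<rfloor>)"
      have "point_measure I (\<lambda>i. ennreal (real (c \<omega> ! ?k ! nat (i + int m)) / n^3)) =
        point_measure I (\<lambda>i. ennreal (real (nat \<lfloor>n^3 * pair (X ?k \<omega>) (tent (1 / n) i)\<rfloor>) / n^3))"
        unfolding point_measure_def by (rule density_cong) (auto simp: c AE_count_space)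
      then show "distr (point_measure I (\<lambda>i. ennreal (real (c \<omega> ! ?k ! nat (i + int m)) / n^3))) borel (\<lambda>i. of_int i * (1 / n)) =
        distr (point_measure I (\<lambda>i. ennreal (real (nat \<lfloor>n^3 * pair (X ?k \<omega>) (tent (1 / n) i)\<rfloor>) / n^3))) borel (\<lambda>i. of_int i * (1 / n))"
        by simp
    qed
  qed
  ultimately show "(\<lambda>\<omega>. F (\<lambda>s. quantize l (X (min l (nat \<lfloor>K * s\<rfloor>)) \<omega>))) \<in> borel_measurable M"
    by simp
qed

text \<open>Sampling on a grid reduces to step paths, and \<open>skor_conv_discretize\<close>
  recovers the given path in the limit. Outside \<open>Dspace\<close> continuity says nothing about
  F; there the indicator removes F, provided the event itself is measurable.\<close>

lemma skor_measurable:
  assumes F: "skor_cont F"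
    and X: "\<And>\<omega> t. \<omega> \<in> space M \<Longrightarrow> t \<ge> 0 \<Longrightarrow> X \<omega> t \<in> fmeas"
    and Xm: "\<And>t f. t \<ge> 0 \<Longrightarrow> f \<in> bdd_lip \<Longrightarrow> (\<lambda>\<omega>. pair (X \<omega> t) f) \<in> borel_measurable M"
    and G: "{\<omega> \<in> space M. X \<omega> \<in> Dspace} \<in> sets M"
  shows "(\<lambda>\<omega>. indicator {\<omega>. X \<omega> \<in> Dspace} \<omega> * F (X \<omega>)) \<in> borel_measurable M"
proof (rule borel_measurable_LIMSEQ_real)
  let ?Y = "\<lambda>k \<omega> s. X \<omega> (of_nat (nat \<lfloor>real (Suc k) * s\<rfloor>) / real (Suc k))"
  fix \<omega> assume w: "\<omega> \<in> space M"
  show "(\<lambda>k. indicator {\<omega>. X \<omega> \<in> Dspace} \<omega> * F (?Y k \<omega>)) \<longlonglongrightarrow> indicator {\<omega>. X \<omega> \<in> Dspace} \<omega> * F (X \<omega>)"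
  proof (cases "X \<omega> \<in> Dspace")
    case True
    have "?Y k \<omega> \<in> Dspace" for k
      by (rule step_Dspace[where y="\<lambda>i. X \<omega> (of_nat (nat i) / real (Suc k))" and K="real (Suc k)"])
         (auto intro!: X w)
    moreover have "skor_conv (\<lambda>k. ?Y k \<omega>) (X \<omega>)"
    proof -
      obtain l where l: "\<forall>k. strict_mono_on {0..} (l k) \<and> continuous_on {0..} (l k) \<and> l k ` {0..} = {0::real..}"
        "\<forall>T>0. \<forall>e>0. \<forall>\<^sub>F k in sequentially. \<forall>t\<in>{0..T}. \<bar>l k t - t\<bar> \<le> e"
        "\<forall>T>0. \<forall>e>0. \<forall>\<^sub>F k in sequentially. \<forall>t\<in>{0..T}.
            dBL (X \<omega> (of_int \<lfloor>real (Suc k) * l k t\<rfloor> / real (Suc k))) (X \<omega> t) \<le> e"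
        using skor_conv_discretize[OF True] unfolding skor_conv_def by blast
      \<comment> \<open>\<open>nat\<close> alters the floor only at negative times, which a time
        change never produces.\<close>
      have Yeq: "?Y k \<omega> (l k t) = X \<omega> (of_int \<lfloor>real (Suc k) * l k t\<rfloor> / real (Suc k))" if "t \<ge> 0" for k t
      proof -
        have "l k t \<ge> 0" using l(1) that by auto
        then show ?thesis by simp
      qed
      have "\<forall>T>0. \<forall>e>0. \<forall>\<^sub>F k in sequentially. \<forall>t\<in>{0..T}. dBL (?Y k \<omega> (l k t)) (X \<omega> t) \<le> e"
      proof (intro allI impI)
        fix T e :: real assume "T > 0" "e > 0"
        with l(3) have "\<forall>\<^sub>F k in sequentially. \<forall>t\<in>{0..T}.
            dBL (X \<omega> (of_int \<lfloor>real (Suc k) * l k t\<rfloor> / real (Suc k))) (X \<omega> t) \<le> e" by blast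
        then show "\<forall>\<^sub>F k in sequentially. \<forall>t\<in>{0..T}. dBL (?Y k \<omega> (l k t)) (X \<omega> t) \<le> e"
        proof (rule eventually_mono, intro ballI)
          fix k t
          assume "\<forall>t\<in>{0..T}. dBL (X \<omega> (of_int \<lfloor>real (Suc k) * l k t\<rfloor> / real (Suc k))) (X \<omega> t) \<le> e"
            and "t \<in> {0..T}"
          then show "dBL (?Y k \<omega> (l k t)) (X \<omega> t) \<le> e" using Yeq[of t k] by (simp only: atLeastAtMost_iff)
        qed
      qed
      then show ?thesis unfolding skor_conv_def using l(1,2) by blast
    qed
    ultimately have "(\<lambda>k. F (?Y k \<omega>)) \<longlonglongrightarrow> F (X \<omega>)"
      using F True by (simp add: skor_cont_def)
    then show ?thesis using True by simp
  qed simp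
next
  fix k
  have *: "(\<lambda>\<omega>. F (\<lambda>s. X \<omega> (of_nat (nat \<lfloor>real (Suc k) * s\<rfloor>) / real (Suc k)))) \<in> borel_measurable M"
    by (rule step_path_measurable[OF F, where X="\<lambda>i \<omega>. X \<omega> (of_nat i / real (Suc k))" and K="real (Suc k)"])
       (auto intro!: X Xm)
  have "(indicator {\<omega> \<in> space M. X \<omega> \<in> Dspace} :: _ \<Rightarrow> real) \<in> borel_measurable M" using G by simp
  then have "(indicator {\<omega>. X \<omega> \<in> Dspace} :: _ \<Rightarrow> real) \<in> borel_measurable M"
    by (rule measurable_cong[THEN iffD1, rotated]) (auto simp: indicator_def)
  then show "(\<lambda>\<omega>. indicator {\<omega>. X \<omega> \<in> Dspace} \<omega> * F (\<lambda>s. X \<omega> (of_nat (nat \<lfloor>real (Suc k) * s\<rfloor>) / real (Suc k)))) \<in> borel_measurable M"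
    using * by (rule borel_measurable_times)
qed

section \<open>Paths of the profile process\<close>

text \<open>Only the masses of Borel sets are known to be measurable in \<omega>. Induction over
  nonnegative integrands extends this to their integrals; adding a bound B, whose integral is
  finite, makes f nonnegative.\<close>

lemma kernel_pair_measurable:
  assumes K: "\<And>\<omega>. \<omega> \<in> space M \<Longrightarrow> K \<omega> \<in> fmeas"
    and Km: "\<And>B. B \<in> sets borel \<Longrightarrow> (\<lambda>\<omega>. emeasure (K \<omega>) B) \<in> borel_measurable M"
    and f: "f \<in> bdd_borel"
  shows "(\<lambda>\<omega>. pair (K \<omega>) f) \<in> borel_measurable M"
proof -
  have nn: "(\<lambda>\<omega>. \<integral>\<^sup>+x. h x \<partial>K \<omega>) \<in> borel_measurable M" if "h \<in> borel_measurable borel" for h :: "real \<Rightarrow> ennreal"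
    using that
  proof induction
    case (cong f g)
    then have "f = g" by auto
    then show ?case using cong by simp
  next
    case (set A)
    then show ?case using Km[OF set] K by (subst measurable_cong[where g="\<lambda>\<omega>. emeasure (K \<omega>) A"]) (auto simp: fmeas_sets)
  next
    case (mult u c)
    have eq: "(\<integral>\<^sup>+x. c * u x \<partial>K \<omega>) = c * (\<integral>\<^sup>+x. u x \<partial>K \<omega>)" if "\<omega> \<in> space M" for \<omega>
      using mult(2) by (intro nn_integral_cmult) (simp add: measurable_cong_sets[OF fmeas_sets[OF K[OF that]] refl])
    have "(\<lambda>\<omega>. c * (\<integral>\<^sup>+x. u x \<partial>K \<omega>)) \<in> borel_measurable M" using mult by simp
    then show ?case by (rule measurable_cong[THEN iffD1, rotated]) (rule eq[symmetric])
  next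
    case (add u v)
    have eq: "(\<integral>\<^sup>+x. v x + u x \<partial>K \<omega>) = (\<integral>\<^sup>+x. v x \<partial>K \<omega>) + (\<integral>\<^sup>+x. u x \<partial>K \<omega>)" if "\<omega> \<in> space M" for \<omega>
      using add by (intro nn_integral_add) (simp_all add: measurable_cong_sets[OF fmeas_sets[OF K[OF that]] refl])
    have "(\<lambda>\<omega>. (\<integral>\<^sup>+x. v x \<partial>K \<omega>) + (\<integral>\<^sup>+x. u x \<partial>K \<omega>)) \<in> borel_measurable M" using add by simp
    then show ?case by (rule measurable_cong[THEN iffD1, rotated]) (rule eq[symmetric])
  next
    case (seq U)
    have eq: "(\<integral>\<^sup>+x. (SUP i. U i) x \<partial>K \<omega>) = (SUP i. \<integral>\<^sup>+x. U i x \<partial>K \<omega>)" if "\<omega> \<in> space M" for \<omega>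
      unfolding SUP_apply
      using seq by (intro nn_integral_monotone_convergence_SUP) (simp_all add: measurable_cong_sets[OF fmeas_sets[OF K[OF that]] refl])
    have "(\<lambda>\<omega>. SUP i. \<integral>\<^sup>+x. U i x \<partial>K \<omega>) \<in> borel_measurable M" using seq by simp
    then show ?case by (rule measurable_cong[THEN iffD1, rotated]) (rule eq[symmetric])
  qed
  obtain B where B: "B \<ge> 0" "\<And>x. \<bar>f x\<bar> \<le> B" using bdd_borel_bound[OF f] by metis
  have fB: "(\<lambda>x. f x + B) \<in> bdd_borel" "\<And>x. 0 \<le> f x + B"
    using bdd_borel_add[OF f bdd_borel_const[of B]] by simp (use B(2) in \<open>smt (verit)\<close>)
  have "(\<lambda>\<omega>. enn2real (\<integral>\<^sup>+x. ennreal (f x + B) \<partial>K \<omega>) - enn2real (\<integral>\<^sup>+x. ennreal B \<partial>K \<omega>)) \<in> borel_measurable M"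
    using fB(1) by (intro borel_measurable_diff borel_measurable_enn2real nn) (auto simp: bdd_borel_def)
  moreover have "pair (K \<omega>) f = enn2real (\<integral>\<^sup>+x. ennreal (f x + B) \<partial>K \<omega>) - enn2real (\<integral>\<^sup>+x. ennreal B \<partial>K \<omega>)"
    if w: "\<omega> \<in> space M" for \<omega>
  proof -
    have "pair (K \<omega>) (\<lambda>x. f x + B) = enn2real (\<integral>\<^sup>+x. ennreal (f x + B) \<partial>K \<omega>)"
      using fmeas_pair_nn[OF K[OF w] fB] pair_nonneg[of "\<lambda>x. f x + B" "K \<omega>", OF fB(2)] by (metis enn2real_ennreal)
    moreover have "pair (K \<omega>) (\<lambda>x. B) = enn2real (\<integral>\<^sup>+x. ennreal B \<partial>K \<omega>)"
      using fmeas_pair_nn[OF K[OF w] bdd_borel_const[of B]] pair_nonneg[of "\<lambda>x. B" "K \<omega>"] B(1) by (metis enn2real_ennreal)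
    moreover have "pair (K \<omega>) (\<lambda>x. f x + B) = pair (K \<omega>) f + pair (K \<omega>) (\<lambda>x. B)"
      by (rule pair_add[OF K[OF w] f bdd_borel_const])
    ultimately show ?thesis by simp
  qed
  ultimately show ?thesis by (subst measurable_cong) auto
qed

text \<open>The sum over an infinite index set is zero by convention, so infinitely many arrivals count as none.\<close>
definition arrived :: "(nat \<Rightarrow> real) \<Rightarrow> real \<Rightarrow> nat set" where
  "arrived T t = (if finite {k. T k \<le> t} then {k. T k \<le> t} else {})"

lemma finite_arrived [simp]: "finite (arrived T t)" by (simp add: arrived_def)

lemma sum_arrived: "(\<Sum>k\<in>{k. T k \<le> t}. g k) = (\<Sum>k\<in>arrived T t. g k)"
  by (simp add: arrived_def)

lemma card_arrived: "card (arrived T t) = card {k. T k \<le> t}"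
  by (simp add: arrived_def)

text \<open>The two sets are nested, so equal finite cardinalities force equality. If the larger one
  is infinite, its cardinality is 0 by convention; the smaller one is then empty or infinite, and
  \<open>arrived\<close> is empty at both times.\<close>

lemma arrived_eq_card:
  assumes "card {k. T k \<le> s} = card {k. T k \<le> t}"
  shows "arrived T s = arrived T t"
proof -
  have *: "arrived T s = arrived T t" if "s \<le> t" "card {k. T k \<le> s} = card {k. T k \<le> t}" for s t
  proof (cases "finite {k. T k \<le> t}")
    case True
    have sub: "{k. T k \<le> s} \<subseteq> {k. T k \<le> t}" using that(1) by auto
    have "{k. T k \<le> s} = {k. T k \<le> t}" by (rule card_subset_eq[OF True sub that(2)])
    then show ?thesis by (simp add: arrived_def)
  next
    case False
    then have "card (arrived T s) = 0" using that(2) by (simp add: card_arrived)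
    then show ?thesis using False by (simp add: arrived_def split: if_splits)
  qed
  show ?thesis
  proof (cases "s \<le> t")
    case True
    then show ?thesis by (rule *[OF _ assms])
  next
    case False
    then have "t \<le> s" by simp
    then show ?thesis by (rule *[OF _ assms[symmetric], symmetric])
  qed
qed

text \<open>Finiteness of the index set says that from some m on no index qualifies, a countable
  condition. On that event the partial sums become constant, and off it the sum is 0.\<close>

lemma sum_arrived_measurable:
  fixes g :: "nat \<Rightarrow> 'a \<Rightarrow> real"
  assumes T [measurable]: "\<And>k. T k \<in> borel_measurable M" and g [measurable]: "\<And>k. g k \<in> borel_measurable M"
  shows "(\<lambda>\<omega>. \<Sum>k\<in>arrived (\<lambda>k. T k \<omega>) t. g k \<omega>) \<in> borel_measurable M"
proof (rule borel_measurable_LIMSEQ_real)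
  let ?fin = "\<lambda>\<omega>. \<exists>m. \<forall>k. m \<le> k \<longrightarrow> t < T k \<omega>"
  let ?u = "\<lambda>m \<omega>. if ?fin \<omega> then \<Sum>k<m. if T k \<omega> \<le> t then g k \<omega> else 0 else 0"
  have fin: "?fin \<omega> \<longleftrightarrow> finite {k. T k \<omega> \<le> t}" for \<omega>
    unfolding finite_nat_iff_bounded by (auto simp: subset_eq not_le) (metis not_le)+
  fix \<omega>
  show "(\<lambda>m. ?u m \<omega>) \<longlonglongrightarrow> (\<Sum>k\<in>arrived (\<lambda>k. T k \<omega>) t. g k \<omega>)"
  proof (cases "?fin \<omega>")
    case True
    then obtain m0 where m0: "\<And>k. m0 \<le> k \<Longrightarrow> t < T k \<omega>" by blast
    have "?u m \<omega> = (\<Sum>k\<in>arrived (\<lambda>k. T k \<omega>) t. g k \<omega>)" if "m0 \<le> m" for m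
    proof -
      have sub: "arrived (\<lambda>k. T k \<omega>) t \<subseteq> {..<m}"
      proof
        fix k assume "k \<in> arrived (\<lambda>k. T k \<omega>) t"
        then have "\<not> m0 \<le> k" using m0[of k] by (auto simp: arrived_def split: if_splits)
        then show "k \<in> {..<m}" using that by simp
      qed
      have mem: "k \<in> arrived (\<lambda>k. T k \<omega>) t \<longleftrightarrow> T k \<omega> \<le> t" for k using True fin by (simp add: arrived_def)
      have "(\<Sum>k<m. if T k \<omega> \<le> t then g k \<omega> else 0) = (\<Sum>k\<in>arrived (\<lambda>k. T k \<omega>) t. g k \<omega>)"
        by (rule sum.mono_neutral_cong_right) (use sub mem in auto)
      then show ?thesis using True by simp
    qed
    then show ?thesis 
      by (intro tendsto_eventually) (unfold eventually_sequentially, intro exI[of _ m0] allI impI)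
  next
    case False
    then show ?thesis using fin by (simp add: arrived_def)
  qed
next
  fix m
  show "(\<lambda>\<omega>. if \<exists>m. \<forall>k. m \<le> k \<longrightarrow> t < T k \<omega> then \<Sum>k<m. if T k \<omega> \<le> t then g k \<omega> else 0 else 0) \<in> borel_measurable M"
    by measurable
qed

section \<open>Decomposition of the normalized profile\<close>

lemma nrm_fmeas: "\<nu> \<in> fmeas \<Longrightarrow> nrm n \<nu> \<in> fmeas"
  unfolding nrm_def by (intro scale_fmeas distr_fmeas) auto

lemma pair_nrm: assumes "\<nu> \<in> fmeas" "f \<in> bdd_borel"
  shows "pair (nrm n \<nu>) f = pair \<nu> (\<lambda>x. f (x / real n)) / real n"
  unfolding nrm_def using assms by (simp add: pair_scale distr_fmeas pair_distr)

text \<open>\<open>measure_sum\<close> has the same shape as \<open>prof\<close>, a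
  \<open>measure_of\<close> of an explicit set function, so the two set functions need only agree on
  Borel sets. The default value of an infinite sum in \<open>prof\<close> is matched by
  \<open>arrived\<close>.\<close>

lemma prof_eq:
  assumes mu: "\<mu> \<in> fmeas"
  shows "prof \<mu> T \<sigma> t = measure_sum (distr \<mu> borel (\<lambda>y. y - t)) (atomic_meas (arrived T t) (\<lambda>_. 1) (\<lambda>k. T k + \<sigma> k - t))"
  unfolding prof_def measure_sum_def
proof (rule measure_of_eq)
  fix B assume "B \<in> sigma_sets UNIV (sets (borel::real measure))"
  then have B: "B \<in> sets borel" using sets.sigma_sets_eq[of "borel::real measure"] by simp
  have m: "(\<lambda>y. y - t) \<in> measurable \<mu> borel" by (rule fmeas_measurable[OF mu]) simp
  have "emeasure (distr \<mu> borel (\<lambda>y. y - t)) B = emeasure \<mu> {y. y - t \<in> B}"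
    using emeasure_distr[OF m B] by (simp add: fmeas_space[OF mu] vimage_def)
  then show "emeasure \<mu> {y. y - t \<in> B} + (\<Sum>k\<in>{k. T k \<le> t}. indicator B (T k + \<sigma> k - t)) =
    emeasure (distr \<mu> borel (\<lambda>y. y - t)) B + emeasure (atomic_meas (arrived T t) (\<lambda>_. 1) (\<lambda>k. T k + \<sigma> k - t)) B"
    by (simp add: emeasure_atomic_meas B sum_arrived)
qed simp

lemma prof_fmeas: "\<mu> \<in> fmeas \<Longrightarrow> prof \<mu> T \<sigma> t \<in> fmeas"
  unfolding prof_eq by (intro measure_sum_fmeas distr_fmeas atomic_meas_fmeas) auto

lemma nprof_fmeas: "\<mu> \<in> fmeas \<Longrightarrow> nprof n \<mu> T \<sigma> t \<in> fmeas"
  unfolding nprof_def by (intro nrm_fmeas prof_fmeas)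

text \<open>The atoms are the scaled departure times, in a frame that does not move with t: time
  enters only through the set of customers counted.\<close>

definition arrival_meas :: "nat \<Rightarrow> (nat \<Rightarrow> real) \<Rightarrow> (nat \<Rightarrow> real) \<Rightarrow> real \<Rightarrow> real measure" where
  "arrival_meas n T \<sigma> t = atomic_meas (arrived (\<lambda>k. T k / real n) t) (\<lambda>_. 1 / real n) (\<lambda>k. (T k + \<sigma> k) / real n)"

lemma arrival_meas_fmeas: "arrival_meas n T \<sigma> t \<in> fmeas"
  unfolding arrival_meas_def by (rule atomic_meas_fmeas) simp

lemma pair_arrival_meas: "f \<in> bdd_borel \<Longrightarrow> pair (arrival_meas n T \<sigma> t) f = (\<Sum>k\<in>arrived (\<lambda>k. T k / real n) t. f ((T k + \<sigma> k) / real n)) / real n"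
  unfolding arrival_meas_def by (subst pair_atomic_meas) (auto simp: sum_divide_distrib)

lemma nprof_pair:
  assumes mu: "\<mu> \<in> fmeas" and f: "f \<in> bdd_borel" and n: "n > 0"
  shows "pair (nprof n \<mu> T \<sigma> t) f = pair (nrm n \<mu>) (\<lambda>y. f (y - t)) + pair (arrival_meas n T \<sigma> t) (\<lambda>y. f (y - t))"
proof -
  have g: "(\<lambda>x. f (x / real n)) \<in> bdd_borel" by (rule bdd_borel_comp[OF f]) simp
  have h: "(\<lambda>x. f (x - t)) \<in> bdd_borel" by (rule bdd_borel_shift[OF f])
  have c: "arrived T (real n * t) = arrived (\<lambda>k. T k / real n) t"
    using n by (simp add: arrived_def field_simps)
  have "pair (nprof n \<mu> T \<sigma> t) f = pair (prof \<mu> T \<sigma> (real n * t)) (\<lambda>x. f (x / real n)) / real n"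
    unfolding nprof_def by (rule pair_nrm[OF prof_fmeas[OF mu] f])
  also have "pair (prof \<mu> T \<sigma> (real n * t)) (\<lambda>x. f (x / real n)) =
    pair \<mu> (\<lambda>y. f ((y - real n * t) / real n)) + (\<Sum>k\<in>arrived T (real n * t). f ((T k + \<sigma> k - real n * t) / real n))"
    unfolding prof_eq[OF mu] using mu g
    by (simp add: pair_measure_sum distr_fmeas atomic_meas_fmeas pair_distr pair_atomic_meas)
  also have "\<dots> = pair \<mu> (\<lambda>y. f (y / real n - t)) + (\<Sum>k\<in>arrived (\<lambda>k. T k / real n) t. f ((T k + \<sigma> k) / real n - t))"
    using n by (simp add: c diff_divide_distrib)
  finally show ?thesis using mu h by (simp add: pair_nrm pair_arrival_meas add_divide_distrib)
qed

lemma nrm_pair_measurable: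
  assumes mu: "\<And>\<omega>. \<omega> \<in> space M \<Longrightarrow> \<mu> \<omega> \<in> fmeas"
    and mum: "\<And>B. B \<in> sets borel \<Longrightarrow> (\<lambda>\<omega>. emeasure (\<mu> \<omega>) B) \<in> borel_measurable M"
    and f: "f \<in> bdd_borel"
  shows "(\<lambda>\<omega>. pair (nrm n (\<mu> \<omega>)) f) \<in> borel_measurable M"
proof -
  have "(\<lambda>\<omega>. pair (\<mu> \<omega>) (\<lambda>x. f (x / real n)) / real n) \<in> borel_measurable M"
    by (intro borel_measurable_divide kernel_pair_measurable mu mum bdd_borel_comp[OF f]) auto
  then show ?thesis by (subst measurable_cong) (simp_all add: pair_nrm mu f)
qed

lemma arrival_meas_pair_measurable:
  assumes [measurable]: "\<And>k. T k \<in> borel_measurable M" "\<And>k. \<sigma> k \<in> borel_measurable M"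
    and f: "f \<in> bdd_borel"
  shows "(\<lambda>\<omega>. pair (arrival_meas n (\<lambda>k. T k \<omega>) (\<lambda>k. \<sigma> k \<omega>) t) f) \<in> borel_measurable M"
proof -
  have [measurable]: "f \<in> borel_measurable borel" using f by (simp add: bdd_borel_def)
  show ?thesis unfolding pair_arrival_meas[OF f]
    by (intro borel_measurable_divide sum_arrived_measurable) measurable
qed

text \<open>The part of the cadlag property that concerns the counting function; integer values turn
  one-sided limits into one-sided local constancy. An infinite set has cardinality 0, so a count
  that explodes falls back to 0, and such a path may still be cadlag.\<close>

definition cadlag_count :: "(nat \<Rightarrow> real) \<Rightarrow> bool" where
  "cadlag_count R \<longleftrightarrow> (\<forall>t\<ge>0. \<forall>\<^sub>F s in at_right t. card {k. R k \<le> s} = card {k. R k \<le> t})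
     \<and> (\<forall>t>0. \<exists>m. \<forall>\<^sub>F s in at_left t. card {k. R k \<le> s} = m)"

lemma nprof_mass:
  assumes "\<mu> \<in> fmeas" "n > 0"
  shows "measure (nprof n \<mu> T \<sigma> t) UNIV = measure (nrm n \<mu>) UNIV + real (card {k. T k / real n \<le> t}) / real n"
  using nprof_pair[OF assms(1) bdd_borel_const assms(2), of T \<sigma> t 1] assms
  by (simp add: pair_const nprof_fmeas nrm_fmeas pair_arrival_meas card_arrived[symmetric] flip: pair_const[OF arrival_meas_fmeas])

text \<open>The distance dominates differences of masses, and the masses along the path differ by
  multiples of 1/n. Two values at distance less than 1/(2n) from a common measure therefore have
  equal counts.\<close>

lemma nprof_Dspace_imp:
  assumes mu: "\<mu> \<in> fmeas" and n: "n > 0" and D: "nprof n \<mu> T \<sigma> \<in> Dspace"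
  shows "cadlag_count (\<lambda>k. T k / real n)"
proof -
  let ?x = "nprof n \<mu> T \<sigma>"
  let ?c = "\<lambda>t. card {k. T k / real n \<le> t}"
  have m: "\<bar>measure (nrm n \<mu>) UNIV + real (?c s) / real n - measure \<nu> UNIV\<bar> \<le> dBL (?x s) \<nu>" if "\<nu> \<in> fmeas" for s \<nu>
    using dBL_mass[OF nprof_fmeas[OF mu] that, of n T \<sigma> s] nprof_mass[OF mu n] by simp
  have near: "?c s = ?c u" if "\<nu> \<in> fmeas" "dBL (?x s) \<nu> < 1 / (2 * real n)" "dBL (?x u) \<nu> < 1 / (2 * real n)" for s u \<nu>
  proof -
    have "\<bar>real (?c s) / real n - real (?c u) / real n\<bar> < 1 / (2 * real n) + 1 / (2 * real n)"
      using m[OF that(1), of s] m[OF that(1), of u] that(2,3) by linarith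
    also have "\<dots> = 1 / real n" using n by (simp add: field_simps)
    finally have "\<bar>real (?c s) - real (?c u)\<bar> / real n < 1 / real n" by (simp add: diff_divide_distrib[symmetric])
    then have "\<bar>real (?c s) - real (?c u)\<bar> < 1" using n by (simp add: divide_less_cancel)
    then show ?thesis by linarith
  qed
  have pos: "0 < 1 / (2 * real n)" using n by simp
  show ?thesis unfolding cadlag_count_def
  proof (intro conjI allI impI)
    fix t :: real assume t: "0 \<le> t"
    then have "((\<lambda>s. dBL (?x s) (?x t)) \<longlongrightarrow> 0) (at_right t)" using D by (auto simp: Dspace_def)
    then have "\<forall>\<^sub>F s in at_right t. dBL (?x s) (?x t) < 1 / (2 * real n)" by (rule order_tendstoD(2)[OF _ pos])
    then show "\<forall>\<^sub>F s in at_right t. ?c s = ?c t"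
      by (rule eventually_mono) (rule near[OF nprof_fmeas[OF mu]], auto simp: dBL_refl n)
  next
    fix t :: real assume t: "0 < t"
    have "\<forall>t>0. \<exists>\<nu>\<in>fmeas. ((\<lambda>s. dBL (?x s) \<nu>) \<longlongrightarrow> 0) (at_left t)"
      using D unfolding Dspace_def by blast
    then obtain \<nu> where nu: "\<nu> \<in> fmeas" "((\<lambda>s. dBL (?x s) \<nu>) \<longlongrightarrow> 0) (at_left t)" using t by blast
    have ev: "\<forall>\<^sub>F s in at_left t. dBL (?x s) \<nu> < 1 / (2 * real n)" by (rule order_tendstoD(2)[OF nu(2) pos])
    then obtain b where b: "b < t" "\<And>s. b < s \<Longrightarrow> s < t \<Longrightarrow> dBL (?x s) \<nu> < 1 / (2 * real n)"
      unfolding eventually_at_left_field by blast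
    have "dBL (?x ((b + t) / 2)) \<nu> < 1 / (2 * real n)" using b by (intro b(2)) auto
    then have "\<forall>\<^sub>F s in at_left t. ?c s = ?c ((b + t) / 2)"
      using ev near[OF nu(1)] by (auto elim: eventually_mono)
    then show "\<exists>m. \<forall>\<^sub>F s in at_left t. ?c s = m" by blast
  qed
qed

text \<open>While the set of counted customers stays fixed, the profile is merely translated, which
  is Lipschitz in time for the distance. Local constancy of the count makes this set constant on
  each side of t.\<close>

lemma cadlag_count_imp:
  assumes mu: "\<mu> \<in> fmeas" and n: "n > 0" and Q: "cadlag_count (\<lambda>k. T k / real n)"
  shows "nprof n \<mu> T \<sigma> \<in> Dspace"
proof -
  let ?x = "nprof n \<mu> T \<sigma>"
  let ?R = "\<lambda>k. T k / real n"
  \<comment> \<open>The profile at time t with the set of counted customers frozen at C; it provides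
    the left limits.\<close>
  define z where "z C t = measure_sum (distr (nrm n \<mu>) borel (\<lambda>y. y - t)) (atomic_meas C (\<lambda>_. 1 / real n) (\<lambda>k. (T k + \<sigma> k) / real n - t))" for C t
  have zf: "z C t \<in> fmeas" if "finite C" for C t
    unfolding z_def using that by (intro measure_sum_fmeas distr_fmeas nrm_fmeas atomic_meas_fmeas mu) auto
  have zp: "pair (z C t) f = pair (nrm n \<mu>) (\<lambda>y. f (y - t)) + (\<Sum>k\<in>C. f ((T k + \<sigma> k) / real n - t)) / real n"
    if "finite C" "f \<in> bdd_borel" for C t f
    unfolding z_def using that
    by (simp add: pair_measure_sum distr_fmeas nrm_fmeas atomic_meas_fmeas mu pair_distr pair_atomic_meas sum_divide_distrib)
  have xz: "pair (?x t) f = pair (z (arrived ?R t) t) f" if "f \<in> bdd_borel" for t f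
    using that by (simp add: zp nprof_pair[OF mu _ n] pair_arrival_meas bdd_borel_shift)
  have xz': "dBL (?x s) (z (arrived ?R t) t) = dBL (?x s) (?x t)" for s t
    unfolding dBL_unit_lip by (intro SUP_cong refl) (simp add: xz unit_lip_bdd_borel)
  have lip: "dBL (?x s) (z C t) \<le> \<bar>s - t\<bar> * (measure (nrm n \<mu>) UNIV + real (card C) / real n)"
    if C: "finite C" "arrived ?R s = C" for s t C
  proof (rule dBL_le)
    fix f assume f: "f \<in> unit_lip"
    have fl: "\<bar>f (y - s) - f (y - t)\<bar> \<le> \<bar>s - t\<bar>" for y
    proof -
      have "\<bar>f (y - s) - f (y - t)\<bar> \<le> \<bar>(y - s) - (y - t)\<bar>" using f unfolding unit_lip_def by blast
      then show ?thesis by simp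
    qed
    have fBM: "(\<lambda>y. f (y - s)) \<in> bdd_borel" "(\<lambda>y. f (y - t)) \<in> bdd_borel" by (intro bdd_borel_shift unit_lip_bdd_borel f)+
    have 1: "\<bar>pair (nrm n \<mu>) (\<lambda>y. f (y - s) - f (y - t))\<bar> \<le> \<bar>s - t\<bar> * measure (nrm n \<mu>) UNIV"
      by (intro pair_bound nrm_fmeas mu bdd_borel_diff fBM fl)
    have "\<bar>\<Sum>k\<in>C. f ((T k + \<sigma> k) / real n - s) - f ((T k + \<sigma> k) / real n - t)\<bar> \<le> (\<Sum>k\<in>C. \<bar>s - t\<bar>)"
      by (rule order_trans[OF sum_abs sum_mono]) (rule fl)
    then have 2: "\<bar>(\<Sum>k\<in>C. f ((T k + \<sigma> k) / real n - s) - f ((T k + \<sigma> k) / real n - t)) / real n\<bar> \<le> \<bar>s - t\<bar> * (real (card C) / real n)"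
      using n by (simp add: divide_right_mono mult.commute)
    have "pair (?x s) f - pair (z C t) f = pair (nrm n \<mu>) (\<lambda>y. f (y - s) - f (y - t))
        + (\<Sum>k\<in>C. f ((T k + \<sigma> k) / real n - s) - f ((T k + \<sigma> k) / real n - t)) / real n"
      using C f fBM by (simp add: xz unit_lip_bdd_borel zp pair_diff nrm_fmeas mu sum_subtractf diff_divide_distrib)
    then show "\<bar>pair (?x s) f - pair (z C t) f\<bar> \<le> \<bar>s - t\<bar> * (measure (nrm n \<mu>) UNIV + real (card C) / real n)"
      using 1 2 unfolding distrib_left by linarith
  qed
  have lim: "((\<lambda>s. dBL (?x s) (z C t)) \<longlongrightarrow> 0) (at t within S)"
    if C: "finite C" and ev: "\<forall>\<^sub>F s in at t within S. arrived ?R s = C" for S C t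
  proof (rule real_tendsto_sandwich[OF _ _ tendsto_const])
    show "\<forall>\<^sub>F s in at t within S. dBL (?x s) (z C t) \<le> \<bar>s - t\<bar> * (measure (nrm n \<mu>) UNIV + real (card C) / real n)"
      using ev by (rule eventually_mono) (rule lip[OF C])
    show "\<forall>\<^sub>F s in at t within S. 0 \<le> dBL (?x s) (z C t)"
      by (intro always_eventually allI dBL_nonneg nprof_fmeas mu zf C)
    have "((\<lambda>s. \<bar>s - t\<bar> * (measure (nrm n \<mu>) UNIV + real (card C) / real n)) \<longlongrightarrow> \<bar>t - t\<bar> * (measure (nrm n \<mu>) UNIV + real (card C) / real n)) (at t within S)"
      by (intro tendsto_mult tendsto_rabs tendsto_diff tendsto_const tendsto_ident_at)
    then show "((\<lambda>s. \<bar>s - t\<bar> * (measure (nrm n \<mu>) UNIV + real (card C) / real n)) \<longlongrightarrow> 0) (at t within S)" by simp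
  qed
  show ?thesis unfolding Dspace_def
  proof (intro CollectI conjI allI impI)
    fix t :: real assume t: "0 \<le> t"
    show "?x t \<in> fmeas" by (rule nprof_fmeas[OF mu])
  next
    fix t :: real assume t: "0 \<le> t"
    have "\<forall>\<^sub>F s in at_right t. card {k. ?R k \<le> s} = card {k. ?R k \<le> t}"
      using Q t by (simp add: cadlag_count_def)
    then have "\<forall>\<^sub>F s in at_right t. arrived ?R s = arrived ?R t"
      by (rule eventually_mono) (rule arrived_eq_card)
    then show "((\<lambda>s. dBL (?x s) (?x t)) \<longlongrightarrow> 0) (at_right t)"
      unfolding xz'[symmetric] by (intro lim) simp
  next
    fix t :: real assume t: "0 < t"
    then obtain m where "\<forall>\<^sub>F s in at_left t. card {k. ?R k \<le> s} = m"
      using Q by (auto simp: cadlag_count_def)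
    then obtain b where b: "b < t" "\<And>s. b < s \<Longrightarrow> s < t \<Longrightarrow> card {k. ?R k \<le> s} = m"
      unfolding eventually_at_left_field by blast
    let ?C = "arrived ?R ((b + t) / 2)"
    have mid: "card {k. ?R k \<le> (b + t) / 2} = m" by (rule b(2)) (use b(1) in auto)
    have "\<forall>\<^sub>F s in at_left t. arrived ?R s = ?C" unfolding eventually_at_left_field
      by (intro exI[of _ b] conjI allI impI arrived_eq_card) (use b mid in auto)
    then show "\<exists>\<nu>\<in>fmeas. ((\<lambda>s. dBL (?x s) \<nu>) \<longlongrightarrow> 0) (at_left t)"
      by (intro bexI[of _ "z ?C t"] lim zf) auto
  qed
qed

text \<open>The accumulation time of the arrivals is their lower limit; in terms of it only countably many
  operations are needed, so the event is measurable.\<close>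
lemma cadlag_count_iff:
  defines "\<tau> R \<equiv> liminf (\<lambda>k. ereal (R k))"
  shows "cadlag_count R \<longleftrightarrow> \<tau> R = \<infinity> \<or> \<tau> R < 0 \<or>
    (\<tau> R = 0 \<or> finite {k. ereal (R k) < \<tau> R}) \<and> (infinite {k. ereal (R k) \<le> \<tau> R} \<or> {k. ereal (R k) \<le> \<tau> R} = {})"
    (is "_ \<longleftrightarrow> ?rhs")
proof -
  let ?A = "\<lambda>t. {k. R k \<le> t}"
  have fin: "finite (?A t)" if "ereal t < \<tau> R" for t
  proof -
    have "\<forall>\<^sub>F k in sequentially. ereal t < ereal (R k)" using that unfolding \<tau>_def by (rule less_LiminfD)
    then obtain m where m: "\<And>k. k \<ge> m \<Longrightarrow> t < R k" by (auto simp: eventually_sequentially)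
    have "?A t \<subseteq> {..<m}" using m by (auto simp: not_le[symmetric])
    then show ?thesis by (rule finite_subset) simp
  qed
  have inf: "infinite (?A t)" if "\<tau> R < ereal t" for t
  proof
    assume "finite (?A t)"
    then obtain m where "?A t \<subseteq> {..<m}" by (auto simp: finite_nat_iff_bounded)
    then have "\<forall>k\<ge>m. ereal t \<le> ereal (R k)" by (auto simp: subset_eq not_le[symmetric] intro: less_imp_le) (metis linear not_le)
    then have "ereal t \<le> \<tau> R" unfolding \<tau>_def
      by (intro Liminf_bounded) (auto simp: eventually_sequentially)
    then show False using that by simp
  qed
  have Amono: "?A s \<subseteq> ?A t" if "s \<le> t" for s t using that by auto
  show ?thesis
  proof
    assume Q: "cadlag_count R"
    show ?rhs
    proof (rule ccontr)
      assume neg: "\<not> ?rhs"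
      then obtain t where t: "\<tau> R = ereal t" "t \<ge> 0" by (cases "\<tau> R") (auto simp: not_less)
      \<comment> \<open>A constant count on a left neighbourhood of t forces the nested finite sets
        there to coincide, so every R k below t is already at most v.\<close>
      have fl: "finite {k. R k < t}" if tp: "t > 0"
      proof -
        obtain m where "\<forall>\<^sub>F s in at_left t. card (?A s) = m" using Q tp by (auto simp: cadlag_count_def)
        then obtain b where b: "b < t" "\<And>s. b < s \<Longrightarrow> s < t \<Longrightarrow> card (?A s) = m"
          unfolding eventually_at_left_field by blast
        define v where "v = (b + t) / 2"
        have v: "b < v" "v < t" using b(1) by (auto simp: v_def)
        have "{k. R k < t} \<subseteq> ?A v"
        proof
          fix k assume k: "k \<in> {k. R k < t}"
          let ?s = "max v (R k)"
          have s: "b < ?s" "?s < t" using v k by auto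
          have "?A v = ?A ?s"
            by (rule card_subset_eq[OF fin[of ?s] Amono]) (use b(2)[OF s] b(2)[OF v] s t in auto)
          then show "k \<in> ?A v" by auto
        qed
        then show ?thesis by (rule finite_subset) (use fin[of v] v t in auto)
      qed
      \<comment> \<open>Right after t the set is infinite and has cardinality 0 by default, so
        right-continuity leaves only cardinality 0 at t.\<close>
      have "infinite (?A t) \<or> ?A t = {}"
      proof (rule ccontr)
        assume "\<not> (infinite (?A t) \<or> ?A t = {})"
        then have "card (?A t) > 0" by (simp add: card_gt_0_iff)
        moreover have "\<forall>\<^sub>F s in at_right t. card (?A s) = card (?A t)" using Q t by (simp add: cadlag_count_def)
        then obtain b where b: "t < b" "\<And>s. t < s \<Longrightarrow> s < b \<Longrightarrow> card (?A s) = card (?A t)"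
          unfolding eventually_at_right_field by blast
        have "card (?A ((t + b) / 2)) = card (?A t)" by (rule b(2)) (use b(1) in auto)
        moreover have "infinite (?A ((t + b) / 2))" by (rule inf) (use b(1) t in auto)
        ultimately show False by simp
      qed
      with neg fl t show False by (cases "t = 0") (auto simp: zero_ereal_def)
    qed
  next
    \<comment> \<open>Past \<open>\<tau> R\<close> the sets are infinite and the count is 0 forever;
      before it they are finite and change only at isolated times. The conditions at a finite
      \<open>\<tau> R\<close> glue the two regimes.\<close>
    assume rhs: ?rhs
    have ev_right: "\<forall>\<^sub>F s in at_right t. card (?A s) = card (?A t)" if t: "t \<ge> 0" for t
    proof (cases "ereal t < \<tau> R")
      case True
      obtain u where u: "ereal t < ereal u" "ereal u < \<tau> R" using ereal_dense2[OF True] by auto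
      let ?D = "insert u (R ` (?A u - ?A t))"
      have D: "finite ?D" "\<And>z. z \<in> ?D \<Longrightarrow> t < z" using fin[OF u(2)] u(1) by auto
      have "t < Min ?D" by (subst Min_gr_iff) (use D in auto)
      moreover have "?A s = ?A t" if s: "t < s" "s < Min ?D" for s
      proof
        show "?A t \<subseteq> ?A s" using s by auto
        have "s < u" using s(2) D(1) by simp
        show "?A s \<subseteq> ?A t"
        proof (rule subsetI, rule ccontr)
          fix k assume k: "k \<in> ?A s" "k \<notin> ?A t"
          then have "R k \<in> ?D" using \<open>s < u\<close> by auto
          then have "Min ?D \<le> R k" using D(1) by (intro Min_le)
          then show False using s k by auto
        qed
      qed
      ultimately show ?thesis unfolding eventually_at_right_field by (intro exI[of _ "Min ?D"]) auto
    next
      case False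
      have after: "card (?A s) = 0" if "t < s" for s
        using inf[of s] False that by (meson card.infinite ereal_less_eq(3) less_ereal.simps(1) not_less order_le_less_trans)
      have "card (?A t) = 0"
      proof (cases "\<tau> R = ereal t")
        case True
        then show ?thesis using rhs t by auto
      next
        case neq: False
        then show ?thesis using inf[of t] False by auto
      qed
      then show ?thesis using after by (auto simp: eventually_at_right_field intro: exI[of _ "t + 1"])
    qed
    have ev_left: "\<exists>m. \<forall>\<^sub>F s in at_left t. card (?A s) = m" if t: "t > 0" for t
    proof (cases "\<exists>s<t. infinite (?A s)")
      case True
      then obtain s where s: "s < t" "infinite (?A s)" by blast
      have "card (?A v) = 0" if "s < v" for v
        using s(2) Amono[of s v] that by (meson card.infinite finite_subset less_imp_le)
      then show ?thesis using s(1) unfolding eventually_at_left_field by blast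
    next
      case False
      then have le: "ereal t \<le> \<tau> R"
      proof -
        have "\<not> \<tau> R < ereal t"
        proof
          assume "\<tau> R < ereal t"
          then obtain s where "\<tau> R < ereal s" "ereal s < ereal t" using ereal_dense2 by blast
          then show False using inf[of s] False by auto
        qed
        then show ?thesis by simp
      qed
      let ?B = "{k. R k < t}"
      have finB: "finite ?B"
      proof (cases "\<tau> R = ereal t")
        case True
        then show ?thesis using rhs t by auto
      next
        case False
        then have "finite (?A t)" using le by (intro fin) auto
        then show ?thesis by (rule rev_finite_subset) auto
      qed
      let ?D = "insert (t - 1) (R ` ?B)"
      have D: "finite ?D" using finB by auto
      have "Max ?D < t" by (subst Max_less_iff) (use D in auto)
      moreover have "?A s = ?B" if s: "Max ?D < s" "s < t" for s
      proof
        show "?A s \<subseteq> ?B" using s by auto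
        show "?B \<subseteq> ?A s"
        proof
          fix k assume "k \<in> ?B"
          then have "R k \<le> Max ?D" using D by (intro Max_ge) auto
          then show "k \<in> ?A s" using s by auto
        qed
      qed
      ultimately show ?thesis unfolding eventually_at_left_field
        by (intro exI[of _ "card ?B"] exI[of _ "Max ?D"]) simp
    qed
    show "cadlag_count R" unfolding cadlag_count_def using ev_right ev_left by blast
  qed
qed

lemma cadlag_count_measurable:
  assumes [measurable]: "\<And>k. R k \<in> borel_measurable M"
  shows "{\<omega> \<in> space M. cadlag_count (\<lambda>k. R k \<omega>)} \<in> sets M"
proof -
  define \<tau> where "\<tau> \<omega> = liminf (\<lambda>k. ereal (R k \<omega>))" for \<omega>
  have [measurable]: "\<tau> \<in> borel_measurable M" unfolding \<tau>_def by measurable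
  have eq: "cadlag_count (\<lambda>k. R k \<omega>) \<longleftrightarrow> \<tau> \<omega> = \<infinity> \<or> \<tau> \<omega> < 0 \<or>
    (\<tau> \<omega> = 0 \<or> (\<exists>m. \<forall>k. m \<le> k \<longrightarrow> \<not> ereal (R k \<omega>) < \<tau> \<omega>)) \<and>
    (\<not> (\<exists>m. \<forall>k. m \<le> k \<longrightarrow> \<not> ereal (R k \<omega>) \<le> \<tau> \<omega>) \<or> (\<forall>k. \<not> ereal (R k \<omega>) \<le> \<tau> \<omega>))" for \<omega>
  proof -
    have fin: "finite {k::nat. P k} \<longleftrightarrow> (\<exists>m. \<forall>k. m \<le> k \<longrightarrow> \<not> P k)" for P
      unfolding finite_nat_iff_bounded by (auto simp: subset_eq not_le[symmetric])
    show ?thesis unfolding cadlag_count_iff \<tau>_def fin by simp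
  qed
  show ?thesis unfolding eq by measurable
qed

lemma nprof_Dspace_measurable:
  assumes mu: "\<And>\<omega>. \<omega> \<in> space M \<Longrightarrow> \<mu> \<omega> \<in> fmeas" and n: "n > 0"
    and T [measurable]: "\<And>k. T k \<in> borel_measurable M"
  shows "{\<omega> \<in> space M. nprof n (\<mu> \<omega>) (\<lambda>k. T k \<omega>) (\<sigma> \<omega>) \<in> Dspace} \<in> sets M"
proof -
  have "nprof n (\<mu> \<omega>) (\<lambda>k. T k \<omega>) (\<sigma> \<omega>) \<in> Dspace \<longleftrightarrow> cadlag_count (\<lambda>k. T k \<omega> / real n)" if "\<omega> \<in> space M" for \<omega>
    by (rule iffI[OF nprof_Dspace_imp[OF mu[OF that] n] cadlag_count_imp[OF mu[OF that] n]])
  then have "{\<omega> \<in> space M. nprof n (\<mu> \<omega>) (\<lambda>k. T k \<omega>) (\<sigma> \<omega>) \<in> Dspace} = {\<omega> \<in> space M. cadlag_count (\<lambda>k. T k \<omega> / real n)}"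
    by auto
  also have "\<dots> \<in> sets M" by (rule cadlag_count_measurable) simp
  finally show ?thesis .
qed

section \<open>Convergence in probability and moment bounds\<close>

text \<open>Convergence to zero in outer probability, which is stable under domination
  without measurability side conditions.\<close>
definition conv0_prob :: "(nat \<Rightarrow> 'a measure) \<Rightarrow> (nat \<Rightarrow> 'a \<Rightarrow> real) \<Rightarrow> bool" where
  "conv0_prob M Z \<longleftrightarrow> (\<forall>\<delta>>0. \<forall>\<epsilon>>0. \<forall>\<^sub>F n in sequentially.
     \<exists>A\<in>sets (M n). measure (M n) A \<le> \<epsilon> \<and> (\<forall>\<omega>\<in>space (M n) - A. \<bar>Z n \<omega>\<bar> \<le> \<delta>))"

lemma conv0_probD: "conv0_prob M Z \<Longrightarrow> \<delta> > 0 \<Longrightarrow> \<epsilon> > 0 \<Longrightarrow> \<forall>\<^sub>F n in sequentially.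
     \<exists>A\<in>sets (M n). measure (M n) A \<le> \<epsilon> \<and> (\<forall>\<omega>\<in>space (M n) - A. \<bar>Z n \<omega>\<bar> \<le> \<delta>)"
  by (simp add: conv0_prob_def)

lemma conv0_prob_finite:
  assumes pm: "\<forall>\<^sub>F n in sequentially. prob_space (M n)" and "finite I" "\<And>i. i \<in> I \<Longrightarrow> conv0_prob M (Z i)"
    and "\<delta> > 0" "\<epsilon> > 0"
  shows "\<forall>\<^sub>F n in sequentially. \<exists>A\<in>sets (M n). measure (M n) A \<le> \<epsilon> \<and> (\<forall>\<omega>\<in>space (M n) - A. \<forall>i\<in>I. \<bar>Z i n \<omega>\<bar> \<le> \<delta>)"
  using assms(2,3,5)
proof (induction I arbitrary: \<epsilon> rule: finite_induct)
  case empty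
  then show ?case by (intro always_eventually allI bexI[of _ "{}"]) auto
next
  case (insert i I)
  have "\<forall>\<^sub>F n in sequentially. \<exists>A\<in>sets (M n). measure (M n) A \<le> \<epsilon> / 2 \<and> (\<forall>\<omega>\<in>space (M n) - A. \<bar>Z i n \<omega>\<bar> \<le> \<delta>)"
    using insert assms(4) by (intro conv0_probD) auto
  moreover have "\<forall>\<^sub>F n in sequentially. \<exists>A\<in>sets (M n). measure (M n) A \<le> \<epsilon> / 2 \<and> (\<forall>\<omega>\<in>space (M n) - A. \<forall>i\<in>I. \<bar>Z i n \<omega>\<bar> \<le> \<delta>)"
    using insert by (intro insert.IH) auto
  ultimately show ?case using pm
  proof eventually_elim
    case (elim n)
    then obtain A B where A: "A \<in> sets (M n)" "measure (M n) A \<le> \<epsilon> / 2" "\<forall>\<omega>\<in>space (M n) - A. \<bar>Z i n \<omega>\<bar> \<le> \<delta>"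
      and B: "B \<in> sets (M n)" "measure (M n) B \<le> \<epsilon> / 2" "\<forall>\<omega>\<in>space (M n) - B. \<forall>i\<in>I. \<bar>Z i n \<omega>\<bar> \<le> \<delta>"
      by blast
    interpret prob_space "M n" by (rule elim(3))
    have "measure (M n) (A \<union> B) \<le> \<epsilon>" using measure_Un_le[OF A(1) B(1)] A(2) B(2) by simp
    then show ?case using A B by (intro bexI[of _ "A \<union> B"]) auto
  qed
qed

lemma conv0_prob_add:
  assumes pm: "\<forall>\<^sub>F n in sequentially. prob_space (M n)" and "conv0_prob M X" "conv0_prob M Y"
  shows "conv0_prob M (\<lambda>n \<omega>. X n \<omega> + Y n \<omega>)"
  unfolding conv0_prob_def
proof (intro allI impI)
  fix d e :: real assume "d > 0" "e > 0"
  have "\<forall>\<^sub>F n in sequentially. \<exists>A\<in>sets (M n). measure (M n) A \<le> e \<and>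
     (\<forall>\<omega>\<in>space (M n) - A. \<forall>i\<in>{True, False}. \<bar>(if i then X else Y) n \<omega>\<bar> \<le> d / 2)"
    using conv0_prob_finite[OF pm, of "{True, False}" "\<lambda>i. if i then X else Y" "d / 2" e] assms \<open>d > 0\<close> \<open>e > 0\<close> by auto
  then show "\<forall>\<^sub>F n in sequentially. \<exists>A\<in>sets (M n). measure (M n) A \<le> e \<and> (\<forall>\<omega>\<in>space (M n) - A. \<bar>X n \<omega> + Y n \<omega>\<bar> \<le> d)"
  proof eventually_elim
    case (elim n)
    then obtain A where A: "A \<in> sets (M n)" "measure (M n) A \<le> e"
      "\<And>\<omega>. \<omega> \<in> space (M n) - A \<Longrightarrow> \<bar>X n \<omega>\<bar> \<le> d / 2 \<and> \<bar>Y n \<omega>\<bar> \<le> d / 2" by auto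
    have "\<bar>X n \<omega> + Y n \<omega>\<bar> \<le> d" if "\<omega> \<in> space (M n) - A" for \<omega> using A(3)[OF that] by linarith
    with A show ?case by blast
  qed
qed

lemma conv0_prob_mult:
  assumes "conv0_prob M X" shows "conv0_prob M (\<lambda>n \<omega>. c * X n \<omega>)"
  unfolding conv0_prob_def
proof (intro allI impI)
  fix d e :: real assume "d > 0" "e > 0"
  define d' where "d' = d / (\<bar>c\<bar> + 1)"
  have d': "d' > 0" "\<bar>c\<bar> * d' \<le> d" using \<open>d > 0\<close> by (auto simp: d'_def field_simps)
  from conv0_probD[OF assms d'(1) \<open>e > 0\<close>]
  show "\<forall>\<^sub>F n in sequentially. \<exists>A\<in>sets (M n). measure (M n) A \<le> e \<and> (\<forall>\<omega>\<in>space (M n) - A. \<bar>c * X n \<omega>\<bar> \<le> d)"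
  proof eventually_elim
    case (elim n)
    then obtain A where A: "A \<in> sets (M n)" "measure (M n) A \<le> e" "\<And>\<omega>. \<omega> \<in> space (M n) - A \<Longrightarrow> \<bar>X n \<omega>\<bar> \<le> d'" by blast
    have "\<bar>c * X n \<omega>\<bar> \<le> d" if "\<omega> \<in> space (M n) - A" for \<omega>
      using mult_left_mono[OF A(3)[OF that], of "\<bar>c\<bar>"] d'(2) by (simp add: abs_mult)
    with A show ?case by blast
  qed
qed

lemma conv0_prob_const:
  assumes "a \<longlonglongrightarrow> 0" shows "conv0_prob M (\<lambda>n \<omega>. a n)"
  unfolding conv0_prob_def
proof (intro allI impI)
  fix d e :: real assume "d > 0" "e > 0"
  have "\<forall>\<^sub>F n in sequentially. \<bar>a n\<bar> < d" using tendstoD[OF assms \<open>d > 0\<close>] by simp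
  then show "\<forall>\<^sub>F n in sequentially. \<exists>A\<in>sets (M n). measure (M n) A \<le> e \<and> (\<forall>\<omega>\<in>space (M n) - A. \<bar>a n\<bar> \<le> d)"
    by eventually_elim (use \<open>e > 0\<close> in \<open>auto intro!: bexI[of _ "{}"]\<close>)
qed

text \<open>Disposes of an error \<eta> that does not shrink with n: Y may depend on \<eta>, which
  is fixed before n tends to infinity.\<close>

lemma conv0_prob_approx:
  assumes "\<And>\<eta>. \<eta> > 0 \<Longrightarrow> \<exists>Y. conv0_prob M Y \<and> (\<forall>\<^sub>F n in sequentially. \<forall>\<omega>\<in>space (M n). \<bar>Z n \<omega>\<bar> \<le> \<bar>Y n \<omega>\<bar> + \<eta>)"
  shows "conv0_prob M Z"
  unfolding conv0_prob_def
proof (intro allI impI)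
  fix d e :: real assume "d > 0" "e > 0"
  then obtain Y where Y: "conv0_prob M Y" "\<forall>\<^sub>F n in sequentially. \<forall>\<omega>\<in>space (M n). \<bar>Z n \<omega>\<bar> \<le> \<bar>Y n \<omega>\<bar> + d / 2"
    using assms[of "d / 2"] by auto
  from conv0_probD[OF Y(1), of "d / 2" e] \<open>d > 0\<close> \<open>e > 0\<close>
  have "\<forall>\<^sub>F n in sequentially. \<exists>A\<in>sets (M n). measure (M n) A \<le> e \<and> (\<forall>\<omega>\<in>space (M n) - A. \<bar>Y n \<omega>\<bar> \<le> d / 2)" by simp
  then show "\<forall>\<^sub>F n in sequentially. \<exists>A\<in>sets (M n). measure (M n) A \<le> e \<and> (\<forall>\<omega>\<in>space (M n) - A. \<bar>Z n \<omega>\<bar> \<le> d)"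
    using Y(2)
  proof eventually_elim
    case (elim n)
    then obtain A where A: "A \<in> sets (M n)" "measure (M n) A \<le> e" "\<And>\<omega>. \<omega> \<in> space (M n) - A \<Longrightarrow> \<bar>Y n \<omega>\<bar> \<le> d / 2" by blast
    have "\<bar>Z n \<omega>\<bar> \<le> d" if "\<omega> \<in> space (M n) - A" for \<omega>
      using A(3)[OF that] elim(2) that by force
    with A show ?case by blast
  qed
qed

text \<open>Z is dominated only where X is at most c, and the complement becomes unlikely. In this
  way X encodes a bad event on which the estimate for Z may fail.\<close>

lemma conv0_prob_cond:
  assumes pm: "\<forall>\<^sub>F n in sequentially. prob_space (M n)" and X: "conv0_prob M X" and Y: "conv0_prob M Y" and c: "c > 0"
    and dom: "\<forall>\<^sub>F n in sequentially. \<forall>\<omega>\<in>space (M n). \<bar>X n \<omega>\<bar> \<le> c \<longrightarrow> \<bar>Z n \<omega>\<bar> \<le> \<bar>Y n \<omega>\<bar>"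
  shows "conv0_prob M Z"
  unfolding conv0_prob_def
proof (intro allI impI)
  fix d e :: real assume d: "d > 0" and e: "e > 0"
  have "\<forall>\<^sub>F n in sequentially. \<exists>A\<in>sets (M n). measure (M n) A \<le> e / 2 \<and> (\<forall>\<omega>\<in>space (M n) - A. \<bar>X n \<omega>\<bar> \<le> c)"
    using conv0_probD[OF X c, of "e / 2"] e by simp
  moreover have "\<forall>\<^sub>F n in sequentially. \<exists>A\<in>sets (M n). measure (M n) A \<le> e / 2 \<and> (\<forall>\<omega>\<in>space (M n) - A. \<bar>Y n \<omega>\<bar> \<le> d)"
    using conv0_probD[OF Y d, of "e / 2"] e by simp
  ultimately show "\<forall>\<^sub>F n in sequentially. \<exists>A\<in>sets (M n). measure (M n) A \<le> e \<and> (\<forall>\<omega>\<in>space (M n) - A. \<bar>Z n \<omega>\<bar> \<le> d)"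
    using pm dom
  proof eventually_elim
    case (elim n)
    then obtain A B where A: "A \<in> sets (M n)" "measure (M n) A \<le> e / 2" "\<forall>\<omega>\<in>space (M n) - A. \<bar>X n \<omega>\<bar> \<le> c"
      and B: "B \<in> sets (M n)" "measure (M n) B \<le> e / 2" "\<forall>\<omega>\<in>space (M n) - B. \<bar>Y n \<omega>\<bar> \<le> d"
      by blast
    interpret prob_space "M n" by (rule elim(3))
    have "measure (M n) (A \<union> B) \<le> e" using measure_Un_le[OF A(1) B(1)] A(2) B(2) by simp
    moreover have "\<bar>Z n \<omega>\<bar> \<le> d" if "\<omega> \<in> space (M n) - (A \<union> B)" for \<omega>
      using elim(4) A(3) B(3) that by (meson DiffD1 DiffD2 DiffI UnI1 UnI2 order_trans)
    ultimately show ?case using A(1) B(1) by (intro bexI[of _ "A \<union> B"]) auto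
  qed
qed

lemma conv0_prob_L1:
  assumes pm: "\<forall>\<^sub>F n in sequentially. prob_space (M n)"
    and int: "\<forall>\<^sub>F n in sequentially. integrable (M n) (Z n) \<and> (\<integral>\<omega>. \<bar>Z n \<omega>\<bar> \<partial>M n) \<le> b n"
    and b: "b \<longlonglongrightarrow> 0"
  shows "conv0_prob M Z"
  unfolding conv0_prob_def
proof (intro allI impI)
  fix d e :: real assume d: "d > 0" and e: "e > 0"
  have "\<forall>\<^sub>F n in sequentially. b n < d * e" by (rule order_tendstoD(2)[OF b]) (use d e in simp)
  then show "\<forall>\<^sub>F n in sequentially. \<exists>A\<in>sets (M n). measure (M n) A \<le> e \<and> (\<forall>\<omega>\<in>space (M n) - A. \<bar>Z n \<omega>\<bar> \<le> d)"
    using int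
  proof eventually_elim
    case (elim n)
    then have i: "integrable (M n) (\<lambda>\<omega>. \<bar>Z n \<omega>\<bar>)" by simp
    let ?A = "{\<omega>\<in>space (M n). \<bar>Z n \<omega>\<bar> \<ge> d}"
    have [measurable]: "Z n \<in> borel_measurable (M n)" using elim by auto
    have "measure (M n) ?A \<le> (\<integral>\<omega>. \<bar>Z n \<omega>\<bar> \<partial>M n) / d"
      by (rule integral_Markov_inequality_measure[OF i sets.top]) (use d in auto)
    also have "\<dots> \<le> e" using elim d by (simp add: field_simps)
    finally show ?case by (intro bexI[of _ ?A]) auto
  qed
qed

lemma conv0_prob_sqrt:
  assumes "conv0_prob M (\<lambda>n \<omega>. (Z n \<omega>)\<^sup>2)" shows "conv0_prob M Z"
  unfolding conv0_prob_def
proof (intro allI impI)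
  fix d e :: real assume d: "d > 0" and e: "e > 0"
  have "\<bar>z\<bar> \<le> d" if "\<bar>z\<^sup>2\<bar> \<le> d\<^sup>2" for z
    using that d by (simp add: power2_le_iff_abs_le)
  then show "\<forall>\<^sub>F n in sequentially. \<exists>A\<in>sets (M n). measure (M n) A \<le> e \<and> (\<forall>\<omega>\<in>space (M n) - A. \<bar>Z n \<omega>\<bar> \<le> d)"
    using conv0_probD[OF assms, of "d\<^sup>2" e] d e by (auto elim!: eventually_mono)
qed

text \<open>\<open>arr e k\<close> sums k + 1 interarrival times, whence the Erlang shape k and the
  mean (k + 1)/l. The joint independence of interarrival and service times is restricted to the left
  summand of the index type.\<close>

lemma (in prob_space) arr_moments:
  assumes l: "l > 0" and E: "\<And>k. distributed M lborel (E k) (exponential_density l)"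
    and ind: "indep_vars (\<lambda>_. borel) (\<lambda>i. case i of Inl k \<Rightarrow> E k | Inr k \<Rightarrow> \<sigma> k) UNIV"
  shows "integrable M (\<lambda>\<omega>. arr (\<lambda>k. E k \<omega>) k)"
    and "integrable M (\<lambda>\<omega>. (arr (\<lambda>k. E k \<omega>) k - (real k + 1) / l)\<^sup>2)"
    and "expectation (\<lambda>\<omega>. (arr (\<lambda>k. E k \<omega>) k - (real k + 1) / l)\<^sup>2) = (real k + 1) / l\<^sup>2"
proof -
  let ?I = "Inl ` {..k} :: (nat + 'b) set"
  let ?T = "\<lambda>\<omega>. arr (\<lambda>k. E k \<omega>) k"
  have "distributed M lborel (\<lambda>\<omega>. \<Sum>i\<in>?I. (case i of Inl k \<Rightarrow> E k | Inr k \<Rightarrow> \<sigma> k) \<omega>) (erlang_density (card ?I - 1) l)"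
    by (rule exponential_distributed_sum[OF _ _ l]) (auto intro: E indep_vars_subset[OF ind])
  moreover have "card ?I - 1 = k" by (subst card_image) auto
  moreover have "(\<Sum>i\<in>?I. (case i of Inl k \<Rightarrow> E k | Inr k \<Rightarrow> \<sigma> k) \<omega>) = ?T \<omega>" for \<omega>
    by (subst sum.reindex) (auto simp: arr_def)
  ultimately have D: "distributed M lborel ?T (erlang_density k l)" by simp
  have mean: "expectation ?T = (real k + 1) / l"
    using erlang_ith_moment[OF l D, of 1] l by simp
  show i1: "integrable M ?T" using erlang_ith_moment_integrable[OF l D, of 1] by simp
  have i2: "integrable M (\<lambda>\<omega>. (?T \<omega>)\<^sup>2)" using erlang_ith_moment_integrable[OF l D, of 2] .
  have "integrable M (\<lambda>\<omega>. (?T \<omega>)\<^sup>2 - 2 * ((real k + 1) / l) * ?T \<omega> + ((real k + 1) / l)\<^sup>2)"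
    using i1 i2 by (intro Bochner_Integration.integrable_add Bochner_Integration.integrable_diff integrable_mult_right integrable_const)
  then show "integrable M (\<lambda>\<omega>. (?T \<omega> - (real k + 1) / l)\<^sup>2)" by (simp add: power2_diff algebra_simps)
  show "expectation (\<lambda>\<omega>. (?T \<omega> - (real k + 1) / l)\<^sup>2) = (real k + 1) / l\<^sup>2"
    using erlang_distributed_variance[OF l D] unfolding mean by simp
qed

text \<open>Second moments control the first one through |x| <= c + x^2/c, with c the standard
  deviation at index N, so the bound is uniform over k <= N. The other terms are the bias from
  replacing the rate l by \<open>l0\<close> and the mean (k + 1)/l by one proportional to k.\<close>

lemma (in prob_space) arr_L1:
  assumes l: "l > 0" and E: "\<And>k. distributed M lborel (E k) (exponential_density l)"
    and ind: "indep_vars (\<lambda>_. borel) (\<lambda>i. case i of Inl k \<Rightarrow> E k | Inr k \<Rightarrow> \<sigma> k) UNIV"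
    and k: "k \<le> N" and n: "n > 0" and l0: "l0 > 0"
  shows "integrable M (\<lambda>\<omega>. \<bar>arr (\<lambda>k. E k \<omega>) k / n - real k / (n * l0)\<bar>)"
    and "expectation (\<lambda>\<omega>. \<bar>arr (\<lambda>k. E k \<omega>) k / n - real k / (n * l0)\<bar>)
       \<le> (2 * sqrt (real N + 1) / l + real N * \<bar>1 / l - 1 / l0\<bar> + 1 / l) / n"
proof -
  let ?T = "\<lambda>\<omega>. arr (\<lambda>k. E k \<omega>) k"
  let ?m = "(real k + 1) / l"
  note mom = arr_moments[OF l E ind, of k]
  show int: "integrable M (\<lambda>\<omega>. \<bar>?T \<omega> / n - real k / (n * l0)\<bar>)"
    using mom(1) by (intro integrable_abs Bochner_Integration.integrable_diff integrable_divide integrable_const)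
  define c where "c = sqrt (real N + 1) / l"
  have c: "c > 0" using l by (simp add: c_def)
  have c2: "c\<^sup>2 = (real N + 1) / l\<^sup>2" using l by (simp add: c_def power_divide)
  define r where "r = real N * \<bar>1 / l - 1 / l0\<bar> + 1 / l"
  have pt: "\<bar>?T \<omega> / n - real k / (n * l0)\<bar> \<le> ((c + (?T \<omega> - ?m)\<^sup>2 / c) + r) / n" for \<omega>
  proof -
    define x where "x = \<bar>?T \<omega> - ?m\<bar>"
    have "2 * x * c \<le> c\<^sup>2 + x\<^sup>2" using sum_squares_bound[of x c] by (simp add: power2_eq_square algebra_simps)
    moreover have "0 \<le> x * c" using c by (simp add: x_def)
    ultimately have "x * c \<le> c\<^sup>2 + x\<^sup>2" by linarith
    then have "x \<le> (c\<^sup>2 + x\<^sup>2) / c" using c by (simp add: field_simps)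
    also have "\<dots> = c + (?T \<omega> - ?m)\<^sup>2 / c" using c by (simp add: x_def add_divide_distrib power2_eq_square)
    finally have 1: "\<bar>?T \<omega> - ?m\<bar> \<le> c + (?T \<omega> - ?m)\<^sup>2 / c" by (simp add: x_def)
    have "?m - real k / l0 = real k * (1 / l - 1 / l0) + 1 / l" by (simp add: algebra_simps add_divide_distrib)
    also have "\<bar>\<dots>\<bar> \<le> real k * \<bar>1 / l - 1 / l0\<bar> + 1 / l"
      using l abs_triangle_ineq[of "real k * (1 / l - 1 / l0)" "1 / l"] by (simp add: abs_mult)
    also have "\<dots> \<le> r" unfolding r_def using k by (intro add_right_mono mult_right_mono) auto
    finally have 2: "\<bar>?m - real k / l0\<bar> \<le> r" .
    have "\<bar>?T \<omega> - real k / l0\<bar> \<le> (c + (?T \<omega> - ?m)\<^sup>2 / c) + r" using 1 2 by linarith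
    then have "\<bar>?T \<omega> - real k / l0\<bar> / n \<le> ((c + (?T \<omega> - ?m)\<^sup>2 / c) + r) / n" using n by (intro divide_right_mono) auto
    moreover have "?T \<omega> / n - real k / (n * l0) = (?T \<omega> - real k / l0) / n" using n l0 by (simp add: field_simps)
    ultimately show ?thesis using n by simp
  qed
  have int2: "integrable M (\<lambda>\<omega>. ((c + (?T \<omega> - ?m)\<^sup>2 / c) + r) / n)"
    using mom(2) by (intro integrable_divide Bochner_Integration.integrable_add integrable_const)
  have "expectation (\<lambda>\<omega>. \<bar>?T \<omega> / n - real k / (n * l0)\<bar>) \<le> expectation (\<lambda>\<omega>. ((c + (?T \<omega> - ?m)\<^sup>2 / c) + r) / n)"
    by (rule integral_mono[OF int int2 pt])
  also have "\<dots> = ((c + ((real k + 1) / l\<^sup>2) / c) + r) / n"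
    using mom(2,3) by (simp add: prob_space)
  also have "\<dots> \<le> ((c + c) + r) / n"
  proof -
    have "(real k + 1) / l\<^sup>2 \<le> c\<^sup>2" unfolding c2 using k by (intro divide_right_mono) auto
    then have "((real k + 1) / l\<^sup>2) / c \<le> c\<^sup>2 / c" using c by (intro divide_right_mono) auto
    also have "\<dots> = c" using c by (simp add: power2_eq_square)
    finally show ?thesis using n by (intro divide_right_mono) auto
  qed
  finally show "expectation (\<lambda>\<omega>. \<bar>?T \<omega> / n - real k / (n * l0)\<bar>)
     \<le> (2 * sqrt (real N + 1) / l + real N * \<bar>1 / l - 1 / l0\<bar> + 1 / l) / n"
    by (simp add: c_def r_def algebra_simps)
qed

lemma (in prob_space) exponential_AE_pos:
  assumes "l > 0" "distributed M lborel X (exponential_density l)"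
  shows "AE \<omega> in M. X \<omega> > 0"
proof -
  have [measurable]: "X \<in> borel_measurable M" using distributed_measurable[OF assms(2)] by simp
  have "prob {\<omega>\<in>space M. 0 < X \<omega>} = 1"
    using exponential_distributedD_gt[OF assms(2) _ assms(1), of 0] by simp
  then show ?thesis by (subst prob_Collect_eq_1[symmetric]) auto
qed

text \<open>Cross terms of the centred variables vanish by independence, and each single variance is
  at most 1.\<close>

lemma (in prob_space) variance_sum_le:
  fixes Y :: "'i \<Rightarrow> 'a \<Rightarrow> real"
  assumes fin: "finite I" and ind: "indep_vars (\<lambda>_. borel) Y I" and bd: "\<And>i \<omega>. i \<in> I \<Longrightarrow> \<bar>Y i \<omega>\<bar> \<le> 1"
  shows "integrable M (\<lambda>\<omega>. ((\<Sum>i\<in>I. Y i \<omega>) - (\<Sum>i\<in>I. expectation (Y i)))\<^sup>2)"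
    and "expectation (\<lambda>\<omega>. ((\<Sum>i\<in>I. Y i \<omega>) - (\<Sum>i\<in>I. expectation (Y i)))\<^sup>2) \<le> real (card I)"
proof -
  define Z where "Z i \<omega> = Y i \<omega> - expectation (Y i)" for i \<omega>
  have Ym [measurable]: "Y i \<in> borel_measurable M" if "i \<in> I" for i using ind that by (auto simp: indep_vars_def)
  have Yi: "integrable M (Y i)" if "i \<in> I" for i
    using bd that by (intro integrable_const_bound[where B=1]) auto
  have EY: "\<bar>expectation (Y i)\<bar> \<le> 1" if "i \<in> I" for i
  proof -
    have "expectation (\<lambda>\<omega>. \<bar>Y i \<omega>\<bar>) \<le> expectation (\<lambda>_. 1)"
      by (rule integral_mono[OF integrable_abs[OF Yi[OF that]] integrable_const bd[OF that]])
    then show ?thesis using order_trans[OF integral_abs_bound[of M "Y i"]] by (simp add: prob_space)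
  qed
  have Zb: "\<bar>Z i \<omega>\<bar> \<le> 2" if "i \<in> I" for i \<omega> using bd[OF that, of \<omega>] EY[OF that] unfolding Z_def by linarith
  have Zi: "integrable M (Z i)" if "i \<in> I" for i unfolding Z_def using Yi[OF that] by simp
  have EZ: "expectation (Z i) = 0" if "i \<in> I" for i unfolding Z_def using Yi[OF that] by (simp add: prob_space)
  have ZZi: "integrable M (\<lambda>\<omega>. Z i \<omega> * Z j \<omega>)" if "i \<in> I" "j \<in> I" for i j
  proof (rule integrable_const_bound[where B="2 * 2"])
    show "AE \<omega> in M. norm (Z i \<omega> * Z j \<omega>) \<le> 2 * 2"
    proof (rule AE_I2)
      fix \<omega>
      have "\<bar>Z i \<omega>\<bar> * \<bar>Z j \<omega>\<bar> \<le> 2 * 2" by (intro mult_mono Zb that) auto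
      then show "norm (Z i \<omega> * Z j \<omega>) \<le> 2 * 2" by (simp add: abs_mult)
    qed
    show "(\<lambda>\<omega>. Z i \<omega> * Z j \<omega>) \<in> borel_measurable M" using Zi that by (intro borel_measurable_times) auto
  qed
  have cross: "expectation (\<lambda>\<omega>. Z i \<omega> * Z j \<omega>) = 0" if ij: "i \<in> I" "j \<in> I" "i \<noteq> j" for i j
  proof -
    have "indep_vars (\<lambda>_. borel) (\<lambda>i \<omega>. Y i \<omega> - expectation (Y i)) I"
      by (rule indep_vars_compose2[OF ind, where Y="\<lambda>i x. x - expectation (Y i)"]) auto
    then have "indep_vars (\<lambda>_. borel) Z {i, j}"
      unfolding Z_def by (rule indep_vars_subset) (use ij in auto)
    then have "expectation (\<lambda>\<omega>. \<Prod>k\<in>{i, j}. Z k \<omega>) = (\<Prod>k\<in>{i, j}. expectation (Z k))"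
      by (intro indep_vars_lebesgue_integral) (use Zi ij in auto)
    then show ?thesis using ij EZ by simp
  qed
  have diag: "expectation (\<lambda>\<omega>. Z i \<omega> * Z i \<omega>) \<le> 1" if i: "i \<in> I" for i
  proof -
    have Y2: "integrable M (\<lambda>\<omega>. (Y i \<omega>)\<^sup>2)"
      using bd i by (intro integrable_const_bound[where B=1]) (auto simp: abs_square_le_1)
    have "expectation (\<lambda>\<omega>. Z i \<omega> * Z i \<omega>) = variance (Y i)" by (simp add: Z_def power2_eq_square)
    also have "\<dots> = expectation (\<lambda>\<omega>. (Y i \<omega>)\<^sup>2) - (expectation (Y i))\<^sup>2" by (rule variance_eq[OF Yi[OF i] Y2])
    also have "\<dots> \<le> expectation (\<lambda>\<omega>. (Y i \<omega>)\<^sup>2)" by simp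
    also have "\<dots> \<le> expectation (\<lambda>\<omega>. 1)" by (rule integral_mono[OF Y2]) (use bd i in \<open>auto simp: abs_square_le_1\<close>)
    finally show ?thesis by (simp add: prob_space)
  qed
  have sq: "((\<Sum>i\<in>I. Y i \<omega>) - (\<Sum>i\<in>I. expectation (Y i)))\<^sup>2 = (\<Sum>i\<in>I. \<Sum>j\<in>I. Z i \<omega> * Z j \<omega>)" for \<omega>
    by (simp add: Z_def sum_subtractf[symmetric] power2_eq_square sum_product)
  show "integrable M (\<lambda>\<omega>. ((\<Sum>i\<in>I. Y i \<omega>) - (\<Sum>i\<in>I. expectation (Y i)))\<^sup>2)"
    unfolding sq by (intro Bochner_Integration.integrable_sum ZZi)
  have "expectation (\<lambda>\<omega>. ((\<Sum>i\<in>I. Y i \<omega>) - (\<Sum>i\<in>I. expectation (Y i)))\<^sup>2) = (\<Sum>i\<in>I. \<Sum>j\<in>I. expectation (\<lambda>\<omega>. Z i \<omega> * Z j \<omega>))"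
    unfolding sq using ZZi by (subst Bochner_Integration.integral_sum; (intro sum.cong refl Bochner_Integration.integral_sum Bochner_Integration.integrable_sum)?)
  also have "\<dots> \<le> (\<Sum>i\<in>I. \<Sum>j\<in>I. if i = j then 1 else 0)"
    by (intro sum_mono) (use cross diag in auto)
  also have "\<dots> = real (card I)" using fin by simp
  finally show "expectation (\<lambda>\<omega>. ((\<Sum>i\<in>I. Y i \<omega>) - (\<Sum>i\<in>I. expectation (Y i)))\<^sup>2) \<le> real (card I)" .
qed

section \<open>Riemann sums with an integrand that varies with n\<close>

lemma riemann_sum_bound:
  fixes g :: "real \<Rightarrow> real"
  assumes L: "L \<ge> 0" "\<And>u v. \<bar>g u - g v\<bar> \<le> L * \<bar>u - v\<bar>" and h: "h > 0"
  shows "\<bar>(\<Sum>k<K. h * g (real k * h)) - integral {0..real K * h} g\<bar> \<le> real K * (L * h\<^sup>2)"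
proof -
  have "L-lipschitz_on UNIV g" by (rule lipschitz_onI) (use L in \<open>auto simp: dist_real_def\<close>)
  then have cont: "continuous_on A g" for A using lipschitz_on_continuous_on continuous_on_subset by blast
  have int: "g integrable_on {a..b}" for a b by (rule integrable_continuous_real[OF cont])
  show ?thesis
  proof (induction K)
    case (Suc K)
    let ?a = "real K * h" and ?b = "real (Suc K) * h"
    have ab: "0 \<le> ?a" "?a \<le> ?b" "?b - ?a = h" using h by (auto simp: algebra_simps)
    have "integral {0..?b} g = integral {0..?a} g + integral {?a..?b} g"
      by (rule Henstock_Kurzweil_Integration.integral_combine[symmetric, OF ab(1,2) int])
    moreover have "\<bar>h * g ?a - integral {?a..?b} g\<bar> \<le> L * h\<^sup>2"
    proof -
      have "integral {?a..?b} (\<lambda>u. g ?a - g u) = h * g ?a - integral {?a..?b} g"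
        using ab by (subst Henstock_Kurzweil_Integration.integral_diff[OF integrable_const_ivl int]) simp
      moreover have "norm (integral {?a..?b} (\<lambda>u. g ?a - g u)) \<le> (L * h) * (?b - ?a)"
      proof (rule integral_bound[OF ab(2)])
        show "continuous_on {?a..?b} (\<lambda>u. g ?a - g u)" by (intro continuous_intros cont)
        fix u assume u: "u \<in> {?a..?b}"
        have "\<bar>g ?a - g u\<bar> \<le> L * \<bar>?a - u\<bar>" by (rule L(2))
        also have "\<dots> \<le> L * h" using u ab(3) L(1) by (intro mult_left_mono) auto
        finally show "norm (g ?a - g u) \<le> L * h" by simp
      qed
      ultimately show ?thesis unfolding ab(3) by (simp add: power2_eq_square mult.assoc)
    qed
    ultimately have "\<bar>(\<Sum>k<Suc K. h * g (real k * h)) - integral {0..?b} g\<bar> \<le> real K * (L * h\<^sup>2) + L * h\<^sup>2"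
      using Suc.IH by simp
    also have "\<dots> = real (Suc K) * (L * h\<^sup>2)" by (simp add: algebra_simps)
    finally show ?case .
  qed simp
qed

text \<open>A Lipschitz constant common to all n makes the Riemann error of order 1/n although the
  integrand changes with n; dominated convergence with the bound 1 then handles the
  integrals.\<close>

lemma riemann_sum_tendsto:
  fixes g :: "nat \<Rightarrow> real \<Rightarrow> real"
  assumes l: "l > 0" and t: "t \<ge> 0" and L: "L \<ge> 0" "\<And>n u v. n > 0 \<Longrightarrow> \<bar>g n u - g n v\<bar> \<le> L * \<bar>u - v\<bar>"
    and bd: "\<And>n u. n > 0 \<Longrightarrow> \<bar>g n u\<bar> \<le> 1"
    and conv: "\<And>u. (\<lambda>n. g n u) \<longlonglongrightarrow> g0 u"
  shows "(\<lambda>n. (\<Sum>k<nat \<lceil>real n * l * t\<rceil>. g n (real k / (real n * l))) / real n) \<longlonglongrightarrow> l * integral {0..t} g0"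
proof -
  have cont: "continuous_on A (g n)" if "n > 0" for A n
  proof -
    have "L-lipschitz_on UNIV (g n)" by (rule lipschitz_onI) (use L that in \<open>auto simp: dist_real_def\<close>)
    then show ?thesis using lipschitz_on_continuous_on continuous_on_subset by blast
  qed
  have int: "g n integrable_on {a..b}" if "n > 0" for a b n by (rule integrable_continuous_real[OF cont[OF that]])
  have lim: "(\<lambda>n. integral {0..t} (g (Suc n))) \<longlonglongrightarrow> integral {0..t} g0"
    by (rule dominated_convergence(2)[where h="\<lambda>_. 1"])
       (use int bd conv in \<open>auto intro: LIMSEQ_Suc\<close>)
  let ?S = "\<lambda>n. (\<Sum>k<nat \<lceil>real n * l * t\<rceil>. g n (real k / (real n * l))) / real n"
  have bound: "\<bar>?S n - l * integral {0..t} (g n)\<bar> \<le> ((l * t + 1) * L / l + 1) / real n" if n: "n > 0" for n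
  proof -
    define h where "h = 1 / (real n * l)"
    have h: "h > 0" using n l by (simp add: h_def)
    \<comment> \<open>Rounding up makes the cells cover [0,t]; they overshoot t by at most one cell
      of length h, whose integral is at most h.\<close>
    define K where "K = nat \<lceil>real n * l * t\<rceil>"
    have "0 \<le> real n * l * t" using l t by simp
    then have K: "real n * l * t \<le> real K" "real K \<le> real n * l * t + 1" unfolding K_def by linarith+
    have nl: "real n * l > 0" using n l by simp
    have Kh: "t \<le> real K * h" "real K * h \<le> t + h"
      using K nl by (auto simp: h_def field_simps)
    have S: "?S n = l * (\<Sum>k<K. h * g n (real k * h))"
      unfolding K_def[symmetric] using l n by (simp add: h_def sum_distrib_left sum_divide_distrib)
    have 1: "\<bar>(\<Sum>k<K. h * g n (real k * h)) - integral {0..real K * h} (g n)\<bar> \<le> real K * (L * h\<^sup>2)"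
      by (rule riemann_sum_bound[OF L(1) L(2)[OF n] h])
    have "integral {0..real K * h} (g n) = integral {0..t} (g n) + integral {t..real K * h} (g n)"
      by (rule Henstock_Kurzweil_Integration.integral_combine[symmetric, OF t Kh(1) int[OF n]])
    moreover have "norm (integral {t..real K * h} (g n)) \<le> 1 * (real K * h - t)"
      by (rule integral_bound[OF Kh(1) cont[OF n]]) (use bd n in auto)
    ultimately have "\<bar>(\<Sum>k<K. h * g n (real k * h)) - integral {0..t} (g n)\<bar> \<le> real K * (L * h\<^sup>2) + h"
    proof -
      have aux: "\<bar>S - J\<bar> \<le> c + h" if "J' = J + D" "\<bar>D\<bar> \<le> 1 * (b - t)" "\<bar>S - J'\<bar> \<le> c" "b \<le> t + h"
        for S J J' D c b :: real using that unfolding abs_le_iff mult_1 by (intro conjI; linarith)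
      assume "integral {0..real K * h} (g n) = integral {0..t} (g n) + integral {t..real K * h} (g n)"
        "norm (integral {t..real K * h} (g n)) \<le> 1 * (real K * h - t)"
      then show ?thesis using 1 Kh(2) unfolding real_norm_def by (rule aux)
    qed
    then have "l * \<bar>(\<Sum>k<K. h * g n (real k * h)) - integral {0..t} (g n)\<bar> \<le> l * (real K * (L * h\<^sup>2) + h)"
      using l by (intro mult_left_mono) auto
    then have "\<bar>?S n - l * integral {0..t} (g n)\<bar> \<le> l * (real K * (L * h\<^sup>2) + h)"
      unfolding S right_diff_distrib[symmetric] abs_mult using l by simp
    also have "\<dots> = (real K / real n) * L / l / real n + 1 / real n"
      using l n by (simp add: h_def field_simps power2_eq_square)
    also have "\<dots> \<le> (l * t + 1) * L / l / real n + 1 / real n"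
    proof -
      have "real K / real n \<le> (real n * l * t + 1) / real n" using K by (intro divide_right_mono) auto
      also have "\<dots> = l * t + 1 / real n" using n by (simp add: field_simps)
      also have "\<dots> \<le> l * t + 1" using n by (simp add: field_simps)
      finally show ?thesis using L l n by (intro add_right_mono divide_right_mono mult_right_mono) auto
    qed
    finally show ?thesis by (simp add: add_divide_distrib)
  qed
  have "(\<lambda>n. ((l * t + 1) * L / l + 1) / real (Suc n)) \<longlonglongrightarrow> 0"
    using LIMSEQ_Suc[OF lim_const_over_n] by simp
  then have "(\<lambda>n. ?S (Suc n) - l * integral {0..t} (g (Suc n))) \<longlonglongrightarrow> 0"
    by (rule Lim_null_comparison[rotated]) (intro always_eventually allI, unfold real_norm_def, rule bound, simp)
  then have "(\<lambda>n. (?S (Suc n) - l * integral {0..t} (g (Suc n))) + l * integral {0..t} (g (Suc n))) \<longlonglongrightarrow> 0 + l * integral {0..t} g0"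
    by (intro tendsto_add tendsto_mult tendsto_const lim)
  then have "(\<lambda>n. ?S (Suc n)) \<longlonglongrightarrow> l * integral {0..t} g0" by simp
  then show ?thesis by (rule LIMSEQ_imp_Suc)
qed

section \<open>Arrival times and the limiting inflow\<close>

text \<open>Turns an almost sure property into a 0/1 variable that can be added to other error
  terms.\<close>

lemma conv0_prob_AE:
  assumes "\<forall>\<^sub>F n in sequentially. AE \<omega> in M n. P n \<omega>"
  shows "conv0_prob M (\<lambda>n \<omega>. if P n \<omega> then 0 else 1)"
  unfolding conv0_prob_def
proof (intro allI impI)
  fix d e :: real assume "d > 0" "e > 0"
  from assms show "\<forall>\<^sub>F n in sequentially. \<exists>A\<in>sets (M n). measure (M n) A \<le> e \<and>
      (\<forall>\<omega>\<in>space (M n) - A. \<bar>if P n \<omega> then 0 else 1\<bar> \<le> d)"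
  proof eventually_elim
    case (elim n)
    then obtain A where A: "{\<omega> \<in> space (M n). \<not> P n \<omega>} \<subseteq> A" "emeasure (M n) A = 0" "A \<in> sets (M n)"
      by (rule AE_E)
    then show ?case using \<open>d > 0\<close> \<open>e > 0\<close> by (intro bexI[of _ A]) (auto simp: measure_def)
  qed
qed

text \<open>C ranges over the naturals so that this is a countable conjunction, which can be
  verified almost surely one condition at a time. Positivity makes the arrival times
  increasing.\<close>

definition good_arr :: "(nat \<Rightarrow> real) \<Rightarrow> bool" where
  "good_arr e \<longleftrightarrow> (\<forall>j. e j > 0) \<and> (\<forall>C::nat. \<exists>k. real C < arr e k)"

lemma good_arr_mono: assumes "good_arr e" "j \<le> k" shows "arr e j \<le> arr e k"
  unfolding arr_def using assms by (intro sum_mono2) (auto simp: good_arr_def less_imp_le)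

lemma good_arr_eventually:
  assumes g: "good_arr e" shows "\<exists>N. \<forall>k\<ge>N. C < arr e k"
proof -
  obtain c :: nat where c: "C \<le> real c" using real_arch_simple by blast
  obtain N where "real c < arr e N" using g by (auto simp: good_arr_def)
  then show ?thesis using good_arr_mono[OF g, of N] c by (intro exI[of _ N]) force
qed

lemma good_arr_finite:
  assumes g: "good_arr e" and n: "n > 0" shows "finite {k. arr e k / real n \<le> t}"
proof -
  obtain N where N: "\<And>k. k \<ge> N \<Longrightarrow> real n * t < arr e k" using good_arr_eventually[OF g] by blast
  have "{k. arr e k / real n \<le> t} \<subseteq> {..<N}"
  proof
    fix k assume "k \<in> {k. arr e k / real n \<le> t}"
    then have "\<not> N \<le> k" using N[of k] n by (auto simp: field_simps)
    then show "k \<in> {..<N}" by simp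
  qed
  then show ?thesis by (rule finite_subset) simp
qed

lemma good_arr_cadlag_count:
  assumes g: "good_arr e" and n: "n > 0" shows "cadlag_count (\<lambda>k. arr e k / real n)"
proof -
  have "(\<lambda>k. ereal (arr e k / real n)) \<longlonglongrightarrow> \<infinity>"
    unfolding tendsto_PInfty
  proof
    fix r :: real
    obtain N where N: "\<And>k. k \<ge> N \<Longrightarrow> real n * r < arr e k" using good_arr_eventually[OF g] by blast
    have "r < arr e k / real n" if "k \<ge> N" for k using N[OF that] n by (simp add: field_simps)
    then show "\<forall>\<^sub>F k in sequentially. ereal r < ereal (arr e k / real n)"
      by (auto simp: eventually_sequentially)
  qed
  then have "liminf (\<lambda>k. ereal (arr e k / real n)) = \<infinity>" by (intro lim_imp_Liminf) auto
  then show ?thesis unfolding cadlag_count_iff by simp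
qed

text \<open>If all arrival times stayed below C, then for every large k the one with index k would
  be at most half its mean, which by Chebyshev has probability at most 4/(k + 1).\<close>

lemma (in prob_space) AE_good_arr:
  assumes l: "l > 0" and E: "\<And>k. distributed M lborel (E k) (exponential_density l)"
    and ind: "indep_vars (\<lambda>_. borel) (\<lambda>i. case i of Inl k \<Rightarrow> E k | Inr k \<Rightarrow> \<sigma> k) UNIV"
  shows "AE \<omega> in M. good_arr (\<lambda>k. E k \<omega>)"
proof -
  have [measurable]: "E k \<in> borel_measurable M" for k using distributed_measurable[OF E] by simp
  let ?T = "\<lambda>k \<omega>. arr (\<lambda>k. E k \<omega>) k"
  have [measurable]: "?T k \<in> borel_measurable M" for k unfolding arr_def by measurable
  have "AE \<omega> in M. \<exists>k. real C < ?T k \<omega>" for C :: nat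
  proof -
    let ?B = "{\<omega>\<in>space M. \<forall>k. ?T k \<omega> \<le> real C}"
    have le: "prob ?B \<le> 4 / (real k + 1)" if k: "2 * real C * l \<le> real k" for k
    proof -
      let ?m = "(real k + 1) / l"
      have m: "?m / 2 > 0" "real C \<le> ?m / 2" using l k by (auto simp: field_simps)
      let ?D = "{\<omega>\<in>space M. (?m / 2)\<^sup>2 \<le> (?T k \<omega> - ?m)\<^sup>2}"
      have "?B \<subseteq> ?D"
      proof clarify
        fix \<omega> assume "\<forall>k. ?T k \<omega> \<le> real C"
        then have "?m / 2 \<le> ?m - ?T k \<omega>" using m by (smt (verit, ccfv_SIG) field_sum_of_halves)
        then have "(?m / 2)\<^sup>2 \<le> (?m - ?T k \<omega>)\<^sup>2" using m by (intro power_mono) auto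
        then show "(?m / 2)\<^sup>2 \<le> (?T k \<omega> - ?m)\<^sup>2" by (simp add: power2_commute)
      qed
      then have "prob ?B \<le> prob ?D" by (intro finite_measure_mono) auto
      also have "\<dots> \<le> expectation (\<lambda>\<omega>. (?T k \<omega> - ?m)\<^sup>2) / (?m / 2)\<^sup>2"
        by (rule integral_Markov_inequality_measure[OF arr_moments(2)[OF l E ind] sets.top]) (use m in auto)
      also have "\<dots> = ((real k + 1) / l\<^sup>2) / (?m / 2)\<^sup>2" by (simp only: arr_moments(3)[OF l E ind])
      also have "\<dots> = 4 / (real k + 1)" using l by (simp add: power2_eq_square divide_simps)
      finally show ?thesis .
    qed
    have "(\<lambda>k. 4 / (real k + 1)) \<longlonglongrightarrow> 0"
      using LIMSEQ_Suc[OF lim_const_over_n[of "4::real"]] by (simp add: add.commute)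
    moreover obtain k0 :: nat where "2 * real C * l \<le> real k0" using real_arch_simple by blast
    then have "\<forall>k\<ge>k0. prob ?B \<le> 4 / (real k + 1)" using le by force
    ultimately have "prob ?B \<le> 0" by (intro LIMSEQ_le_const) auto
    then have "prob ?B = 0" using measure_nonneg[of M ?B] by linarith
    moreover have "?B \<in> events" by measurable
    ultimately have "AE \<omega> in M. \<omega> \<notin> ?B" by (simp only: prob_eq_0)
    with AE_space have "AE \<omega> in M. \<not> (\<forall>k. ?T k \<omega> \<le> real C)" by eventually_elim blast
    then show ?thesis by eventually_elim (auto simp: not_le)
  qed
  moreover have "AE \<omega> in M. E j \<omega> > 0" for j by (rule exponential_AE_pos[OF l E])
  ultimately show ?thesis unfolding good_arr_def by (simp add: AE_all_countable)
qed

lemma card_near_le: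
  assumes h: "h > 0" and eta: "\<eta> > 0"
  shows "real (card {k\<in>{..<N}. \<bar>real k * h - t\<bar> \<le> \<eta>}) \<le> 2 * \<eta> / h + 1"
proof (cases "{k\<in>{..<N}. \<bar>real k * h - t\<bar> \<le> \<eta>} = {}")
  case True
  have "0 \<le> 2 * \<eta> / h + 1" using h eta by simp
  then show ?thesis unfolding True by simp
next
  case False
  let ?S = "{k\<in>{..<N}. \<bar>real k * h - t\<bar> \<le> \<eta>}"
  have S: "finite ?S" by simp
  let ?a = "Min ?S" and ?b = "Max ?S"
  have a: "?a \<in> ?S" "?b \<in> ?S" using Min_in[OF S False] Max_in[OF S False] by auto
  have ab: "?a \<le> ?b" using Min_le[OF S a(2)] .
  have "?S \<subseteq> {?a..?b}" using Min_le[OF S] Max_ge[OF S] by auto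
  then have "card ?S \<le> card {?a..?b}" by (intro card_mono) auto
  then have "real (card ?S) \<le> (real ?b - real ?a) + 1" using ab unfolding card_atLeastAtMost by linarith
  moreover have "real ?b - real ?a \<le> 2 * \<eta> / h"
  proof -
    have "\<bar>real ?a * h - t\<bar> \<le> \<eta>" "\<bar>real ?b * h - t\<bar> \<le> \<eta>" using a by blast+
    then have "(real ?b - real ?a) * h \<le> 2 * \<eta>" unfolding left_diff_distrib by linarith
    then show ?thesis using h by (simp add: field_simps)
  qed
  ultimately show ?thesis by linarith
qed

text \<open>Let R_k = T_k/n and h = 1/(n l). If both sums count index k, or neither does, the
  Lipschitz bound applies. Otherwise t lies between R_k and k h, so |R_k - k h| >= |k h - t|: either
  the latter exceeds \<eta> and the error 1 is absorbed by |R_k - k h|/\<eta>, or k is one of the at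
  most 2 \<eta>/h + 1 indices near t. N bounds all indices counted on either side.\<close>

lemma arrival_meas_compare:
  assumes n: "n > 0" and l: "l > 0" and t: "t \<ge> 0" and f: "\<And>x. \<bar>f x\<bar> \<le> 1" "f \<in> bdd_borel"
    and L: "L \<ge> 0" "\<And>x y. \<bar>f x - f y\<bar> \<le> L * \<bar>x - y\<bar>" and eta: "\<eta> > 0"
    and N: "\<And>k. k \<ge> N \<Longrightarrow> t < T k / real n" "nat \<lceil>real n * l * t\<rceil> \<le> N"
  shows "\<bar>pair (arrival_meas n T \<sigma> t) f - (\<Sum>k<nat \<lceil>real n * l * t\<rceil>. f (real k / (real n * l) + \<sigma> k / real n)) / real n\<bar>
    \<le> (L + 1 / \<eta>) * ((\<Sum>k<N. \<bar>T k / real n - real k / (real n * l)\<bar>) / real n) + (2 * \<eta> * l + 1 / real n)"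
proof -
  define K where "K = nat \<lceil>real n * l * t\<rceil>"
  define h where "h = 1 / (real n * l)"
  have nl: "real n * l > 0" using n l by simp
  have h: "h > 0" using nl by (simp add: h_def)
  define R where "R k = T k / real n" for k
  have sub: "{k. R k \<le> t} \<subseteq> {..<N}"
  proof
    fix k assume "k \<in> {k. R k \<le> t}"
    then have "\<not> N \<le> k" using N(1)[of k] by (auto simp: R_def)
    then show "k \<in> {..<N}" by simp
  qed
  then have arrived: "arrived R t = {k. R k \<le> t}" unfolding arrived_def using finite_subset[OF sub] by simp
  have kK: "k < K \<longleftrightarrow> real k * h < t" for k
  proof -
    have "k < K \<longleftrightarrow> real k < real n * l * t" unfolding K_def by (simp add: zless_nat_eq_int_zless less_ceiling_iff)
    then show ?thesis using nl by (simp add: h_def field_simps)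
  qed
  define a where "a k = f (R k + \<sigma> k / real n)" for k
  define b where "b k = f (real k * h + \<sigma> k / real n)" for k
  have A: "pair (arrival_meas n T \<sigma> t) f = (\<Sum>k<N. if R k \<le> t then a k else 0) / real n"
  proof -
    have "pair (arrival_meas n T \<sigma> t) f = (\<Sum>k\<in>{k. R k \<le> t}. a k) / real n"
      unfolding pair_arrival_meas[OF f(2)] R_def[symmetric] arrived by (simp add: a_def R_def add_divide_distrib)
    also have "(\<Sum>k\<in>{k. R k \<le> t}. a k) = (\<Sum>k<N. if R k \<le> t then a k else 0)"
      by (rule sum.mono_neutral_cong_left) (use sub in auto)
    finally show ?thesis .
  qed
  have B: "(\<Sum>k<K. f (real k / (real n * l) + \<sigma> k / real n)) = (\<Sum>k<N. if k < K then b k else 0)"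
    by (rule sum.mono_neutral_cong_left) (use N(2)[folded K_def] in \<open>auto simp: b_def h_def\<close>)
  have termwise: "\<bar>(if R k \<le> t then a k else 0) - (if k < K then b k else 0)\<bar>
     \<le> (L + 1 / \<eta>) * \<bar>R k - real k * h\<bar> + (if \<bar>real k * h - t\<bar> \<le> \<eta> then 1 else 0)" for k
  proof -
    let ?D = "\<bar>R k - real k * h\<bar>"
    have D: "(L + 1 / \<eta>) * ?D = L * ?D + ?D / \<eta>" by (simp add: algebra_simps)
    have D0: "0 \<le> L * ?D" "0 \<le> ?D / \<eta>" using L(1) eta by auto
    have ab: "\<bar>a k\<bar> \<le> 1" "\<bar>b k\<bar> \<le> 1" by (simp_all add: a_def b_def f)
    have ff: "\<bar>a k - b k\<bar> \<le> L * ?D" unfolding a_def b_def using L(2)[of "R k + \<sigma> k / real n" "real k * h + \<sigma> k / real n"] by simp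
    show ?thesis
    proof (cases "R k \<le> t \<longleftrightarrow> k < K")
      case True
      then show ?thesis using ff D D0 by auto
    next
      case False
      then have 1: "\<bar>(if R k \<le> t then a k else 0) - (if k < K then b k else 0)\<bar> \<le> 1" using ab by auto
      have "\<bar>real k * h - t\<bar> \<le> ?D" using False kK[of k] by auto
      then have "\<eta> < \<bar>real k * h - t\<bar> \<Longrightarrow> 1 \<le> ?D / \<eta>" using eta by (simp add: field_simps)
      then show ?thesis using 1 D D0 by (auto simp: not_le)
    qed
  qed
  have "\<bar>(\<Sum>k<N. if R k \<le> t then a k else 0) - (\<Sum>k<N. if k < K then b k else 0)\<bar>
     \<le> (\<Sum>k<N. (L + 1 / \<eta>) * \<bar>R k - real k * h\<bar> + (if \<bar>real k * h - t\<bar> \<le> \<eta> then 1 else 0))"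
    unfolding sum_subtractf[symmetric] by (rule order_trans[OF sum_abs sum_mono]) (rule termwise)
  also have "\<dots> = (L + 1 / \<eta>) * (\<Sum>k<N. \<bar>R k - real k * h\<bar>) + real (card {k\<in>{..<N}. \<bar>real k * h - t\<bar> \<le> \<eta>})"
    by (simp add: sum.distrib sum_distrib_left sum.If_cases Int_def)
  also have "\<dots> \<le> (L + 1 / \<eta>) * (\<Sum>k<N. \<bar>R k - real k * h\<bar>) + (2 * \<eta> / h + 1)"
    using card_near_le[OF h eta, of N t] by simp
  finally have "\<bar>(\<Sum>k<N. if R k \<le> t then a k else 0) - (\<Sum>k<N. if k < K then b k else 0)\<bar> / real n
    \<le> ((L + 1 / \<eta>) * (\<Sum>k<N. \<bar>R k - real k * h\<bar>) + (2 * \<eta> / h + 1)) / real n"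
    by (rule divide_right_mono) simp
  also have "\<dots> = (L + 1 / \<eta>) * ((\<Sum>k<N. \<bar>R k - real k * h\<bar>) / real n) + (2 * \<eta> * l + 1 / real n)"
    using n l by (simp add: h_def add_divide_distrib)
  finally show ?thesis
    unfolding K_def[symmetric] A B using n
    by (simp add: diff_divide_distrib[symmetric] R_def h_def)
qed

text \<open>The fluid limit of \<open>arrival_meas\<close>: departure times u + y, with arrival
  times u spread over [0,t] at rate l and service times y distributed by
  \<open>\<alpha>\<close>.\<close>

definition inflow :: "real \<Rightarrow> real measure \<Rightarrow> real \<Rightarrow> real measure" where
  "inflow l \<alpha> t = scale_measure (ennreal l) (distr (density lborel (indicator {0..t}) \<Otimes>\<^sub>M \<alpha>) borel (\<lambda>(u, y). u + y))"

lemma inflow_props: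
  assumes a: "prob_space \<alpha>" "sets \<alpha> = sets borel" and l: "l \<ge> 0" and t: "t \<ge> 0"
  shows inflow_fmeas: "inflow l \<alpha> t \<in> fmeas"
    and pair_inflow: "f \<in> bdd_borel \<Longrightarrow> pair (inflow l \<alpha> t) f = l * (LINT u:{0..t}|lborel. pair \<alpha> (\<lambda>y. f (u + y)))"
proof -
  let ?L = "density lborel (indicator {0..t}) :: real measure"
  note [measurable_cong] = a(2)
  interpret A: prob_space \<alpha> by (rule a(1))
  interpret L: finite_measure ?L
    by (rule finite_measureI) (simp add: emeasure_density t)
  interpret P: pair_sigma_finite ?L \<alpha> ..
  have fin: "finite_measure (?L \<Otimes>\<^sub>M \<alpha>)"
  proof (rule finite_measureI)
    have "emeasure (?L \<Otimes>\<^sub>M \<alpha>) (space ?L \<times> space \<alpha>) = emeasure ?L (space ?L) * emeasure \<alpha> (space \<alpha>)"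
      by (rule A.emeasure_pair_measure_Times) auto
    then show "emeasure (?L \<Otimes>\<^sub>M \<alpha>) (space (?L \<Otimes>\<^sub>M \<alpha>)) \<noteq> \<infinity>"
      using L.emeasure_finite by (simp add: space_pair_measure A.emeasure_space_1)
  qed
  have m [measurable]: "(\<lambda>(u, y). u + y) \<in> borel_measurable (?L \<Otimes>\<^sub>M \<alpha>)" by measurable
  have df: "distr (?L \<Otimes>\<^sub>M \<alpha>) borel (\<lambda>(u, y). u + y) \<in> fmeas"
    by (intro fmeasI finite_measure.finite_measure_distr fin m) auto
  then show "inflow l \<alpha> t \<in> fmeas" unfolding inflow_def by (rule scale_fmeas)
  assume f: "f \<in> bdd_borel"
  have [measurable]: "f \<in> borel_measurable borel" using f by (simp add: bdd_borel_def)
  obtain B where B: "\<And>x. \<bar>f x\<bar> \<le> B" using bdd_borel_bound[OF f] by metis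
  have "pair (inflow l \<alpha> t) f = l * pair (distr (?L \<Otimes>\<^sub>M \<alpha>) borel (\<lambda>(u, y). u + y)) f"
    unfolding inflow_def by (rule pair_scale[OF df f l])
  also have "pair (distr (?L \<Otimes>\<^sub>M \<alpha>) borel (\<lambda>(u, y). u + y)) f = (\<integral>p. f (case p of (u, y) \<Rightarrow> u + y) \<partial>(?L \<Otimes>\<^sub>M \<alpha>))"
    unfolding pair_def by (rule integral_distr) measurable
  also have "\<dots> = (\<integral>u. (\<integral>y. f (u + y) \<partial>\<alpha>) \<partial>?L)"
  proof -
    have "integrable (?L \<Otimes>\<^sub>M \<alpha>) (\<lambda>p. f (case p of (u, y) \<Rightarrow> u + y))"
      by (rule finite_measure.integrable_const_bound[OF fin, where B=B]) (use B in auto)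
    from P.integral_fst'[OF this] show ?thesis by simp
  qed
  also have "\<dots> = (\<integral>u. indicator {0..t} u *\<^sub>R (\<integral>y. f (u + y) \<partial>\<alpha>) \<partial>lborel)"
  proof -
    have "?L = density lborel (\<lambda>u. ennreal (indicator {0..t} u))" by (simp add: ennreal_indicator)
    then show ?thesis by (simp only:) (rule integral_density, auto)
  qed
  finally show "pair (inflow l \<alpha> t) f = l * (LINT u:{0..t}|lborel. pair \<alpha> (\<lambda>y. f (u + y)))"
    by (simp add: set_lebesgue_integral_def pair_def)
qed

text \<open>Substituting s = t - u replaces the arrival time by the time elapsed since arrival,
  which is the variable of the integral in the theorem.\<close>

lemma inflow_shift:
  assumes a: "prob_space \<alpha>" "sets \<alpha> = sets borel" and l: "l \<ge> 0" and t: "t \<ge> 0" and f: "f \<in> bdd_borel"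
  shows "pair (inflow l \<alpha> t) (\<lambda>z. f (z - t)) = l * (LBINT s=0..t. pair \<alpha> (\<lambda>y. f (y - s)))"
proof -
  let ?H = "\<lambda>s. pair \<alpha> (\<lambda>y. f (y - s))"
  have "pair (inflow l \<alpha> t) (\<lambda>z. f (z - t)) = l * (LINT u:{0..t}|lborel. pair \<alpha> (\<lambda>y. f (u + y - t)))"
    by (rule pair_inflow[OF a l t bdd_borel_shift[OF f]])
  also have "(LINT u:{0..t}|lborel. pair \<alpha> (\<lambda>y. f (u + y - t))) = (\<integral>u. indicator {0..t} u *\<^sub>R ?H (t - u) \<partial>lborel)"
    unfolding set_lebesgue_integral_def by (simp add: algebra_simps)
  also have "\<dots> = (\<integral>u. indicator {0..t} (t + (-1) * u) *\<^sub>R ?H (t - (t + (-1) * u)) \<partial>lborel)"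
    using lborel_integral_real_affine[of "-1" "\<lambda>u. indicator {0..t} u *\<^sub>R ?H (t - u)" t] by simp
  also have "\<dots> = (LINT s:{0..t}|lborel. ?H s)"
    unfolding set_lebesgue_integral_def
    by (intro Bochner_Integration.integral_cong refl) (auto simp: indicator_def)
  also have "\<dots> = (LBINT s=0..t. ?H s)"
    using interval_integral_Icc[of 0 t ?H] t by (simp add: zero_ereal_def)
  finally show ?thesis .
qed

section \<open>The law of large numbers for the queues\<close>

text \<open>Otherwise some paths would approach m uniformly on growing intervals while F stays e
  away from its value at m; with the identity time change they converge to m in the Skorokhod sense,
  against the continuity of F. In this form a uniform estimate in probability can be fed to
  F.\<close>

lemma skor_cont_locally_uniform:
  assumes F: "skor_cont F" and m: "m \<in> Dspace" and e: "e > 0"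
  shows "\<exists>T>0. \<exists>\<delta>>0. \<forall>y\<in>Dspace. (\<forall>t\<in>{0..T}. dBL (y t) (m t) \<le> \<delta>) \<longrightarrow> \<bar>F y - F m\<bar> \<le> e"
proof (rule ccontr)
  assume neg: "\<not> ?thesis"
  have "\<exists>y\<in>Dspace. (\<forall>t\<in>{0..real (Suc k)}. dBL (y t) (m t) \<le> 1 / real (Suc k)) \<and> e < \<bar>F y - F m\<bar>" for k
  proof -
    have "real (Suc k) > 0" "1 / real (Suc k) > 0" by auto
    with neg have "\<not> (\<forall>y\<in>Dspace. (\<forall>t\<in>{0..real (Suc k)}. dBL (y t) (m t) \<le> 1 / real (Suc k)) \<longrightarrow> \<bar>F y - F m\<bar> \<le> e)" by blast
    then show ?thesis by (simp only: not_le not_all not_imp Bex_def Ball_def)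
  qed
  then obtain y where y: "\<And>k. y k \<in> Dspace"
    "\<And>k t. t \<in> {0..real (Suc k)} \<Longrightarrow> dBL (y k t) (m t) \<le> 1 / real (Suc k)" "\<And>k. e < \<bar>F (y k) - F m\<bar>" by metis
  have "skor_conv y m"
  proof (rule skor_conv_uniform)
    fix T d :: real assume "T > 0" "d > 0"
    have "(\<lambda>k. 1 / real (Suc k)) \<longlonglongrightarrow> 0" by (rule LIMSEQ_Suc[OF lim_1_over_n])
    then have "\<forall>\<^sub>F k in sequentially. 1 / real (Suc k) < d" by (rule order_tendstoD(2)) fact
    moreover obtain k0 :: nat where k0: "T \<le> real k0" using real_arch_simple by blast
    have "\<forall>\<^sub>F k in sequentially. k0 \<le> k" by (rule eventually_ge_at_top)
    ultimately show "\<forall>\<^sub>F k in sequentially. \<forall>t\<in>{0..T}. dBL (y k t) (m t) \<le> d"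
    proof eventually_elim
      case (elim k)
      have "dBL (y k t) (m t) \<le> d" if "t \<in> {0..T}" for t
        using y(2)[of t k] that k0 elim by force
      then show ?case by blast
    qed
  qed
  then have "(\<lambda>k. F (y k)) \<longlonglongrightarrow> F m" using F y(1) m by (simp add: skor_cont_def)
  from tendstoD[OF this e] obtain k where "dist (F (y k)) (F m) < e" by (auto simp: eventually_sequentially)
  then show False using y(3)[of k] by (simp add: dist_real_def)
qed

text \<open>Arrivals and services only: the initial profile enters additively and is treated
  separately. The Poisson stream is given by its exponential interarrival times, and the sum type as
  index set states their joint independence with the service times.\<close>

locale queue_sequence =
  fixes M :: "nat \<Rightarrow> 'a measure" and E \<sigma> :: "nat \<Rightarrow> nat \<Rightarrow> 'a \<Rightarrow> real"
    and lam :: "nat \<Rightarrow> real" and lam_lim :: real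
    and \<alpha> :: "nat \<Rightarrow> real measure" and \<alpha>_lim :: "real measure"
  assumes prob: "\<And>n. n > 0 \<Longrightarrow> prob_space (M n)"
    and lam_pos: "\<And>n. n > 0 \<Longrightarrow> lam n > 0"
    and E_exp: "\<And>n k. n > 0 \<Longrightarrow> distributed (M n) lborel (E n k) (exponential_density (lam n))"
    and sigma_law: "\<And>n k. n > 0 \<Longrightarrow> \<sigma> n k \<in> borel_measurable (M n) \<and> distr (M n) borel (\<sigma> n k) = \<alpha> n"
    and indep: "\<And>n. n > 0 \<Longrightarrow> prob_space.indep_vars (M n) (\<lambda>_. borel)
                   (\<lambda>i. case i of Inl k \<Rightarrow> E n k | Inr k \<Rightarrow> \<sigma> n k) UNIV"
    and alpha_prob: "\<And>n. n > 0 \<Longrightarrow> prob_space (\<alpha> n) \<and> sets (\<alpha> n) = sets borel"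
    and lam_conv: "lam \<longlonglongrightarrow> lam_lim" and lam_lim_pos: "lam_lim > 0"
    and alpha_lim: "prob_space \<alpha>_lim \<and> sets \<alpha>_lim = sets borel"
    and alpha_conv: "wconv (\<lambda>n. distr (\<alpha> n) borel (\<lambda>x. x / real n)) \<alpha>_lim"
begin

section \<open>Convergence of the arrival part, at fixed times and then locally uniformly\<close>

abbreviation T :: "nat \<Rightarrow> 'a \<Rightarrow> nat \<Rightarrow> real" where "T n \<omega> \<equiv> arr (\<lambda>k. E n k \<omega>)"
abbreviation S :: "nat \<Rightarrow> 'a \<Rightarrow> nat \<Rightarrow> real" where "S n \<omega> \<equiv> (\<lambda>k. \<sigma> n k \<omega>)"

lemma ev_pos: "\<forall>\<^sub>F n in sequentially. n > (0::nat)" by (rule eventually_gt_at_top)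

lemma ev_prob: "\<forall>\<^sub>F n in sequentially. prob_space (M n)"
  using ev_pos by eventually_elim (rule prob)

lemma E_measurable: "n > 0 \<Longrightarrow> E n k \<in> borel_measurable (M n)"
  using distributed_measurable[OF E_exp] by simp

lemma T_measurable: "n > 0 \<Longrightarrow> (\<lambda>\<omega>. T n \<omega> k) \<in> borel_measurable (M n)"
  unfolding arr_def by (intro borel_measurable_sum E_measurable)

lemma \<sigma>_measurable: "n > 0 \<Longrightarrow> \<sigma> n k \<in> borel_measurable (M n)"
  using sigma_law by blast

lemma alpha_fmeas: "n > 0 \<Longrightarrow> \<alpha> n \<in> fmeas"
  using alpha_prob[of n] by (intro fmeasI) (auto simp: prob_space.finite_measure)

lemma alpha_lim_fmeas: "\<alpha>_lim \<in> fmeas"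
  using alpha_lim by (intro fmeasI) (auto simp: prob_space.finite_measure)

lemma AE_good: "n > 0 \<Longrightarrow> AE \<omega> in M n. good_arr (\<lambda>k. E n k \<omega>)"
  by (rule prob_space.AE_good_arr[OF prob lam_pos E_exp indep])

lemma inflow_in: "t \<ge> 0 \<Longrightarrow> inflow lam_lim \<alpha>_lim t \<in> fmeas"
  using inflow_fmeas[of \<alpha>_lim lam_lim t] alpha_lim lam_lim_pos by simp

lemma pair_inflow_lim: "t \<ge> 0 \<Longrightarrow> f \<in> bdd_borel \<Longrightarrow>
    pair (inflow lam_lim \<alpha>_lim t) f = lam_lim * (LINT u:{0..t}|lborel. pair \<alpha>_lim (\<lambda>y. f (u + y)))"
  using pair_inflow[of \<alpha>_lim lam_lim t f] alpha_lim lam_lim_pos by simp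

text \<open>For N(n) of order n every index up to N(n) has L1 deviation at most b(n), so the sum
  over the indices divided by n costs no more than C b(n). Expectations of single deviations are
  enough; no maximal inequality enters.\<close>

lemma arrivals_deviation:
  fixes N :: "nat \<Rightarrow> nat"
  assumes C: "\<And>n. n > 0 \<Longrightarrow> real (N n) + 1 \<le> C * real n"
  shows "conv0_prob M (\<lambda>n \<omega>. \<bar>T n \<omega> (N n) / real n - real (N n) / (real n * lam_lim)\<bar>)"
    and "conv0_prob M (\<lambda>n \<omega>. (\<Sum>k<N n. \<bar>T n \<omega> k / real n - real k / (real n * lam_lim)\<bar>) / real n)"
proof -
  have C0: "C \<ge> 0" using C[of 1] by simp
  \<comment> \<open>The three terms are the fluctuation of the arrival time, the mismatch of the
    rates, and the offset between k + 1 and k.\<close>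
  define b where "b n = 2 * sqrt C / (lam n * sqrt (real n)) + C * \<bar>1 / lam n - 1 / lam_lim\<bar> + 1 / (lam n * real n)" for n
  have b0: "b n \<ge> 0" if "n > 0" for n using lam_pos[OF that] C0 by (simp add: b_def)
  let ?D = "\<lambda>n k \<omega>. \<bar>T n \<omega> k / real n - real k / (real n * lam_lim)\<bar>"
  have int: "integrable (M n) (?D n k)" and bound: "(\<integral>\<omega>. ?D n k \<omega> \<partial>M n) \<le> b n"
    if n: "n > 0" and k: "k \<le> N n" for n k
  proof -
    have n': "real n > 0" using n by simp
    have l: "lam n > 0" by (rule lam_pos[OF n])
    note * = prob_space.arr_L1[OF prob[OF n] l E_exp[OF n] indep[OF n] k n' lam_lim_pos]
    show "integrable (M n) (?D n k)" by (rule *(1))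
    have "sqrt (real (N n) + 1) \<le> sqrt (C * real n)" using C[OF n] by simp
    then have s: "2 * sqrt (real (N n) + 1) / lam n \<le> 2 * (sqrt C * sqrt (real n)) / lam n"
      using l by (intro divide_right_mono) (auto simp: real_sqrt_mult)
    have "real (N n) \<le> C * real n" using C[OF n] by simp
    then have "real (N n) * \<bar>1 / lam n - 1 / lam_lim\<bar> \<le> (C * real n) * \<bar>1 / lam n - 1 / lam_lim\<bar>"
      by (rule mult_right_mono) simp
    with s have "(2 * sqrt (real (N n) + 1) / lam n + real (N n) * \<bar>1 / lam n - 1 / lam_lim\<bar> + 1 / lam n) / real n
      \<le> (2 * (sqrt C * sqrt (real n)) / lam n + (C * real n) * \<bar>1 / lam n - 1 / lam_lim\<bar> + 1 / lam n) / real n"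
      using n by (intro divide_right_mono) auto
    also have "\<dots> = b n"
    proof -
      have "sqrt (real n) / real n = 1 / sqrt (real n)"
        using n by (simp add: field_simps)
      then have "2 * (sqrt C * sqrt (real n)) / lam n / real n = 2 * sqrt C / (lam n * sqrt (real n))"
        using n l by (simp add: field_simps)
      then show ?thesis using n l by (simp add: b_def add_divide_distrib)
    qed
    finally show "(\<integral>\<omega>. ?D n k \<omega> \<partial>M n) \<le> b n" using *(2) by linarith
  qed
  have lim: "b \<longlonglongrightarrow> 0"
  proof -
    have r: "(\<lambda>n. 1 / real n) \<longlonglongrightarrow> 0" by (rule lim_1_over_n)
    have rs: "(\<lambda>n. 1 / sqrt (real n)) \<longlonglongrightarrow> 0" using tendsto_real_sqrt[OF r] by (simp add: real_sqrt_divide)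
    have "(\<lambda>n. 2 * sqrt C * (1 / lam n) * (1 / sqrt (real n)) + C * \<bar>1 / lam n - 1 / lam_lim\<bar> + (1 / lam n) * (1 / real n))
       \<longlonglongrightarrow> 2 * sqrt C * (1 / lam_lim) * 0 + C * \<bar>1 / lam_lim - 1 / lam_lim\<bar> + (1 / lam_lim) * 0"
      using lam_conv lam_lim_pos
      by (intro tendsto_add tendsto_mult tendsto_const tendsto_rabs tendsto_diff tendsto_divide r rs) auto
    then show ?thesis unfolding b_def by simp
  qed
  show "conv0_prob M (\<lambda>n \<omega>. ?D n (N n) \<omega>)"
    by (rule conv0_prob_L1[OF ev_prob _ lim]) (use ev_pos in eventually_elim, use int bound in simp)
  have limC: "(\<lambda>n. C * b n) \<longlonglongrightarrow> 0" using tendsto_mult_left[OF lim, of C] by simp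
  show "conv0_prob M (\<lambda>n \<omega>. (\<Sum>k<N n. ?D n k \<omega>) / real n)"
  proof (rule conv0_prob_L1[OF ev_prob _ limC])
    show "\<forall>\<^sub>F n in sequentially. integrable (M n) (\<lambda>\<omega>. (\<Sum>k<N n. ?D n k \<omega>) / real n) \<and>
       (\<integral>\<omega>. \<bar>(\<Sum>k<N n. ?D n k \<omega>) / real n\<bar> \<partial>M n) \<le> C * b n"
      using ev_pos
    proof eventually_elim
      case (elim n)
      have i: "integrable (M n) (\<lambda>\<omega>. (\<Sum>k<N n. ?D n k \<omega>) / real n)"
        using int[OF elim] by (intro integrable_divide Bochner_Integration.integrable_sum) simp
      have "\<bar>(\<Sum>k<N n. ?D n k \<omega>) / real n\<bar> = (\<Sum>k<N n. ?D n k \<omega>) / real n" for \<omega>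
        by (intro abs_of_nonneg divide_nonneg_nonneg sum_nonneg) auto
      then have "(\<integral>\<omega>. \<bar>(\<Sum>k<N n. ?D n k \<omega>) / real n\<bar> \<partial>M n) = (\<integral>\<omega>. (\<Sum>k<N n. ?D n k \<omega>) \<partial>M n) / real n"
        by simp
      also have "(\<integral>\<omega>. (\<Sum>k<N n. ?D n k \<omega>) \<partial>M n) = (\<Sum>k<N n. \<integral>\<omega>. ?D n k \<omega> \<partial>M n)"
        using int[OF elim] by (intro Bochner_Integration.integral_sum) simp
      also have "\<dots> \<le> (\<Sum>k<N n. b n)" using bound[OF elim] by (intro sum_mono) simp
      also have "\<dots> = real (N n) * b n" by simp
      also have "\<dots> \<le> (C * real n) * b n" using C[OF elim] b0[OF elim] by (intro mult_right_mono) auto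
      finally have "(\<integral>\<omega>. \<bar>(\<Sum>k<N n. ?D n k \<omega>) / real n\<bar> \<partial>M n) \<le> C * b n"
        using elim by (simp add: divide_right_mono)
      with i show ?case by blast
    qed
  qed
qed

text \<open>\<open>arrival_meas_compare\<close> leaves a remainder 2 \<eta> \<open>lam_lim\<close>
  that does not decrease with n; it is set equal to an arbitrary \<open>\<eta>0\<close> and removed
  by \<open>conv0_prob_approx\<close>.\<close>

lemma arrival_meas_sampled:
  assumes t: "t \<ge> 0" and f: "f \<in> bdd_lip"
  shows "conv0_prob M (\<lambda>n \<omega>. pair (arrival_meas n (T n \<omega>) (S n \<omega>) t) f
     - (\<Sum>k<nat \<lceil>real n * lam_lim * t\<rceil>. f (real k / (real n * lam_lim) + \<sigma> n k \<omega> / real n)) / real n)"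
proof (rule conv0_prob_approx)
  fix \<eta>0 :: real assume e0: "\<eta>0 > 0"
  obtain L where L: "L \<ge> 0" "\<And>x y. \<bar>f x - f y\<bar> \<le> L * \<bar>x - y\<bar>" using f by (auto simp: bdd_lip_def)
  have f1: "\<And>x. \<bar>f x\<bar> \<le> 1" "f \<in> bdd_borel" using f bdd_lip_bdd_borel[OF f] by (auto simp: bdd_lip_def)
  define \<eta> where "\<eta> = \<eta>0 / (2 * lam_lim)"
  have eta: "\<eta> > 0" "2 * \<eta> * lam_lim = \<eta>0" using e0 lam_lim_pos by (auto simp: \<eta>_def)
  \<comment> \<open>One extra unit of time ensures that, when the scaled arrival time at index N(n)
    deviates by at most 1/2, this arrival and all later ones come after t.\<close>
  define N where "N n = nat \<lceil>real n * lam_lim * (t + 1)\<rceil>" for n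
  define C where "C = lam_lim * (t + 1) + 2"
  have Nle: "real n * lam_lim * (t + 1) \<le> real (N n)" for n unfolding N_def by linarith
  have C: "real (N n) + 1 \<le> C * real n" if "n > 0" for n
  proof -
    have "0 \<le> real n * lam_lim * (t + 1)" using lam_lim_pos t by simp
    then have "real (N n) \<le> real n * lam_lim * (t + 1) + 1" unfolding N_def by linarith
    then have "real (N n) + 1 \<le> real n * lam_lim * (t + 1) + 2 * real n" using that by linarith
    then show ?thesis by (simp add: C_def algebra_simps)
  qed
  note dev = arrivals_deviation[of N C, OF C]
  let ?A = "\<lambda>n \<omega>. if good_arr (\<lambda>k. E n k \<omega>) then 0 else 1 :: real"
  let ?B = "\<lambda>n \<omega>. \<bar>T n \<omega> (N n) / real n - real (N n) / (real n * lam_lim)\<bar>"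
  let ?V = "\<lambda>n \<omega>. (\<Sum>k<N n. \<bar>T n \<omega> k / real n - real k / (real n * lam_lim)\<bar>) / real n"
  let ?Z = "\<lambda>n \<omega>. pair (arrival_meas n (T n \<omega>) (S n \<omega>) t) f
     - (\<Sum>k<nat \<lceil>real n * lam_lim * t\<rceil>. f (real k / (real n * lam_lim) + \<sigma> n k \<omega> / real n)) / real n"
  \<comment> \<open>If this sum is at most 1/2, the 0/1 term must be 0 and the deviation of arrival
    N(n) is at most 1/2.\<close>
  have X: "conv0_prob M (\<lambda>n \<omega>. ?A n \<omega> + ?B n \<omega>)"
    by (intro conv0_prob_add ev_prob dev(1) conv0_prob_AE) (use ev_pos in eventually_elim, rule AE_good)
  have Y: "conv0_prob M (\<lambda>n \<omega>. (L + 1 / \<eta>) * ?V n \<omega> + 1 / real n)"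
    by (intro conv0_prob_add ev_prob conv0_prob_mult dev(2) conv0_prob_const lim_1_over_n)
  have dom: "\<bar>?Z n \<omega>\<bar> \<le> ((L + 1 / \<eta>) * ?V n \<omega> + 1 / real n) + \<eta>0"
    if n: "n > 0" and X: "\<bar>?A n \<omega> + ?B n \<omega>\<bar> \<le> 1 / 2" for n \<omega>
  proof -
    have g: "good_arr (\<lambda>k. E n k \<omega>)"
    proof (rule ccontr)
      assume "\<not> good_arr (\<lambda>k. E n k \<omega>)"
      then have "?A n \<omega> = 1" by simp
      moreover have "0 \<le> ?B n \<omega>" by simp
      ultimately show False using X by linarith
    qed
    then have B: "?B n \<omega> \<le> 1 / 2" using X by simp
    have nl: "real n * lam_lim > 0" using n lam_lim_pos by simp
    have "t + 1 \<le> real (N n) / (real n * lam_lim)" using Nle[of n] nl by (simp add: pos_le_divide_eq mult.commute mult.left_commute)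
    then have TN: "t < T n \<omega> (N n) / real n" using B by linarith
    have "t < T n \<omega> k / real n" if "k \<ge> N n" for k
    proof -
      have "T n \<omega> (N n) / real n \<le> T n \<omega> k / real n" using good_arr_mono[OF g that] by (intro divide_right_mono) auto
      then show ?thesis using TN by linarith
    qed
    moreover have "nat \<lceil>real n * lam_lim * t\<rceil> \<le> N n"
      unfolding N_def using nl by (intro nat_mono ceiling_mono mult_left_mono) auto
    ultimately have "\<bar>?Z n \<omega>\<bar> \<le> (L + 1 / \<eta>) * ?V n \<omega> + (2 * \<eta> * lam_lim + 1 / real n)"
      by (intro arrival_meas_compare n lam_lim_pos t f1 L eta(1))
    then show ?thesis using eta(2) by linarith
  qed
  have Vn: "0 \<le> (L + 1 / \<eta>) * ?V n \<omega> + 1 / real n" for n \<omega>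
    using L(1) eta(1) by (intro add_nonneg_nonneg mult_nonneg_nonneg divide_nonneg_nonneg sum_nonneg) auto
  \<comment> \<open>Only the excess over \<open>\<eta>0\<close> can be dominated by an error that
    vanishes with n.\<close>
  let ?R = "\<lambda>n \<omega>. max 0 (\<bar>?Z n \<omega>\<bar> - \<eta>0)"
  have "conv0_prob M ?R"
  proof (rule conv0_prob_cond[OF ev_prob X Y, of "1 / 2"])
    show "\<forall>\<^sub>F n in sequentially. \<forall>\<omega>\<in>space (M n). \<bar>?A n \<omega> + ?B n \<omega>\<bar> \<le> 1 / 2 \<longrightarrow>
        \<bar>?R n \<omega>\<bar> \<le> \<bar>(L + 1 / \<eta>) * ?V n \<omega> + 1 / real n\<bar>"
      using ev_pos
    proof (eventually_elim, intro ballI impI)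
      fix n \<omega> assume "0 < n" "\<bar>?A n \<omega> + ?B n \<omega>\<bar> \<le> 1 / 2"
      from dom[OF this] show "\<bar>?R n \<omega>\<bar> \<le> \<bar>(L + 1 / \<eta>) * ?V n \<omega> + 1 / real n\<bar>"
        using Vn[of n \<omega>] by linarith
    qed
  qed simp
  moreover have "\<bar>?Z n \<omega>\<bar> \<le> \<bar>?R n \<omega>\<bar> + \<eta>0" for n \<omega> by linarith
  ultimately show "\<exists>Y. conv0_prob M Y \<and> (\<forall>\<^sub>F n in sequentially. \<forall>\<omega>\<in>space (M n). \<bar>?Z n \<omega>\<bar> \<le> \<bar>Y n \<omega>\<bar> + \<eta>0)"
    by (intro exI[of _ ?R]) auto
qed

text \<open>At most n \<open>lam_lim\<close> t + 1 independent terms bounded by 1 have a sum with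
  variance of order n; dividing the sum by n leaves a variance of order 1/n.\<close>

lemma sampled_mean:
  assumes t: "t \<ge> 0" and f: "f \<in> bdd_lip"
  shows "conv0_prob M (\<lambda>n \<omega>. (\<Sum>k<nat \<lceil>real n * lam_lim * t\<rceil>. f (real k / (real n * lam_lim) + \<sigma> n k \<omega> / real n)) / real n
     - (\<Sum>k<nat \<lceil>real n * lam_lim * t\<rceil>. pair (distr (\<alpha> n) borel (\<lambda>x. x / real n)) (\<lambda>y. f (real k / (real n * lam_lim) + y))) / real n)"
    (is "conv0_prob M ?Z")
proof (rule conv0_prob_sqrt, rule conv0_prob_L1[OF ev_prob])
  have f1: "\<And>x. \<bar>f x\<bar> \<le> 1" "f \<in> bdd_borel" using f bdd_lip_bdd_borel[OF f] by (auto simp: bdd_lip_def)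
  have [measurable]: "f \<in> borel_measurable borel" using f1 by (simp add: bdd_borel_def)
  show "\<forall>\<^sub>F n in sequentially. integrable (M n) (\<lambda>\<omega>. (?Z n \<omega>)\<^sup>2) \<and> (\<integral>\<omega>. \<bar>(?Z n \<omega>)\<^sup>2\<bar> \<partial>M n) \<le> (lam_lim * t + 1) / real n"
    using ev_pos
  proof eventually_elim
    case (elim n)
    interpret prob_space "M n" by (rule prob[OF elim])
    define K where "K = nat \<lceil>real n * lam_lim * t\<rceil>"
    let ?I = "Inr ` {..<K} :: (nat + nat) set"
    \<comment> \<open>The value 0 on the left summand merely makes h total on the index type; the
      sums run over the service times.\<close>
    define h :: "nat + nat \<Rightarrow> real \<Rightarrow> real"
      where "h i x = (case i of Inl _ \<Rightarrow> 0 | Inr k \<Rightarrow> f (real k / (real n * lam_lim) + x / real n))" for i x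
    define Y where "Y i \<omega> = h i ((case i of Inl k \<Rightarrow> E n k | Inr k \<Rightarrow> \<sigma> n k) \<omega>)" for i \<omega>
    have hm: "h i \<in> borel_measurable borel" for i unfolding h_def[abs_def] by (cases i) simp_all
    have ind: "indep_vars (\<lambda>_. borel) Y ?I"
      unfolding Y_def by (rule indep_vars_compose2[OF indep_vars_subset[OF indep[OF elim]]]) (use hm in auto)
    have Yb: "\<bar>Y i \<omega>\<bar> \<le> 1" for i \<omega> by (cases i) (auto simp: Y_def h_def f1)
    have YInr: "Y (Inr k) \<omega> = f (real k / (real n * lam_lim) + \<sigma> n k \<omega> / real n)" for k \<omega> by (simp add: Y_def h_def)
    have EY: "expectation (Y (Inr k)) = pair (distr (\<alpha> n) borel (\<lambda>x. x / real n)) (\<lambda>y. f (real k / (real n * lam_lim) + y))" for k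
    proof -
      have "(\<lambda>y. f (real k / (real n * lam_lim) + y)) \<in> bdd_borel" by (rule bdd_borel_comp[OF f1(2)]) simp
      then have "pair (distr (\<alpha> n) borel (\<lambda>x. x / real n)) (\<lambda>y. f (real k / (real n * lam_lim) + y))
         = pair (\<alpha> n) (\<lambda>x. f (real k / (real n * lam_lim) + x / real n))"
        by (intro pair_distr alpha_fmeas elim) auto
      also have "\<dots> = (\<integral>x. f (real k / (real n * lam_lim) + x / real n) \<partial>distr (M n) borel (\<sigma> n k))"
        unfolding pair_def using sigma_law[OF elim] by simp
      also have "\<dots> = expectation (\<lambda>\<omega>. f (real k / (real n * lam_lim) + \<sigma> n k \<omega> / real n))"
        by (rule integral_distr) (use \<sigma>_measurable[OF elim] in auto)
      also have "(\<lambda>\<omega>. f (real k / (real n * lam_lim) + \<sigma> n k \<omega> / real n)) = Y (Inr k)"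
        by (rule ext) (rule YInr[symmetric])
      finally show ?thesis by (rule sym)
    qed
    have s1: "(\<Sum>i\<in>?I. Y i \<omega>) = (\<Sum>k<K. f (real k / (real n * lam_lim) + \<sigma> n k \<omega> / real n))" for \<omega>
      by (subst sum.reindex) (auto simp: YInr)
    have s2: "(\<Sum>i\<in>?I. expectation (Y i)) = (\<Sum>k<K. pair (distr (\<alpha> n) borel (\<lambda>x. x / real n)) (\<lambda>y. f (real k / (real n * lam_lim) + y)))"
      by (subst sum.reindex) (auto simp: EY)
    have Z: "(?Z n \<omega>)\<^sup>2 = ((\<Sum>i\<in>?I. Y i \<omega>) - (\<Sum>i\<in>?I. expectation (Y i)))\<^sup>2 / (real n)\<^sup>2" for \<omega>
      unfolding s1 s2 K_def[symmetric] by (simp add: diff_divide_distrib[symmetric] power_divide)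
    note var = variance_sum_le[of ?I Y, OF _ ind Yb]
    have "integrable (M n) (\<lambda>\<omega>. (?Z n \<omega>)\<^sup>2)" unfolding Z using var(1) by simp
    moreover have "(\<integral>\<omega>. \<bar>(?Z n \<omega>)\<^sup>2\<bar> \<partial>M n) \<le> (lam_lim * t + 1) / real n"
    proof -
      have "(\<integral>\<omega>. \<bar>(?Z n \<omega>)\<^sup>2\<bar> \<partial>M n) = (\<integral>\<omega>. (?Z n \<omega>)\<^sup>2 \<partial>M n)" by simp
      also have "\<dots> = expectation (\<lambda>\<omega>. ((\<Sum>i\<in>?I. Y i \<omega>) - (\<Sum>i\<in>?I. expectation (Y i)))\<^sup>2) / (real n)\<^sup>2"
        unfolding Z by simp
      also have "\<dots> \<le> real (card ?I) / (real n)\<^sup>2" using var(2) by (intro divide_right_mono) auto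
      also have "real (card ?I) = real K" by (subst card_image) auto
      also have "real K / (real n)\<^sup>2 \<le> (real n * (lam_lim * t + 1)) / (real n)\<^sup>2"
      proof (rule divide_right_mono)
        have "0 \<le> real n * lam_lim * t" using lam_lim_pos t by simp
        then have "real K \<le> real n * lam_lim * t + 1" unfolding K_def by linarith
        also have "\<dots> \<le> real n * (lam_lim * t + 1)" using elim by (simp add: algebra_simps)
        finally show "real K \<le> real n * (lam_lim * t + 1)" .
      qed simp
      also have "\<dots> = (lam_lim * t + 1) / real n" using elim by (simp add: power2_eq_square)
      finally show ?thesis .
    qed
    ultimately show ?case ..
  qed
  show "(\<lambda>n. (lam_lim * t + 1) / real n) \<longlonglongrightarrow> 0" by (rule lim_const_over_n)
qed

text \<open>Weak convergence of the scaled service laws gives, for each u, convergence of the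
  averages of f(u + y). These laws have mass 1, so the averages inherit the Lipschitz constant and
  the bound of f uniformly in n, as \<open>riemann_sum_tendsto\<close> requires.\<close>

lemma mean_limit:
  assumes t: "t \<ge> 0" and f: "f \<in> bdd_lip"
  shows "(\<lambda>n. (\<Sum>k<nat \<lceil>real n * lam_lim * t\<rceil>. pair (distr (\<alpha> n) borel (\<lambda>x. x / real n)) (\<lambda>y. f (real k / (real n * lam_lim) + y))) / real n)
    \<longlonglongrightarrow> pair (inflow lam_lim \<alpha>_lim t) f"
proof -
  obtain L where L: "L \<ge> 0" "\<And>x y. \<bar>f x - f y\<bar> \<le> L * \<bar>x - y\<bar>" using f by (auto simp: bdd_lip_def)
  have f1: "\<And>x. \<bar>f x\<bar> \<le> 1" "f \<in> bdd_borel" using f bdd_lip_bdd_borel[OF f] by (auto simp: bdd_lip_def)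
  let ?a = "\<lambda>n. distr (\<alpha> n) borel (\<lambda>x. x / real n)"
  define g where "g n u = pair (?a n) (\<lambda>y. f (u + y))" for n u
  define g0 where "g0 u = pair \<alpha>_lim (\<lambda>y. f (u + y))" for u
  have fu: "(\<lambda>y. f (u + y)) \<in> bdd_borel" for u by (rule bdd_borel_comp[OF f1(2)]) simp
  have af: "?a n \<in> fmeas" if "n > 0" for n by (rule distr_fmeas[OF alpha_fmeas[OF that]]) simp
  have a1: "measure (?a n) UNIV = 1" if "n > 0" for n
  proof -
    interpret prob_space "\<alpha> n" using alpha_prob[OF that] by simp
    have "prob_space (?a n)"
      by (rule prob_space_distr) (rule fmeas_measurable[OF alpha_fmeas[OF that]], simp)
    then show ?thesis using prob_space.prob_space[of "?a n"] by simp
  qed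
  have lip: "\<bar>pair \<mu> (\<lambda>y. f (u + y)) - pair \<mu> (\<lambda>y. f (v + y))\<bar> \<le> L * \<bar>u - v\<bar> * measure \<mu> UNIV" if "\<mu> \<in> fmeas" for \<mu> u v
  proof -
    have "\<bar>f (u + y) - f (v + y)\<bar> \<le> L * \<bar>u - v\<bar>" for y using L(2)[of "u + y" "v + y"] by simp
    then have "\<bar>pair \<mu> (\<lambda>y. f (u + y) - f (v + y))\<bar> \<le> L * \<bar>u - v\<bar> * measure \<mu> UNIV"
      by (intro pair_bound that bdd_borel_diff fu)
    then show ?thesis by (simp only: pair_diff[OF that fu fu])
  qed
  have "(\<lambda>n. (\<Sum>k<nat \<lceil>real n * lam_lim * t\<rceil>. g n (real k / (real n * lam_lim))) / real n) \<longlonglongrightarrow> lam_lim * integral {0..t} g0"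
  proof (rule riemann_sum_tendsto[OF lam_lim_pos t L(1)])
    fix n :: nat and u v assume n: "n > 0"
    show "\<bar>g n u - g n v\<bar> \<le> L * \<bar>u - v\<bar>" using lip[OF af[OF n], of u v] a1[OF n] by (simp add: g_def)
    show "\<bar>g n u\<bar> \<le> 1" using pair_bound[OF af[OF n] fu, of u 1] a1[OF n] f1(1) by (simp add: g_def)
  next
    fix u
    have "(\<lambda>y. f (u + y)) \<in> bdd_lip" unfolding bdd_lip_def using f1(1) L by (auto intro!: exI[of _ L]) (metis add_diff_cancel_left)
    then show "(\<lambda>n. g n u) \<longlonglongrightarrow> g0 u" using alpha_conv bdd_lip_Cb unfolding wconv_def g_def g0_def by blast
  qed
  moreover have "lam_lim * integral {0..t} g0 = pair (inflow lam_lim \<alpha>_lim t) f"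
  proof -
    have "(L * measure \<alpha>_lim UNIV)-lipschitz_on UNIV g0"
      by (rule lipschitz_onI) (use lip[OF alpha_lim_fmeas] L(1) in \<open>auto simp: dist_real_def g0_def mult_ac\<close>)
    then have "continuous_on {0..t} g0" using lipschitz_on_continuous_on continuous_on_subset by blast
    then have "set_integrable lborel {0..t} g0" unfolding set_integrable_def by (intro borel_integrable_compact) auto
    then have "(LINT u:{0..t}|lborel. g0 u) = integral {0..t} g0" by (rule set_borel_integral_eq_integral(2))
    then show ?thesis unfolding pair_inflow_lim[OF t f1(2)] by (simp add: g0_def)
  qed
  ultimately show ?thesis by (simp add: g_def)
qed

lemma arrival_meas_pair_tendsto:
  assumes t: "t \<ge> 0" and f: "f \<in> bdd_lip"
  shows "conv0_prob M (\<lambda>n \<omega>. pair (arrival_meas n (T n \<omega>) (S n \<omega>) t) f - pair (inflow lam_lim \<alpha>_lim t) f)"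
proof -
  let ?m = "\<lambda>n. (\<Sum>k<nat \<lceil>real n * lam_lim * t\<rceil>. pair (distr (\<alpha> n) borel (\<lambda>x. x / real n)) (\<lambda>y. f (real k / (real n * lam_lim) + y))) / real n"
  have "conv0_prob M (\<lambda>n \<omega>. ?m n - pair (inflow lam_lim \<alpha>_lim t) f)"
    by (rule conv0_prob_const) (rule LIM_zero[OF mean_limit[OF t f]])
  from conv0_prob_add[OF ev_prob conv0_prob_add[OF ev_prob arrival_meas_sampled[OF t f] sampled_mean[OF t f]] this]
  show ?thesis by simp
qed

text \<open>The exceptional set is a common one for the finitely many functions from
  \<open>dBL_finite_test\<close>, so a supremum over an uncountable class never has to be
  measured.\<close>

lemma conv0_prob_dBL:
  assumes nu: "\<nu> \<in> fmeas" and X: "\<And>n \<omega>. n > 0 \<Longrightarrow> \<omega> \<in> space (M n) \<Longrightarrow> X n \<omega> \<in> fmeas"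
    and conv: "\<And>f. f \<in> bdd_lip \<Longrightarrow> conv0_prob M (\<lambda>n \<omega>. pair (X n \<omega>) f - pair \<nu> f)"
  shows "conv0_prob M (\<lambda>n \<omega>. dBL (X n \<omega>) \<nu>)"
  unfolding conv0_prob_def
proof (intro allI impI)
  fix d e :: real assume d: "d > 0" and e: "e > 0"
  obtain H c where H: "finite H" "H \<subseteq> bdd_lip" "c > 0"
    "\<And>\<mu>. \<mu> \<in> fmeas \<Longrightarrow> (\<And>h. h \<in> H \<Longrightarrow> \<bar>pair \<mu> h - pair \<nu> h\<bar> \<le> c) \<Longrightarrow> dBL \<mu> \<nu> \<le> d"
    using dBL_finite_test[OF nu d] by metis
  have "\<forall>\<^sub>F n in sequentially. \<exists>A\<in>sets (M n). measure (M n) A \<le> e \<and>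
      (\<forall>\<omega>\<in>space (M n) - A. \<forall>h\<in>H. \<bar>pair (X n \<omega>) h - pair \<nu> h\<bar> \<le> c)"
    by (rule conv0_prob_finite[OF ev_prob H(1) conv H(3) e]) (use H(2) in auto)
  then show "\<forall>\<^sub>F n in sequentially. \<exists>A\<in>sets (M n). measure (M n) A \<le> e \<and> (\<forall>\<omega>\<in>space (M n) - A. \<bar>dBL (X n \<omega>) \<nu>\<bar> \<le> d)"
    using ev_pos
  proof eventually_elim
    case (elim n)
    then obtain A where A: "A \<in> sets (M n)" "measure (M n) A \<le> e"
      "\<And>\<omega> h. \<omega> \<in> space (M n) - A \<Longrightarrow> h \<in> H \<Longrightarrow> \<bar>pair (X n \<omega>) h - pair \<nu> h\<bar> \<le> c" by blast
    have "\<bar>dBL (X n \<omega>) \<nu>\<bar> \<le> d" if w: "\<omega> \<in> space (M n) - A" for \<omega>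
    proof -
      have x: "X n \<omega> \<in> fmeas" by (rule X[OF elim(2)]) (use w in simp)
      show ?thesis using H(4)[OF x A(3)[OF w]] dBL_nonneg[OF x nu] by simp
    qed
    with A show ?case by blast
  qed
qed

lemma arrival_meas_dBL_tendsto: "t \<ge> 0 \<Longrightarrow> conv0_prob M (\<lambda>n \<omega>. dBL (arrival_meas n (T n \<omega>) (S n \<omega>) t) (inflow lam_lim \<alpha>_lim t))"
  by (intro conv0_prob_dBL inflow_in arrival_meas_fmeas arrival_meas_pair_tendsto)

text \<open>Both families increase in time, so on a time interval the test-function increments are
  bounded by the mass increments; this upgrades convergence at fixed times to local uniformity.\<close>
lemma arrival_meas_increment:
  assumes g: "good_arr e" and n: "n > 0" and st: "s \<le> t" and f: "f \<in> unit_lip"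
  shows "\<bar>pair (arrival_meas n (arr e) \<sigma>' t) f - pair (arrival_meas n (arr e) \<sigma>' s) f\<bar>
    \<le> measure (arrival_meas n (arr e) \<sigma>' t) UNIV - measure (arrival_meas n (arr e) \<sigma>' s) UNIV"
proof -
  let ?R = "\<lambda>k. arr e k / real n"
  let ?A = "\<lambda>t. {k. ?R k \<le> t}"
  have fin: "finite (?A t)" for t by (rule good_arr_finite[OF g n])
  have sub: "?A s \<subseteq> ?A t" using st by auto
  have p: "pair (arrival_meas n (arr e) \<sigma>' u) h = (\<Sum>k\<in>?A u. h ((arr e k + \<sigma>' k) / real n)) / real n" if "h \<in> bdd_borel" for u h
    unfolding pair_arrival_meas[OF that] by (simp add: arrived_def fin)
  have d: "pair (arrival_meas n (arr e) \<sigma>' t) h - pair (arrival_meas n (arr e) \<sigma>' s) h = (\<Sum>k\<in>?A t - ?A s. h ((arr e k + \<sigma>' k) / real n)) / real n"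
    if "h \<in> bdd_borel" for h
    unfolding p[OF that] using sum_diff[OF fin sub, of "\<lambda>k. h ((arr e k + \<sigma>' k) / real n)"] by (simp add: diff_divide_distrib)
  have "\<bar>\<Sum>k\<in>?A t - ?A s. f ((arr e k + \<sigma>' k) / real n)\<bar> \<le> (\<Sum>k\<in>?A t - ?A s. 1)"
    by (rule order_trans[OF sum_abs sum_mono]) (use f in \<open>auto simp: unit_lip_def\<close>)
  then have "\<bar>pair (arrival_meas n (arr e) \<sigma>' t) f - pair (arrival_meas n (arr e) \<sigma>' s) f\<bar>
     \<le> pair (arrival_meas n (arr e) \<sigma>' t) (\<lambda>_. 1) - pair (arrival_meas n (arr e) \<sigma>' s) (\<lambda>_. 1)"
    unfolding d[OF unit_lip_bdd_borel[OF f]] d[OF bdd_borel_const] using n by (simp add: divide_right_mono)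
  then show ?thesis by (simp add: pair_const arrival_meas_fmeas)
qed

lemma inflow_increment:
  assumes s: "0 \<le> s" "s \<le> t" and f: "f \<in> bdd_borel" "\<And>x. \<bar>f x\<bar> \<le> 1"
  shows "\<bar>pair (inflow lam_lim \<alpha>_lim t) f - pair (inflow lam_lim \<alpha>_lim s) f\<bar> \<le> lam_lim * (t - s)"
proof -
  let ?G = "\<lambda>u. pair \<alpha>_lim (\<lambda>y. f (u + y))"
  interpret A: prob_space \<alpha>_lim using alpha_lim by simp
  have [measurable_cong]: "sets \<alpha>_lim = sets borel" using alpha_lim by simp
  have [measurable]: "f \<in> borel_measurable borel" using f by (simp add: bdd_borel_def)
  have Gm [measurable]: "?G \<in> borel_measurable borel" unfolding pair_def by measurable
  have Gb: "\<bar>?G u\<bar> \<le> 1" for u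
    using pair_bound[OF alpha_lim_fmeas bdd_borel_comp[OF f(1), of "\<lambda>y. u + y"], of 1] f(2) A.prob_space
    by (simp add: fmeas_space[OF alpha_lim_fmeas])
  have int: "set_integrable lborel {a..b} ?G" for a b
    unfolding set_integrable_def
    by (rule integrableI_bounded_set_indicator[where B=1]) (use Gb in \<open>auto simp: emeasure_lborel_Icc_eq\<close>)
  have int': "set_integrable lborel {s<..t} ?G"
    by (rule set_integrable_subset[OF int[of s t]]) auto
  have "{0..t} = {0..s} \<union> {s<..t}" using s by auto
  moreover have "{0..s} \<inter> {s<..t} = {}" by auto
  ultimately have "(LINT u:{0..t}|lborel. ?G u) = (LINT u:{0..s}|lborel. ?G u) + (LINT u:{s<..t}|lborel. ?G u)"
    using set_integral_Un[OF _ int[of 0 s] int'] by metis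
  moreover have "\<bar>LINT u:{s<..t}|lborel. ?G u\<bar> \<le> t - s"
  proof -
    have "\<bar>LINT u:{s<..t}|lborel. ?G u\<bar> \<le> (LINT u:{s<..t}|lborel. 1)"
      unfolding set_lebesgue_integral_def
    proof (rule order_trans[OF integral_abs_bound integral_mono])
      show "integrable lborel (\<lambda>u. \<bar>indicator {s<..t} u *\<^sub>R ?G u\<bar>)"
        using int' unfolding set_integrable_def by (rule integrable_abs)
      show "integrable lborel (\<lambda>u. indicator {s<..t} u *\<^sub>R (1::real))"
        using s by simp
    qed (use Gb in \<open>auto simp: indicator_def\<close>)
    also have "\<dots> = t - s" using s by (simp add: set_lebesgue_integral_def)
    finally show ?thesis .
  qed
  ultimately show ?thesis
    using s f lam_lim_pos by (simp add: pair_inflow_lim distrib_left abs_mult)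
qed

lemma arrival_meas_uniform:
  assumes T0: "T0 > 0" and d: "\<delta> > 0" and e: "\<epsilon> > 0"
  shows "\<forall>\<^sub>F n in sequentially. \<exists>A\<in>sets (M n). measure (M n) A \<le> \<epsilon> \<and>
     (\<forall>\<omega>\<in>space (M n) - A. good_arr (\<lambda>k. E n k \<omega>) \<longrightarrow>
        (\<forall>t\<in>{0..T0}. dBL (arrival_meas n (T n \<omega>) (S n \<omega>) t) (inflow lam_lim \<alpha>_lim t) \<le> \<delta>))"
proof -
  \<comment> \<open>Error budget: \<delta>/8 at the grid point, \<delta>/4 for the inflow over one
    step, and \<delta>/2 for the arrivals, whose mass increment is compared with that of the inflow
    at both ends of the step.\<close>
  define h where "h = \<delta> / (4 * lam_lim)"
  have h: "h > 0" using d lam_lim_pos by (simp add: h_def)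
  have lh: "lam_lim * h = \<delta> / 4" using lam_lim_pos by (simp add: h_def)
  \<comment> \<open>The additional index makes the right end of the last step a grid point as
    well.\<close>
  let ?I = "{..nat \<lceil>T0 / h\<rceil> + 1}"
  let ?F = "inflow lam_lim \<alpha>_lim"
  have "\<forall>\<^sub>F n in sequentially. \<exists>A\<in>sets (M n). measure (M n) A \<le> \<epsilon> \<and>
     (\<forall>\<omega>\<in>space (M n) - A. \<forall>i\<in>?I. \<bar>dBL (arrival_meas n (T n \<omega>) (S n \<omega>) (real i * h)) (?F (real i * h))\<bar> \<le> \<delta> / 8)"
    by (rule conv0_prob_finite[OF ev_prob _ arrival_meas_dBL_tendsto]) (use h d e in auto)
  then show ?thesis using ev_pos
  proof eventually_elim
    case (elim n)
    then obtain A where A: "A \<in> sets (M n)" "measure (M n) A \<le> \<epsilon>"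
      "\<And>\<omega> i. \<omega> \<in> space (M n) - A \<Longrightarrow> i \<in> ?I \<Longrightarrow> \<bar>dBL (arrival_meas n (T n \<omega>) (S n \<omega>) (real i * h)) (?F (real i * h))\<bar> \<le> \<delta> / 8" by blast
    have "dBL (arrival_meas n (T n \<omega>) (S n \<omega>) t) (?F t) \<le> \<delta>"
      if w: "\<omega> \<in> space (M n) - A" and g: "good_arr (\<lambda>k. E n k \<omega>)" and t: "t \<in> {0..T0}" for \<omega> t
    proof -
      define i where "i = nat \<lfloor>t / h\<rfloor>"
      have th: "0 \<le> t / h" using t h by simp
      then have i: "real i \<le> t / h" "t / h < real i + 1" unfolding i_def by linarith+
      have "t / h \<le> T0 / h" using t h by (intro divide_right_mono) auto
      then have "i \<le> nat \<lceil>T0 / h\<rceil>" using i(1) by linarith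
      then have iI: "i \<in> ?I" "Suc i \<in> ?I" by auto
      let ?a = "real i * h" and ?b = "real (Suc i) * h"
      have ab: "0 \<le> ?a" "?a \<le> t" "t \<le> ?b" "?b - ?a = h" using i h by (auto simp: field_simps)
      let ?X = "\<lambda>t. arrival_meas n (T n \<omega>) (S n \<omega>) t"
      have Xa: "dBL (?X ?a) (?F ?a) \<le> \<delta> / 8" using A(3)[OF w iI(1)] by simp
      have Xb: "dBL (?X ?b) (?F ?b) \<le> \<delta> / 8" using A(3)[OF w iI(2)] by simp
      have b0: "0 \<le> ?b" using h by simp
      have mono: "measure (?X t) UNIV \<le> measure (?X ?b) UNIV"
      proof -
        have "(\<lambda>_. 0 :: real) \<in> unit_lip" by (simp add: unit_lip_const)
        from order_trans[OF abs_ge_zero arrival_meas_increment[OF g elim(2) ab(3) this, of "S n \<omega>"]] show ?thesis by simp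
      qed
      have "measure (?X ?b) UNIV - measure (?X ?a) UNIV \<le> \<delta> / 8 + \<delta> / 8 + \<delta> / 4"
      proof -
        have "\<bar>measure (?X ?b) UNIV - measure (?F ?b) UNIV\<bar> \<le> \<delta> / 8"
          using dBL_mass[OF arrival_meas_fmeas inflow_in[OF b0], of n "T n \<omega>" "S n \<omega>" ?b] Xb by linarith
        moreover have "\<bar>measure (?X ?a) UNIV - measure (?F ?a) UNIV\<bar> \<le> \<delta> / 8"
          using dBL_mass[OF arrival_meas_fmeas inflow_in[OF ab(1)], of n "T n \<omega>" "S n \<omega>" ?a] Xa by linarith
        moreover have "\<bar>measure (?F ?b) UNIV - measure (?F ?a) UNIV\<bar> \<le> \<delta> / 4"
          using inflow_increment[OF ab(1), of ?b "\<lambda>_. 1"] ab lh inflow_in[OF ab(1)] inflow_in[OF b0]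
          by (simp add: pair_const)
        ultimately show ?thesis by linarith
      qed
      then have incr: "measure (?X t) UNIV - measure (?X ?a) UNIV \<le> \<delta> / 2" using mono by simp
      have Fab: "lam_lim * (t - ?a) \<le> \<delta> / 4"
      proof -
        have "lam_lim * (t - ?a) \<le> lam_lim * h" using ab lam_lim_pos by (intro mult_left_mono) auto
        then show ?thesis by (simp add: lh)
      qed
      show ?thesis
      proof (rule dBL_le)
        fix f assume f: "f \<in> unit_lip"
        have "\<bar>pair (?X t) f - pair (?X ?a) f\<bar> \<le> \<delta> / 2"
          using arrival_meas_increment[OF g elim(2) ab(2) f, of "S n \<omega>"] incr by linarith
        moreover have "\<bar>pair (?F t) f - pair (?F ?a) f\<bar> \<le> \<delta> / 4"
        proof -
          have "\<bar>pair (?F t) f - pair (?F ?a) f\<bar> \<le> lam_lim * (t - ?a)"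
            by (rule inflow_increment[OF ab(1,2) unit_lip_bdd_borel[OF f]]) (use f in \<open>auto simp: unit_lip_def\<close>)
          then show ?thesis using Fab by linarith
        qed
        moreover have "\<bar>pair (?X ?a) f - pair (?F ?a) f\<bar> \<le> \<delta> / 8"
          using dBL_ge[OF arrival_meas_fmeas inflow_in[OF ab(1)] f, of n "T n \<omega>" "S n \<omega>" ?a] Xa by linarith
        ultimately show "\<bar>pair (?X t) f - pair (?F t) f\<bar> \<le> \<delta>" using d by linarith
      qed
    qed
    with A(1,2) show ?case by blast
  qed
qed

end

section \<open>The limit path and convergence in distribution\<close>

lemma pair_shift_tendsto:
  assumes nu: "\<nu> \<in> fmeas" and f: "f \<in> Cb" and s: "s \<longlonglongrightarrow> t"
  shows "(\<lambda>k. pair \<nu> (\<lambda>y. f (y - s k))) \<longlonglongrightarrow> pair \<nu> (\<lambda>y. f (y - t))"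
proof -
  have fBM: "f \<in> bdd_borel" by (intro Db_bdd_borel Cb_Db f)
  obtain B where B: "\<And>x. \<bar>f x\<bar> \<le> B" using bdd_borel_bound[OF fBM] by metis
  have c: "isCont f x" for x using f by (simp add: Cb_def continuous_on_eq_continuous_at)
  show ?thesis unfolding pair_def
  proof (rule integral_dominated_convergence[where w="\<lambda>_. B"])
    show "integrable \<nu> (\<lambda>_. B)" by (rule fmeas_integrable[OF nu bdd_borel_const])
    show "AE y in \<nu>. (\<lambda>k. f (y - s k)) \<longlonglongrightarrow> f (y - t)"
      by (intro AE_I2 isCont_tendsto_compose[OF c] tendsto_diff tendsto_const s)
    show "AE y in \<nu>. norm (f (y - s k)) \<le> B" for k using B by simp
    show "(\<lambda>y. f (y - s k)) \<in> borel_measurable \<nu>" for k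
      by (rule fmeas_measurable[OF nu bdd_borel_measurable[OF bdd_borel_shift[OF fBM]]])
    show "(\<lambda>y. f (y - t)) \<in> borel_measurable \<nu>"
      by (rule fmeas_measurable[OF nu bdd_borel_measurable[OF bdd_borel_shift[OF fBM]]])
  qed
qed

context queue_sequence
begin

lemma inflow_increment_abs:
  assumes s: "0 \<le> s" "0 \<le> t" and f: "f \<in> bdd_borel" "\<And>x. \<bar>f x\<bar> \<le> B" and B: "B > 0"
  shows "\<bar>pair (inflow lam_lim \<alpha>_lim s) f - pair (inflow lam_lim \<alpha>_lim t) f\<bar> \<le> B * (lam_lim * \<bar>s - t\<bar>)"
proof -
  let ?g = "\<lambda>x. (1 / B) * f x"
  have g: "?g \<in> bdd_borel" by (rule bdd_borel_mult[OF f(1)])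
  have g1: "\<bar>?g x\<bar> \<le> 1" for x using f(2)[of x] B by (simp add: abs_mult)
  have "\<bar>pair (inflow lam_lim \<alpha>_lim s) ?g - pair (inflow lam_lim \<alpha>_lim t) ?g\<bar> \<le> lam_lim * \<bar>s - t\<bar>"
    using inflow_increment[OF s(1) _ g g1, of t] inflow_increment[OF s(2) _ g g1, of s]
    by (cases "s \<le> t") (auto simp: abs_minus_commute)
  then have "\<bar>pair (inflow lam_lim \<alpha>_lim s) f - pair (inflow lam_lim \<alpha>_lim t) f\<bar> / B \<le> lam_lim * \<bar>s - t\<bar>"
    unfolding pair_mult right_diff_distrib[symmetric] abs_mult using B by simp
  then show ?thesis using B by (simp add: field_simps)
qed

text \<open>m is constrained only through its pairings at times t >= 0, because the theorem makes
  its claim for every path with these pairings.\<close>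

context
  fixes \<mu> :: "real measure" and m :: "real \<Rightarrow> real measure"
  assumes mu: "\<mu> \<in> fmeas"
    and m_fmeas: "\<And>t. t \<ge> 0 \<Longrightarrow> m t \<in> fmeas"
    and m_pair: "\<And>t f. t \<ge> 0 \<Longrightarrow> f \<in> Db \<Longrightarrow> pair (m t) f = pair \<mu> (\<lambda>y. f (y - t)) + pair (inflow lam_lim \<alpha>_lim t) (\<lambda>y. f (y - t))"
begin

text \<open>The increment splits into a change of the inflow under the same test function, bounded
  by the added mass, and a shift of the test function under a fixed measure, where dominated
  convergence applies.\<close>

lemma limit_weakly_continuous:
  assumes s: "\<And>k. s k \<ge> 0" "s \<longlonglongrightarrow> t" and t: "t \<ge> 0"
  shows "wconv (\<lambda>k. m (s k)) (m t)"
  unfolding wconv_def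
proof
  fix f assume f: "f \<in> Cb"
  let ?F = "inflow lam_lim \<alpha>_lim"
  have fD: "f \<in> Db" and fBM: "f \<in> bdd_borel" using Cb_Db[OF f] Db_bdd_borel by auto
  obtain B0 where B0: "B0 \<ge> 0" "\<And>x. \<bar>f x\<bar> \<le> B0" using bdd_borel_bound[OF fBM] by metis
  define B where "B = B0 + 1"
  have B: "B > 0" "\<And>x. \<bar>f x\<bar> \<le> B" using B0(1) order_trans[OF B0(2)] by (auto simp: B_def)
  have "(\<lambda>k. B * (lam_lim * \<bar>s k - t\<bar>)) \<longlonglongrightarrow> B * (lam_lim * \<bar>t - t\<bar>)"
    by (intro tendsto_mult tendsto_const tendsto_rabs tendsto_diff s)
  then have z: "(\<lambda>k. B * (lam_lim * \<bar>s k - t\<bar>)) \<longlonglongrightarrow> 0" by simp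
  have "(\<lambda>k. pair (?F (s k)) (\<lambda>y. f (y - s k)) - pair (?F t) (\<lambda>y. f (y - s k))) \<longlonglongrightarrow> 0"
    by (rule Lim_null_comparison[OF _ z])
       (intro always_eventually allI, unfold real_norm_def, intro inflow_increment_abs s t bdd_borel_shift fBM B)
  from tendsto_add[OF this pair_shift_tendsto[OF inflow_in[OF t] f s(2)]]
  have "(\<lambda>k. pair (?F (s k)) (\<lambda>y. f (y - s k))) \<longlonglongrightarrow> pair (?F t) (\<lambda>y. f (y - t))" by simp
  from tendsto_add[OF pair_shift_tendsto[OF mu f s(2)] this]
  show "(\<lambda>k. pair (m (s k)) f) \<longlonglongrightarrow> pair (m t) f"
    by (simp add: m_pair[OF s(1) fD] m_pair[OF t fD])
qed

text \<open>Mass already present moves at unit speed and new mass enters at rate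
  \<open>lam_lim\<close>; a function in \<open>unit_lip\<close> feels both linearly in time.\<close>

lemma limit_lipschitz:
  assumes s: "s \<ge> 0" and t: "t \<ge> 0"
  shows "dBL (m s) (m t) \<le> (measure \<mu> UNIV + measure (inflow lam_lim \<alpha>_lim t) UNIV + lam_lim) * \<bar>s - t\<bar>"
proof (rule dBL_le)
  fix f assume f: "f \<in> unit_lip"
  let ?F = "inflow lam_lim \<alpha>_lim"
  have fl: "\<bar>f (y - s) - f (y - t)\<bar> \<le> \<bar>s - t\<bar>" for y
  proof -
    have "\<bar>f (y - s) - f (y - t)\<bar> \<le> \<bar>(y - s) - (y - t)\<bar>" using f unfolding unit_lip_def by blast
    then show ?thesis by simp
  qed
  have fBM: "(\<lambda>y. f (y - u)) \<in> bdd_borel" for u by (intro bdd_borel_shift unit_lip_bdd_borel f)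
  have f1: "\<bar>f x\<bar> \<le> 1" for x using f by (simp add: unit_lip_def)
  have lip: "\<bar>pair \<nu> (\<lambda>y. f (y - s)) - pair \<nu> (\<lambda>y. f (y - t))\<bar> \<le> \<bar>s - t\<bar> * measure \<nu> UNIV" if "\<nu> \<in> fmeas" for \<nu>
    unfolding pair_diff[OF that fBM fBM, symmetric] by (intro pair_bound that bdd_borel_diff fBM fl)
  have D: "f \<in> Db" by (intro bdd_lip_Db unit_lip_bdd_lip f)
  have "\<bar>pair (?F s) (\<lambda>y. f (y - s)) - pair (?F t) (\<lambda>y. f (y - s))\<bar> \<le> 1 * (lam_lim * \<bar>s - t\<bar>)"
    by (intro inflow_increment_abs s t fBM f1) simp
  then have "\<bar>pair (m s) f - pair (m t) f\<bar> \<le> \<bar>s - t\<bar> * measure \<mu> UNIV + \<bar>s - t\<bar> * measure (?F t) UNIV + lam_lim * \<bar>s - t\<bar>"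
    using lip[OF mu] lip[OF inflow_in[OF t]] unfolding m_pair[OF s D] m_pair[OF t D] by linarith
  then show "\<bar>pair (m s) f - pair (m t) f\<bar> \<le> (measure \<mu> UNIV + measure (?F t) UNIV + lam_lim) * \<bar>s - t\<bar>"
    by (simp add: algebra_simps)
qed

lemma limit_Dspace: "m \<in> Dspace"
proof -
  have lim: "((\<lambda>s. dBL (m s) (m t)) \<longlongrightarrow> 0) (at t within A)"
    if t: "t \<ge> 0" and pos: "\<forall>\<^sub>F s in at t within A. s \<ge> 0" for t A
  proof (rule real_tendsto_sandwich[OF _ _ tendsto_const])
    let ?c = "measure \<mu> UNIV + measure (inflow lam_lim \<alpha>_lim t) UNIV + lam_lim"
    show "\<forall>\<^sub>F s in at t within A. 0 \<le> dBL (m s) (m t)"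
      using pos by eventually_elim (intro dBL_nonneg m_fmeas t)
    show "\<forall>\<^sub>F s in at t within A. dBL (m s) (m t) \<le> ?c * \<bar>s - t\<bar>"
      using pos by eventually_elim (rule limit_lipschitz[OF _ t])
    have "((\<lambda>s. ?c * \<bar>s - t\<bar>) \<longlongrightarrow> ?c * \<bar>t - t\<bar>) (at t within A)"
      by (intro tendsto_mult tendsto_const tendsto_rabs tendsto_diff tendsto_ident_at)
    then show "((\<lambda>s. ?c * \<bar>s - t\<bar>) \<longlongrightarrow> 0) (at t within A)" by simp
  qed
  show ?thesis unfolding Dspace_def
  proof (intro CollectI conjI allI impI)
    fix t :: real assume t: "0 \<le> t"
    show "m t \<in> fmeas" by (rule m_fmeas[OF t])
    show "((\<lambda>s. dBL (m s) (m t)) \<longlongrightarrow> 0) (at_right t)"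
      by (rule lim[OF t]) (use t in \<open>auto simp: eventually_at_right_field intro!: exI[of _ "t + 1"]\<close>)
  next
    fix t :: real assume t: "0 < t"
    have "((\<lambda>s. dBL (m s) (m t)) \<longlongrightarrow> 0) (at_left t)"
      by (rule lim) (use t in \<open>auto simp: eventually_at_left_field intro!: exI[of _ 0]\<close>)
    then show "\<exists>\<nu>\<in>fmeas. ((\<lambda>s. dBL (m s) \<nu>) \<longlongrightarrow> 0) (at_left t)"
      using m_fmeas[of t] t by auto
  qed
qed

text \<open>Translations preserve \<open>unit_lip\<close>, so the common shift by t disappears from
  both parts. The initial term on the right does not depend on t, and its convergence is uniform in
  time at once.\<close>

lemma nprof_dBL_le:
  assumes nu: "\<nu> \<in> fmeas" and n: "n > 0" and t: "t \<ge> 0"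
  shows "dBL (nprof n \<nu> T' \<sigma>' t) (m t) \<le> dBL (nrm n \<nu>) \<mu> + dBL (arrival_meas n T' \<sigma>' t) (inflow lam_lim \<alpha>_lim t)"
proof (rule dBL_le)
  fix f assume f: "f \<in> unit_lip"
  have ft: "(\<lambda>y. f (y - t)) \<in> unit_lip" by (rule unit_lip_shift[OF f])
  have "\<bar>pair (nrm n \<nu>) (\<lambda>y. f (y - t)) - pair \<mu> (\<lambda>y. f (y - t))\<bar> \<le> dBL (nrm n \<nu>) \<mu>"
    by (rule dBL_ge[OF nrm_fmeas[OF nu] mu ft])
  moreover have "\<bar>pair (arrival_meas n T' \<sigma>' t) (\<lambda>y. f (y - t)) - pair (inflow lam_lim \<alpha>_lim t) (\<lambda>y. f (y - t))\<bar>
      \<le> dBL (arrival_meas n T' \<sigma>' t) (inflow lam_lim \<alpha>_lim t)"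
    by (rule dBL_ge[OF arrival_meas_fmeas inflow_in[OF t] ft])
  ultimately show "\<bar>pair (nprof n \<nu> T' \<sigma>' t) f - pair (m t) f\<bar>
      \<le> dBL (nrm n \<nu>) \<mu> + dBL (arrival_meas n T' \<sigma>' t) (inflow lam_lim \<alpha>_lim t)"
    unfolding nprof_pair[OF nu unit_lip_bdd_borel[OF f] n] m_pair[OF t bdd_lip_Db[OF unit_lip_bdd_lip[OF f]]] by linarith
qed

text \<open>Off an event of small probability the path is close to m throughout [0,T0] and F differs
  from its value at m by at most e/2; on that event boundedness of F limits the difference to
  2B.\<close>

lemma nprof_conv_dist:
  fixes \<mu>0 :: "nat \<Rightarrow> 'a \<Rightarrow> real measure"
  assumes mu0_meas: "\<And>n \<omega>. n > 0 \<Longrightarrow> \<omega> \<in> space (M n) \<Longrightarrow> \<mu>0 n \<omega> \<in> fmeas"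
    and mu0_rv: "\<And>n B. n > 0 \<Longrightarrow> B \<in> sets borel \<Longrightarrow> (\<lambda>\<omega>. emeasure (\<mu>0 n \<omega>) B) \<in> borel_measurable (M n)"
    and mu0_conv: "\<And>f. f \<in> bdd_lip \<Longrightarrow> conv0_prob M (\<lambda>n \<omega>. pair (nrm n (\<mu>0 n \<omega>)) f - pair \<mu> f)"
  shows "conv_dist_D M (\<lambda>n \<omega> t. nprof n (\<mu>0 n \<omega>) (T n \<omega>) (S n \<omega>) t) m"
  unfolding conv_dist_D_def
proof (intro allI impI, elim conjE)
  fix F :: "(real \<Rightarrow> real measure) \<Rightarrow> real"
  assume "\<exists>B. \<forall>y\<in>Dspace. \<bar>F y\<bar> \<le> B"
    and "\<forall>ys y. (\<forall>k. ys k \<in> Dspace) \<and> y \<in> Dspace \<and> skor_conv ys y \<longrightarrow> (\<lambda>k. F (ys k)) \<longlonglongrightarrow> F y"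
  then obtain B where B: "\<And>y. y \<in> Dspace \<Longrightarrow> \<bar>F y\<bar> \<le> B" and F: "skor_cont F"
    by (auto simp: skor_cont_def)
  have B0: "B \<ge> 0" using B[OF limit_Dspace] by linarith
  let ?X = "\<lambda>n \<omega>. nprof n (\<mu>0 n \<omega>) (T n \<omega>) (S n \<omega>)"
  let ?h = "\<lambda>n \<omega>. indicator {\<omega>. ?X n \<omega> \<in> Dspace} \<omega> * F (?X n \<omega>)"
  have hm: "?h n \<in> borel_measurable (M n)" if n: "n > 0" for n
  proof (rule skor_measurable[OF F])
    show "?X n \<omega> t \<in> fmeas" if "\<omega> \<in> space (M n)" for \<omega> t
      by (rule nprof_fmeas[OF mu0_meas[OF n that]])
    show "{\<omega> \<in> space (M n). ?X n \<omega> \<in> Dspace} \<in> sets (M n)"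
      by (rule nprof_Dspace_measurable[OF mu0_meas[OF n] n T_measurable[OF n]])
    fix t f assume f: "f \<in> bdd_lip"
    have fs: "(\<lambda>y. f (y - t)) \<in> bdd_borel" by (intro bdd_borel_shift bdd_lip_bdd_borel f)
    have "(\<lambda>\<omega>. pair (nrm n (\<mu>0 n \<omega>)) (\<lambda>y. f (y - t)) + pair (arrival_meas n (T n \<omega>) (S n \<omega>) t) (\<lambda>y. f (y - t))) \<in> borel_measurable (M n)"
      by (intro borel_measurable_add nrm_pair_measurable arrival_meas_pair_measurable mu0_meas mu0_rv n fs T_measurable \<sigma>_measurable)
    then show "(\<lambda>\<omega>. pair (?X n \<omega> t) f) \<in> borel_measurable (M n)"
      by (rule measurable_cong[THEN iffD1, rotated]) (rule nprof_pair[OF mu0_meas[OF n] bdd_lip_bdd_borel[OF f] n, symmetric])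
  qed
  show "(\<lambda>n. \<integral>\<omega>. ?h n \<omega> \<partial>M n) \<longlonglongrightarrow> F m"
  proof (rule tendstoI)
    fix e :: real assume e: "e > 0"
    obtain T0 d where Td: "T0 > 0" "d > 0"
      "\<And>y. y \<in> Dspace \<Longrightarrow> (\<And>t. t \<in> {0..T0} \<Longrightarrow> dBL (y t) (m t) \<le> d) \<Longrightarrow> \<bar>F y - F m\<bar> \<le> e / 2"
      using skor_cont_locally_uniform[OF F limit_Dspace, of "e / 2"] e by auto
    \<comment> \<open>Two exceptional sets of probability at most q, with difference at most 2B,
      cost 4 B q in total; B + 1 avoids a division by zero when B = 0.\<close>
    define q where "q = e / (8 * (B + 1))"
    have q: "q > 0" "4 * B * q < e / 2" using e B0 by (auto simp: q_def field_simps)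
    have "conv0_prob M (\<lambda>n \<omega>. dBL (nrm n (\<mu>0 n \<omega>)) \<mu>)"
      by (intro conv0_prob_dBL mu nrm_fmeas mu0_meas mu0_conv)
    from conv0_probD[OF this, of "d / 2" q] Td(2) q(1)
    have "\<forall>\<^sub>F n in sequentially. \<exists>A\<in>sets (M n). measure (M n) A \<le> q \<and>
      (\<forall>\<omega>\<in>space (M n) - A. \<bar>dBL (nrm n (\<mu>0 n \<omega>)) \<mu>\<bar> \<le> d / 2)" by simp
    moreover have "\<forall>\<^sub>F n in sequentially. \<exists>A\<in>sets (M n). measure (M n) A \<le> q \<and>
     (\<forall>\<omega>\<in>space (M n) - A. good_arr (\<lambda>k. E n k \<omega>) \<longrightarrow>
        (\<forall>t\<in>{0..T0}. dBL (arrival_meas n (T n \<omega>) (S n \<omega>) t) (inflow lam_lim \<alpha>_lim t) \<le> d / 2))"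
      by (rule arrival_meas_uniform) (use Td q in auto)
    ultimately show "\<forall>\<^sub>F n in sequentially. dist (\<integral>\<omega>. ?h n \<omega> \<partial>M n) (F m) < e"
      using ev_pos
    proof eventually_elim
      case (elim n)
      then obtain A1 A2 where A1: "A1 \<in> sets (M n)" "measure (M n) A1 \<le> q"
          "\<And>\<omega>. \<omega> \<in> space (M n) - A1 \<Longrightarrow> \<bar>dBL (nrm n (\<mu>0 n \<omega>)) \<mu>\<bar> \<le> d / 2"
        and A2: "A2 \<in> sets (M n)" "measure (M n) A2 \<le> q"
          "\<And>\<omega> t. \<omega> \<in> space (M n) - A2 \<Longrightarrow> good_arr (\<lambda>k. E n k \<omega>) \<Longrightarrow> t \<in> {0..T0} \<Longrightarrow>
             dBL (arrival_meas n (T n \<omega>) (S n \<omega>) t) (inflow lam_lim \<alpha>_lim t) \<le> d / 2"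
        by blast
      have n: "n > 0" by (rule elim(3))
      interpret prob_space "M n" by (rule prob[OF n])
      define A where "A = A1 \<union> A2"
      have A: "A \<in> sets (M n)" "measure (M n) A \<le> 2 * q"
        using measure_Un_le[OF A1(1) A2(1)] A1 A2 by (auto simp: A_def)
      \<comment> \<open>Almost surely the arrivals do not accumulate, so the path is in
        \<open>Dspace\<close>, the indicator is 1 and F may be estimated directly.\<close>
      have ae: "AE \<omega> in M n. \<bar>?h n \<omega> - F m\<bar> \<le> e / 2 + 2 * B * indicator A \<omega>"
        using AE_good[OF n] AE_space
      proof eventually_elim
        case (elim \<omega>)
        have D: "?X n \<omega> \<in> Dspace"
          by (rule cadlag_count_imp[OF mu0_meas[OF n elim(2)] n good_arr_cadlag_count[OF elim(1) n]])
        then have h: "?h n \<omega> = F (?X n \<omega>)" by simp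
        show ?case
        proof (cases "\<omega> \<in> A")
          case True
          then show ?thesis using B[OF D] B[OF limit_Dspace] e unfolding h by simp
        next
          case False
          have "dBL (?X n \<omega> t) (m t) \<le> d" if t: "t \<in> {0..T0}" for t
          proof -
            have "dBL (nrm n (\<mu>0 n \<omega>)) \<mu> \<le> d / 2" using A1(3)[of \<omega>] False elim(2) by (simp add: A_def)
            moreover have "dBL (arrival_meas n (T n \<omega>) (S n \<omega>) t) (inflow lam_lim \<alpha>_lim t) \<le> d / 2"
              using A2(3)[of \<omega> t] False elim t by (simp add: A_def)
            ultimately show ?thesis
              using nprof_dBL_le[OF mu0_meas[OF n elim(2)] n, of t "T n \<omega>" "S n \<omega>"] t by simp
          qed
          from Td(3)[OF D this] show ?thesis using False unfolding h by simp
        qed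
      qed
      have hb: "AE \<omega> in M n. norm (?h n \<omega>) \<le> B"
        using B B0 by (intro AE_I2) (auto simp: indicator_def)
      have hi: "integrable (M n) (?h n)" by (rule integrable_const_bound[OF hb hm[OF n]])
      have bi: "integrable (M n) (\<lambda>\<omega>. e / 2 + 2 * B * indicator A \<omega>)"
        using A(1) by (intro Bochner_Integration.integrable_add integrable_const integrable_mult_right integrable_real_indicator) (auto simp: less_top[symmetric])
      have "(\<integral>\<omega>. ?h n \<omega> \<partial>M n) - F m = (\<integral>\<omega>. ?h n \<omega> - F m \<partial>M n)"
        using hi by (simp add: prob_space)
      then have "\<bar>(\<integral>\<omega>. ?h n \<omega> \<partial>M n) - F m\<bar> \<le> (\<integral>\<omega>. \<bar>?h n \<omega> - F m\<bar> \<partial>M n)"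
        by (simp only: integral_abs_bound)
      also have "\<dots> \<le> (\<integral>\<omega>. e / 2 + 2 * B * indicator A \<omega> \<partial>M n)"
        by (rule integral_mono_AE[OF _ bi ae]) (use hi in auto)
      also have "\<dots> = e / 2 + 2 * B * measure (M n) A"
        using A(1) by (subst Bochner_Integration.integral_add) (auto simp: prob_space less_top[symmetric])
      also have "\<dots> \<le> e / 2 + 2 * B * (2 * q)"
        using A(2) B0 by (intro add_left_mono mult_left_mono) auto
      also have "\<dots> < e" using q(2) by simp
      finally show ?case by (simp add: dist_real_def)
    qed
  qed
qed

end

end

theorem theorem2:
  fixes M :: "nat \<Rightarrow> 'a measure"
    and \<mu>0 :: "nat \<Rightarrow> 'a \<Rightarrow> real measure"
    and E \<sigma> :: "nat \<Rightarrow> nat \<Rightarrow> 'a \<Rightarrow> real"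
    and lam :: "nat \<Rightarrow> real" and lam_lim :: real
    and \<alpha> :: "nat \<Rightarrow> real measure"
    and \<mu>0_lim \<alpha>_lim :: "real measure"
  assumes prob: "\<And>n. n > 0 \<Longrightarrow> prob_space (M n)"
    and mu0_meas: "\<And>n \<omega>. n > 0 \<Longrightarrow> \<omega> \<in> space (M n) \<Longrightarrow> \<mu>0 n \<omega> \<in> fmeas"
    and mu0_rv: "\<And>n B. n > 0 \<Longrightarrow> B \<in> sets borel \<Longrightarrow>
                   (\<lambda>\<omega>. emeasure (\<mu>0 n \<omega>) B) \<in> borel_measurable (M n)"
    and lam_pos: "\<And>n. n > 0 \<Longrightarrow> lam n > 0"
    and E_exp: "\<And>n k. n > 0 \<Longrightarrow> distributed (M n) lborel (E n k) (exponential_density (lam n))"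
    and sigma_law: "\<And>n k. n > 0 \<Longrightarrow> \<sigma> n k \<in> borel_measurable (M n)
                         \<and> distr (M n) borel (\<sigma> n k) = \<alpha> n"
    and indep: "\<And>n. n > 0 \<Longrightarrow> prob_space.indep_vars (M n) (\<lambda>_. borel)
                   (\<lambda>i. case i of Inl k \<Rightarrow> E n k | Inr k \<Rightarrow> \<sigma> n k) UNIV"
    and alpha_prob: "\<And>n. n > 0 \<Longrightarrow> prob_space (\<alpha> n) \<and> sets (\<alpha> n) = sets borel"
    and alpha_nonatomic: "\<And>n. n > 0 \<Longrightarrow> nonatomic (\<alpha> n)"
    and alpha_I: "\<And>n. n > 0 \<Longrightarrow> pairI (\<alpha> n) < \<infinity>"
    and lam_conv: "lam \<longlonglongrightarrow> lam_lim" and lam_lim_pos: "lam_lim > 0"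
    and tight: "\<forall>\<epsilon>>0. \<exists>C>0. \<forall>n>0.
                   prob_space.prob (M n) {\<omega>\<in>space (M n). measure (\<mu>0 n \<omega>) UNIV > real n * C} \<le> \<epsilon>"
    and mu0_lim: "\<mu>0_lim \<in> fmeas" and mu0_lim_I: "pairI \<mu>0_lim < \<infinity>"
    and mu0_conv: "\<forall>f\<in>Db. \<forall>\<delta>>0. (\<lambda>n. prob_space.prob (M n)
                     {\<omega>\<in>space (M n). \<bar>pair (nrm n (\<mu>0 n \<omega>)) f - pair \<mu>0_lim f\<bar> > \<delta>}) \<longlonglongrightarrow> 0"
    and alpha_lim: "prob_space \<alpha>_lim \<and> sets \<alpha>_lim = sets borel" "nonatomic \<alpha>_lim"
    and alpha_conv: "wconv (\<lambda>n. distr (\<alpha> n) borel (\<lambda>x. x / real n)) \<alpha>_lim"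
    and alpha_I_conv: "(\<lambda>n. pairI (distr (\<alpha> n) borel (\<lambda>x. x / real n))) \<longlonglongrightarrow> pairI \<alpha>_lim"
    and alpha_lim_I: "pairI \<alpha>_lim < \<infinity>"
  shows "(\<exists>m. \<forall>t\<ge>0. m t \<in> fmeas \<and>
            (\<forall>\<phi>\<in>Db. pair (m t) \<phi> = pair \<mu>0_lim (\<lambda>y. \<phi> (y - t))
                 + lam_lim * (LBINT s=0..t. pair \<alpha>_lim (\<lambda>y. \<phi> (y - s)))))
       \<and> (\<forall>m. (\<forall>t\<ge>0. m t \<in> fmeas \<and>
            (\<forall>\<phi>\<in>Db. pair (m t) \<phi> = pair \<mu>0_lim (\<lambda>y. \<phi> (y - t))
                 + lam_lim * (LBINT s=0..t. pair \<alpha>_lim (\<lambda>y. \<phi> (y - s)))))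
          \<longrightarrow> (\<forall>t\<ge>0. \<forall>ts. (\<forall>k. ts k \<ge> 0) \<and> ts \<longlonglongrightarrow> t \<longrightarrow> wconv (\<lambda>k. m (ts k)) (m t))
            \<and> conv_dist_D M (\<lambda>n \<omega> t. nprof n (\<mu>0 n \<omega>) (arr (\<lambda>k. E n k \<omega>)) (\<lambda>k. \<sigma> n k \<omega>) t) m)"
proof -
  interpret Q: queue_sequence M E \<sigma> lam lam_lim \<alpha> \<alpha>_lim
    by (rule queue_sequence.intro) (fact prob lam_pos E_exp sigma_law indep alpha_prob lam_conv lam_lim_pos alpha_lim(1) alpha_conv)+
  let ?F = "inflow lam_lim \<alpha>_lim"
  have shift: "pair (?F t) (\<lambda>z. \<phi> (z - t)) = lam_lim * (LBINT s=0..t. pair \<alpha>_lim (\<lambda>y. \<phi> (y - s)))"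
    if "t \<ge> 0" "\<phi> \<in> Db" for t \<phi>
    using inflow_shift[of \<alpha>_lim lam_lim t \<phi>] alpha_lim(1) lam_lim_pos that Db_bdd_borel by simp
  have conv: "conv0_prob M (\<lambda>n \<omega>. pair (nrm n (\<mu>0 n \<omega>)) f - pair \<mu>0_lim f)" if f: "f \<in> bdd_lip" for f
    unfolding conv0_prob_def
  proof (intro allI impI)
    fix d e :: real assume "d > 0" "e > 0"
    let ?A = "\<lambda>n. {\<omega>\<in>space (M n). \<bar>pair (nrm n (\<mu>0 n \<omega>)) f - pair \<mu>0_lim f\<bar> > d}"
    have "(\<lambda>n. measure (M n) (?A n)) \<longlonglongrightarrow> 0" using mu0_conv bdd_lip_Db[OF f] \<open>d > 0\<close> by blast
    then have "\<forall>\<^sub>F n in sequentially. measure (M n) (?A n) < e" by (rule order_tendstoD(2)) fact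
    then show "\<forall>\<^sub>F n in sequentially. \<exists>A\<in>sets (M n). measure (M n) A \<le> e \<and>
       (\<forall>\<omega>\<in>space (M n) - A. \<bar>pair (nrm n (\<mu>0 n \<omega>)) f - pair \<mu>0_lim f\<bar> \<le> d)"
      using Q.ev_pos
    proof eventually_elim
      case (elim n)
      have [measurable]: "(\<lambda>\<omega>. pair (nrm n (\<mu>0 n \<omega>)) f) \<in> borel_measurable (M n)"
        by (intro nrm_pair_measurable mu0_meas mu0_rv elim(2) bdd_lip_bdd_borel f)
      \<comment> \<open>A non-measurable set would have \<open>measure\<close> 0 by convention, so
        the smallness of its measure is informative only together with this membership.\<close>
      have "?A n \<in> sets (M n)" by measurable
      then show ?case using elim(1) by (intro bexI[of _ "?A n"]) auto
    qed
  qed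
  show ?thesis
  proof (intro conjI allI impI)
    \<comment> \<open>Both parts are translated by t, since the inflow was built in the frame that
      does not move with time.\<close>
    define m where "m t = measure_sum (distr \<mu>0_lim borel (\<lambda>y. y - t)) (distr (?F t) borel (\<lambda>y. y - t))" for t
    have "m t \<in> fmeas \<and> (\<forall>\<phi>\<in>Db. pair (m t) \<phi> = pair \<mu>0_lim (\<lambda>y. \<phi> (y - t))
                 + lam_lim * (LBINT s=0..t. pair \<alpha>_lim (\<lambda>y. \<phi> (y - s))))" if t: "t \<ge> 0" for t
    proof -
      have d: "distr \<mu>0_lim borel (\<lambda>y. y - t) \<in> fmeas" "distr (?F t) borel (\<lambda>y. y - t) \<in> fmeas"
        using mu0_lim Q.inflow_in[OF t] by (auto intro!: distr_fmeas)
      show ?thesis unfolding m_def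
        using d mu0_lim Q.inflow_in[OF t]
        by (auto simp: measure_sum_fmeas pair_measure_sum Db_bdd_borel pair_distr shift[OF t])
    qed
    then show "\<exists>m. \<forall>t\<ge>0. m t \<in> fmeas \<and>
            (\<forall>\<phi>\<in>Db. pair (m t) \<phi> = pair \<mu>0_lim (\<lambda>y. \<phi> (y - t))
                 + lam_lim * (LBINT s=0..t. pair \<alpha>_lim (\<lambda>y. \<phi> (y - s))))" by blast
  next
    fix m and t and ts :: "nat \<Rightarrow> real"
    assume m: "\<forall>t\<ge>0. m t \<in> fmeas \<and> (\<forall>\<phi>\<in>Db. pair (m t) \<phi> = pair \<mu>0_lim (\<lambda>y. \<phi> (y - t))
                 + lam_lim * (LBINT s=0..t. pair \<alpha>_lim (\<lambda>y. \<phi> (y - s))))"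
      and t: "0 \<le> t" and ts: "(\<forall>k. 0 \<le> ts k) \<and> ts \<longlonglongrightarrow> t"
    show "wconv (\<lambda>k. m (ts k)) (m t)"
      by (rule Q.limit_weakly_continuous[OF mu0_lim]) (use m shift t ts in auto)
  next
    fix m
    assume m: "\<forall>t\<ge>0. m t \<in> fmeas \<and> (\<forall>\<phi>\<in>Db. pair (m t) \<phi> = pair \<mu>0_lim (\<lambda>y. \<phi> (y - t))
                 + lam_lim * (LBINT s=0..t. pair \<alpha>_lim (\<lambda>y. \<phi> (y - s))))"
    show "conv_dist_D M (\<lambda>n \<omega> t. nprof n (\<mu>0 n \<omega>) (arr (\<lambda>k. E n k \<omega>)) (\<lambda>k. \<sigma> n k \<omega>) t) m"
      by (rule Q.nprof_conv_dist[OF mu0_lim]) (use m shift mu0_meas mu0_rv conv in auto)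
  qed
qed

end
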